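(* Let $H:T^*\mathbb{T}^d\to\mathbb{R}$ be a Tonelli Hamiltonian with Hamiltonian flow $(\varphi_t)$ and let $\mathcal{T}\subset T^*\mathbb{T}^d$ be a Lipschitz $d$-dimensional torus that is invariant by $(\varphi_t)$. Assume that: (1) for one $T>0$, the time-$T$ map $\varphi_T$ restricted to $\mathcal{T}$ is Lipschitz conjugated to a (not necessarily ergodic) rotation of $\mathbb{T}^d$; (2) all the orbits of $(\varphi_t)$ that are contained in $\mathcal{T}$ have no conjugate points. Then $\mathcal{T}$ is Lagrangian and is the graph of a $C^1$ function (i.e. there is a $C^1$ map $s:\mathbb{T}^d\to\mathbb{R}^d$ with $\mathcal{T}=\{(q,s(q)):q\in\mathbb{T}^d\}$).
   Context: $\mathbb{T}=\mathbb{R}/\mathbb{Z}$ and $T^*\mathbb{T}^d=\mathbb{T}^d\times\mathbb{R}^d$ carries its usual symplectic form; $\pi$ is the projection to $\mathbb{T}^d$. A $C^2$ function $H:T^*\mathbb{T}^d\to\mathbb{R}$ is a Tonelli Hamiltonian if it is superlinear in the fiber ($\forall A\in\mathbb{R}, \exists B\in\mathbb{R}, \forall (q,p)$, $\|p\|\ge B\Rightarrow H(q,p)\ge A\|p\|$) and $C^2$-convex in the fiber (at every $(q,p)$ the Hessian $\frac{\partial^2H}{\partial p^2}(q,p)$ is positive definite). The vertical subspace at $x$ is $V(x)=\ker D\pi(x)$. An orbit of $(\varphi_t)$ has no conjugate points if for every $x$ in the orbit and every $t\neq 0$, $D\varphi_t(V(x))\cap V(\varphi_t(x))=\{0\}$.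 A Lipschitz $d$-dimensional submanifold is a subset that is locally, in suitable smooth charts, the graph of a Lipschitz map defined on an open subset of $\mathbb{R}^d$; a Lipschitz torus is such a submanifold homeomorphic to $\mathbb{T}^d$. A rotation of $\mathbb{T}^d$ is a translation $\theta\mapsto\theta+a$. Lipschitz conjugated means conjugated by a bi-Lipschitz homeomorphism $\mathbb{T}^d\to\mathcal{T}$. *)

theory Defs
  imports "HOL-Analysis.Analysis"
begin

text \<open>
  The circle \<open>\<real>/\<int>\<close>, with its group structure and its quotient metric. The torus of dimension
  \<open>CARD('n)\<close> is then the type \<open>circle ^ 'n\<close>, which inherits group structure, topology and
  (Euclidean product) metric from the library instances for \<open>vec\<close>.
\<close>

quotient_type circle = real / "\<lambda>x y. x - y \<in> \<int>"
  morphisms rep_circle circle_of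
proof (rule equivpI)
  show "reflp (\<lambda>x y::real. x - y \<in> \<int>)"
    by (simp add: reflp_def)
  show "symp (\<lambda>x y::real. x - y \<in> \<int>)"
    by (metis (mono_tags, lifting) Ints_minus minus_diff_eq sympI)
  show "transp (\<lambda>x y::real. x - y \<in> \<int>)"
    by (rule transpI) (metis Ints_add diff_add_cancel add_diff_eq)
qed

instantiation circle :: ab_group_add
begin

lift_definition zero_circle :: circle is 0 .

lift_definition plus_circle :: "circle \<Rightarrow> circle \<Rightarrow> circle" is "(+)"
  by (metis Ints_add add_diff_add)

lift_definition uminus_circle :: "circle \<Rightarrow> circle" is uminus
  by (metis Ints_minus minus_diff_eq minus_diff_minus)

lift_definition minus_circle :: "circle \<Rightarrow> circle \<Rightarrow> circle" is "(-)"
  by (metis Ints_diff add_diff_add diff_add_eq_diff_diff_swap diff_diff_eq2 add_diff_eq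
      diff_add_eq add.commute)

instance
  by standard (transfer, simp add: algebra_simps)+

end

lemma infdist_Ints_attained:
  fixes x :: real
  obtains k where "k \<in> \<int>" "infdist x \<int> = dist x k"
proof -
  have "(\<int>::real set) \<noteq> {}"
    using Ints_0 by blast
  then show ?thesis
    using infdist_attains_inf[OF closed_Ints] that by blast
qed

lemma infdist_Ints_shift:
  fixes x y :: real
  assumes "x - y \<in> \<int>"
  shows "infdist x \<int> \<le> infdist y \<int>"
proof -
  obtain k where k: "k \<in> \<int>" "infdist y \<int> = dist y k"
    using infdist_Ints_attained by blast
  have "infdist x \<int> \<le> dist x (k + (x - y))"
    using k assms by (intro infdist_le) auto
  then show ?thesis
    using k by (simp add: dist_real_def)
qed

lemma infdist_Ints_add:
  fixes x y :: real
  shows "infdist (x + y) \<int> \<le> infdist x \<int> + infdist y \<int>"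
proof -
  obtain k l where k: "k \<in> \<int>" "infdist x \<int> = dist x k"
    and l: "l \<in> \<int>" "infdist y \<int> = dist y l"
    using infdist_Ints_attained by metis
  have "infdist (x + y) \<int> \<le> dist (x + y) (k + l)"
    using k l by (intro infdist_le) auto
  also have "\<dots> \<le> dist x k + dist y l"
    by (simp add: dist_real_def)
  finally show ?thesis
    using k l by simp
qed

lemma infdist_Ints_minus:
  fixes x :: real
  shows "infdist (- x) \<int> \<le> infdist x \<int>"
proof -
  obtain k where k: "k \<in> \<int>" "infdist x \<int> = dist x k"
    using infdist_Ints_attained by blast
  have "infdist (- x) \<int> \<le> dist (- x) (- k)"
    using k by (intro infdist_le) auto
  then show ?thesis
    using k by (simp add: dist_real_def)
qed

instantiation circle :: metric_space
begin

lift_definition dist_circle :: "circle \<Rightarrow> circle \<Rightarrow> real" is "\<lambda>x y. infdist (x - y) \<int>"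
proof -
  fix x x' y y' :: real
  assume "x - x' \<in> \<int>" "y - y' \<in> \<int>"
  then have "(x - x') - (y - y') \<in> \<int>" and "(y - y') - (x - x') \<in> \<int>"
    by (auto intro: Ints_diff)
  then have "(x - y) - (x' - y') \<in> \<int>" "(x' - y') - (x - y) \<in> \<int>"
    by (simp_all add: algebra_simps)
  then show "infdist (x - y) \<int> = infdist (x' - y') \<int>"
    by (intro antisym infdist_Ints_shift)
qed

definition uniformity_circle :: "(circle \<times> circle) filter"
  where "uniformity_circle = (INF e\<in>{0<..}. principal {(x, y). dist x y < e})"

definition open_circle :: "circle set \<Rightarrow> bool"
  where "open_circle U \<longleftrightarrow> (\<forall>x\<in>U. eventually (\<lambda>(x', y). x' = x \<longrightarrow> y \<in> U) uniformity)"

instance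
proof
  fix x y z :: circle
  show "dist x y = 0 \<longleftrightarrow> x = y"
    by transfer
      (metis Ints_0 closed_Ints empty_iff in_closed_iff_infdist_zero)
  show "dist x y \<le> dist x z + dist y z"
  proof transfer
    fix x y z :: real
    have "infdist (x - y) \<int> \<le> infdist (x - z) \<int> + infdist (- (y - z)) \<int>"
      using infdist_Ints_add[of "x - z" "- (y - z)"] by simp
    then show "infdist (x - y) \<int> \<le> infdist (x - z) \<int> + infdist (y - z) \<int>"
      using infdist_Ints_minus[of "y - z"] by simp
  qed
qed (simp_all add: uniformity_circle_def open_circle_def)

end

lemma dist_circle_of_le: "dist (circle_of x) (circle_of y) \<le> \<bar>x - y\<bar>"
  by transfer (use infdist_le[of 0 "\<int>::real set"] in \<open>auto simp: dist_real_def\<close>)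

text \<open>The metric topology is the quotient topology.\<close>

lemma open_circle_iff_quotient: "open U \<longleftrightarrow> open (circle_of -` U)"
proof
  assume U: "open U"
  have "continuous_on UNIV circle_of"
    unfolding continuous_on_iff
    by (metis dist_circle_of_le dist_real_def le_less_trans)
  then show "open (circle_of -` U)"
    using U by (simp add: open_vimage)
next
  assume U: "open (circle_of -` U)"
  show "open U"
    unfolding open_dist
  proof
    fix c assume "c \<in> U"
    obtain x where c: "c = circle_of x"
      by (metis Quotient_abs_rep Quotient_circle)
    with \<open>c \<in> U\<close> obtain e where e: "e > 0" "\<And>y. dist y x < e \<Longrightarrow> circle_of y \<in> U"
      using U by (auto simp: open_dist)
    have "d \<in> U" if d: "dist d c < e" for d
    proof -
      obtain y where y: "d = circle_of y"
        by (metis Quotient_abs_rep Quotient_circle)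
      have "infdist (y - x) \<int> < e"
        using d unfolding c y by (simp add: dist_circle.abs_eq)
      then obtain k where k: "k \<in> \<int>" "dist (y - x) k < e"
        using infdist_Ints_attained[of "y - x"] by metis
      have "circle_of (y - k) \<in> U"
        using k by (intro e) (simp add: dist_real_def algebra_simps)
      moreover have "circle_of (y - k) = circle_of y"
        using k by (simp add: circle.abs_eq_iff)
      ultimately show ?thesis
        using y by simp
    qed
    with e show "\<exists>e>0. \<forall>y. dist y c < e \<longrightarrow> y \<in> U"
      by blast
  qed
qed

text \<open>
  The cotangent bundle of the torus is the product of the torus with \<open>\<real>\<^sup>d\<close>. Its smooth structure
  is the one for which the covering \<open>cotangent_of\<close> is a local diffeomorphism, and all
  differential notions are expressed in (local) lifts. Lifts of a point or map differ by integer
  translations, so every tangent space is canonically identified with \<open>\<real>\<^sup>d \<times> \<real>\<^sup>d\<close>.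
\<close>

type_synonym 'n torus = "(circle, 'n) vec"
type_synonym 'n cotangent = "(circle, 'n) vec \<times> (real, 'n) vec"
type_synonym 'n lifted = "(real, 'n) vec \<times> (real, 'n) vec"

definition torus_of :: "real ^ 'n \<Rightarrow> circle ^ 'n"
  where "torus_of q = (\<chi> i. circle_of (q $ i))"

definition cotangent_of :: "'n::finite lifted \<Rightarrow> 'n cotangent"
  where "cotangent_of z = (torus_of (fst z), snd z)"

text \<open>
  On open sets in Euclidean spaces this is \<open>C\<^sup>k\<close>: derivatives are evaluated at fixed
  vectors so that the recursion stays within one type.
\<close>

fun Ck_on :: "nat \<Rightarrow> 'a::real_normed_vector set \<Rightarrow> ('a \<Rightarrow> 'b::real_normed_vector) \<Rightarrow> bool"
  where
    "Ck_on 0 S f \<longleftrightarrow> continuous_on S f"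
  | "Ck_on (Suc k) S f \<longleftrightarrow>
      (\<forall>x\<in>S. f differentiable (at x)) \<and> (\<forall>v. Ck_on k S (\<lambda>x. frechet_derivative f (at x) v))"

definition smooth_on :: "'a::real_normed_vector set \<Rightarrow> ('a \<Rightarrow> 'b::real_normed_vector) \<Rightarrow> bool"
  where "smooth_on S f \<longleftrightarrow> (\<forall>k. Ck_on k S f)"

definition fiber_hessian :: "('n::finite cotangent \<Rightarrow> real) \<Rightarrow> 'n cotangent \<Rightarrow> real ^ 'n \<Rightarrow> real ^ 'n \<Rightarrow> real"
  where "fiber_hessian H x v w =
    frechet_derivative (\<lambda>p. frechet_derivative (\<lambda>p'. H (fst x, p')) (at p) w) (at (snd x)) v"

definition tonelli :: "('n::finite cotangent \<Rightarrow> real) \<Rightarrow> bool"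
  where "tonelli H \<longleftrightarrow>
    Ck_on 2 UNIV (H \<circ> cotangent_of) \<and>
    (\<forall>A. \<exists>B. \<forall>q p. norm p \<ge> B \<longrightarrow> H (q, p) \<ge> A * norm p) \<and>
    (\<forall>x v. v \<noteq> 0 \<longrightarrow> fiber_hessian H x v v > 0)"

text \<open>The symplectic form \<open>\<Sum>\<^sub>i dq\<^sub>i \<and> dp\<^sub>i\<close>.\<close>

definition omega :: "'n::finite lifted \<Rightarrow> 'n lifted \<Rightarrow> real"
  where "omega v w = fst v \<bullet> snd w - snd v \<bullet> fst w"

definition lagrangian_subspace :: "'n::finite lifted set \<Rightarrow> bool"
  where "lagrangian_subspace L \<longleftrightarrow> subspace L \<and> L = {v. \<forall>w\<in>L. omega v w = 0}"

text \<open>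
  The lifted orbits solve \<open>\<gamma>' = X\<close>, where \<open>omega X = dH\<close>; in coordinates,
  \<open>q' = \<partial>H/\<partial>p\<close> and \<open>p' = - \<partial>H/\<partial>q\<close>.
\<close>

definition hamiltonian_flow :: "('n::finite cotangent \<Rightarrow> real) \<Rightarrow> (real \<Rightarrow> 'n cotangent \<Rightarrow> 'n cotangent) \<Rightarrow> bool"
  where "hamiltonian_flow H \<phi> \<longleftrightarrow>
    (\<forall>x. \<phi> 0 x = x \<and>
      (\<exists>\<gamma>. \<forall>t. \<phi> t x = cotangent_of (\<gamma> t) \<and>
        (\<exists>X. (\<gamma> has_vector_derivative X) (at t) \<and>
          (\<forall>w. omega X w = frechet_derivative (H \<circ> cotangent_of) (at (\<gamma> t)) w))))"

definition has_cotangent_derivative ::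
    "('n::finite cotangent \<Rightarrow> 'n cotangent) \<Rightarrow> ('n lifted \<Rightarrow> 'n lifted) \<Rightarrow> 'n cotangent \<Rightarrow> bool"
  where "has_cotangent_derivative f D x \<longleftrightarrow>
    (\<exists>F z. cotangent_of z = x \<and> (F has_derivative D) (at z) \<and>
      (\<forall>\<^sub>F y in nhds z. cotangent_of (F y) = f (cotangent_of y)))"

text \<open>The projection to the torus lifts to \<open>fst\<close>, so this is the kernel of its derivative at every point.\<close>

definition vertical :: "'n::finite lifted set"
  where "vertical = {v. fst v = 0}"

definition orbit :: "(real \<Rightarrow> 'a \<Rightarrow> 'a) \<Rightarrow> 'a \<Rightarrow> 'a set"
  where "orbit \<phi> x = range (\<lambda>t. \<phi> t x)"

definition no_conjugate_points :: "(real \<Rightarrow> 'n::finite cotangent \<Rightarrow> 'n cotangent) \<Rightarrow> 'n cotangent set \<Rightarrow> bool"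
  where "no_conjugate_points \<phi> Orb \<longleftrightarrow>
    (\<forall>x\<in>Orb. \<forall>t. t \<noteq> 0 \<longrightarrow>
      (\<exists>D. has_cotangent_derivative (\<phi> t) D x \<and> D ` vertical \<inter> vertical = {0}))"

text \<open>
  A chart around \<open>x\<close> is given by a sheet \<open>U\<close> of the covering \<open>cotangent_of\<close> followed by a smooth
  diffeomorphism \<open>\<psi>\<close> from \<open>U\<close> onto an open set \<open>W\<close>, with inverse \<open>\<psi>'\<close>.
\<close>

definition lipschitz_submanifold :: "'n::finite cotangent set \<Rightarrow> bool"
  where "lipschitz_submanifold N \<longleftrightarrow>
    (\<forall>x\<in>N. \<exists>(U :: 'n lifted set) (W :: 'n lifted set) \<psi> \<psi>'.
      open U \<and> inj_on cotangent_of U \<and> x \<in> cotangent_of ` U \<and> open W \<and>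
      homeomorphism U W \<psi> \<psi>' \<and> smooth_on U \<psi> \<and> smooth_on W \<psi>' \<and>
      (\<exists>(S :: (real ^ 'n) set) (g :: real ^ 'n \<Rightarrow> real ^ 'n) C.
        open S \<and> C-lipschitz_on S g \<and>
        \<psi> ` (U \<inter> cotangent_of -` N) = (\<lambda>u. (u, g u)) ` S))"

definition lipschitz_torus :: "'n::finite cotangent set \<Rightarrow> bool"
  where "lipschitz_torus N \<longleftrightarrow>
    lipschitz_submanifold N \<and> N homeomorphic (UNIV :: 'n torus set)"

definition lipschitz_conjugated ::
    "'a::metric_space set \<Rightarrow> ('a \<Rightarrow> 'a) \<Rightarrow> 'b::metric_space set \<Rightarrow> ('b \<Rightarrow> 'b) \<Rightarrow> bool"
  where "lipschitz_conjugated A f B g \<longleftrightarrow>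
    (\<exists>h h' C C'. homeomorphism A B h h' \<and> C-lipschitz_on A h \<and> C'-lipschitz_on B h' \<and>
      (\<forall>x\<in>A. h (f x) = g (h x)))"

text \<open>
  Velocities at \<open>x\<close> of curves in \<open>N\<close>; for a \<open>C\<^sup>1\<close> submanifold this is its tangent space at \<open>x\<close>.
\<close>

definition tangent_vectors :: "'n::finite cotangent set \<Rightarrow> 'n cotangent \<Rightarrow> 'n lifted set"
  where "tangent_vectors N x =
    {v. \<exists>\<gamma>. cotangent_of (\<gamma> 0) = x \<and> (\<forall>t. cotangent_of (\<gamma> t) \<in> N) \<and>
      (\<gamma> has_vector_derivative v) (at (0::real))}"

definition lagrangian :: "'n::finite cotangent set \<Rightarrow> bool"
  where "lagrangian N \<longleftrightarrow> (\<forall>x\<in>N. lagrangian_subspace (tangent_vectors N x))"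

end

theory Submission
  imports Defs
begin

text \<open>
  Along an orbit of \<open>\<T>\<close> the powers of \<open>\<phi> T\<close> are equi-Lipschitz on \<open>\<T>\<close>, so every limit of difference
  quotients of points of (a lift of) \<open>\<T>\<close> is a vector whose image under the linearized flow stays
  bounded in forward time. For such a vector \<open>u\<close> write \<open>D\<^sub>t u = D\<^sub>t (0, \<lambda>\<^sub>t) + (0, \<eta>\<^sub>t)\<close>, which is possible for
  \<open>t > 0\<close> in the absence of conjugate points. The function \<open>f t = omega (0, \<lambda>\<^sub>t) u\<close> equals the inner product
  of \<open>\<eta>\<^sub>t\<close> with the bounded base component of \<open>D\<^sub>t u\<close>, and its derivative is the fiber Hessian evaluated
  at \<open>\<eta>\<^sub>t\<close>, so \<open>f' \<ge> k f\<^sup>2\<close> with \<open>k > 0\<close>. As \<open>f\<close> cannot blow up in finite time, \<open>f \<le> 0\<close>; hence \<open>\<eta>\<^sub>t\<close> is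
  arbitrarily small at suitable times, which makes the bounded vectors isotropic, and (shifting time)
  a vertical bounded vector vanishes. No convergence of Green bundles is needed.

  Since limits of difference quotients are never vertical, the projection of the lift of \<open>\<T>\<close> to
  \<open>\<real>\<^sup>d\<close> is locally bi-Lipschitz. By invariance of domain the lifted torus is the graph of a map \<open>s\<close> over
  \<open>\<real>\<^sup>d\<close>, and the isotropic limit spaces force \<open>s\<close> to be \<open>C\<^sup>1\<close> with symmetric derivative, so \<open>s = grad u\<close>.
  For an integer vector \<open>a\<close> the function \<open>q \<mapsto> u (q + a) - u q\<close> is invariant under the deck group, so it has
  a maximum, where \<open>s (q + a) = s q\<close>; injectivity of the parametrization then puts \<open>a\<close> into the deck
  group. Hence \<open>s\<close> is \<open>\<int>\<^sup>d\<close>-periodic and \<open>\<T>\<close> is a graph over the torus.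
\<close>

section \<open>Linearization of flows of Lipschitz vector fields\<close>

text \<open>\<open>H\<close> is only C^2, so the Hamiltonian field is only C^1 and its linearized
  flow has to be built by hand. Superlinearity and conservation of energy replace compactness of the
  phase space: on an energy sublevel of the lifted Hamiltonian the momenta are bounded, and
  periodicity in the base makes all estimates on the field and its derivative uniform. The Lipschitz
  hypothesis controls quotients of two points of the torus that both move; for this reason
  differentiability is used in its strict form, and this is also what finally makes the derivative
  of \<open>s\<close> continuous. The limit directions are not known to form a subspace, so they are
  enclosed in the space of vectors bounded in forward time, which is linear by construction and
  isotropic by the Riccati argument; its dimension is read off only once the graph is there. The
  shift of time is forced because the block of the linearized flow from fiber to base vanishes at
  time 0. Finally, the lifted parametrization acts on integer translations in an unknown way, so the
  periodicity of \<open>s\<close> cannot be read off from it; hence the maximum argument.\<close>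

lemma gronwall:
  fixes y :: "real \<Rightarrow> 'a::real_inner"
  assumes der: "\<And>t. 0 \<le> t \<Longrightarrow> t \<le> \<tau> \<Longrightarrow> (y has_vector_derivative y' t) (at t within {0..\<tau>})"
    and bound: "\<And>t. 0 \<le> t \<Longrightarrow> t \<le> \<tau> \<Longrightarrow> norm (y' t) \<le> L * norm (y t) + e"
    and "0 \<le> L" "0 \<le> e" and t: "0 \<le> t" "t \<le> \<tau>"
  shows "norm (y t) \<le> (norm (y 0) + e) * exp ((2 * L + 1) * t)"
proof -
  \<comment> \<open>The norm is not differentiable at 0, so its square is used. The added
    \<open>e\<^sup>2\<close> absorbs the cross term,
    \<open>2 * e * norm (y s) \<le> (norm (y s))\<^sup>2 + e\<^sup>2\<close>, which accounts for the
    extra 1 in the rate.\<close>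
  define g where "g t = (y t \<bullet> y t + e\<^sup>2) * exp (- (2 * L + 1) * t)" for t
  have "continuous_on {0..\<tau>} y"
    using der by (meson atLeastAtMost_iff continuous_on_vector_derivative)
  then have "continuous_on {0..t} y"
    by (rule continuous_on_subset) (use t in auto)
  then have cont: "continuous_on {0..t} g"
    unfolding g_def by (intro continuous_intros)
  have "g t \<le> g 0"
  proof (rule DERIV_nonpos_imp_decreasing_open[OF t(1) _ cont])
    fix s assume s: "0 < s" "s < t"
    have "(y has_vector_derivative y' s) (at s)"
      using der[of s] s t at_within_Icc_at[of 0 s \<tau>] by auto
    then have "((\<lambda>s. y s \<bullet> y s) has_vector_derivative (y s \<bullet> y' s + y' s \<bullet> y s)) (at s)"
      using bounded_bilinear.has_vector_derivative[OF bounded_bilinear_inner] by blast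
    then have "((\<lambda>s. y s \<bullet> y s) has_real_derivative (y s \<bullet> y' s + y' s \<bullet> y s)) (at s)"
      by (simp add: has_real_derivative_iff_has_vector_derivative)
    then have d: "(g has_real_derivative
        (2 * (y s \<bullet> y' s) - (2 * L + 1) * (y s \<bullet> y s + e\<^sup>2)) * exp (- (2 * L + 1) * s)) (at s)"
      unfolding g_def by (auto intro!: derivative_eq_intros simp: algebra_simps inner_commute)
    have "y s \<bullet> y' s \<le> norm (y s) * norm (y' s)"
      using norm_cauchy_schwarz by blast
    also have "\<dots> \<le> norm (y s) * (L * norm (y s) + e)"
      using bound[of s] s t by (intro mult_left_mono) auto
    finally have "2 * (y s \<bullet> y' s) \<le> 2 * L * (norm (y s))\<^sup>2 + 2 * e * norm (y s)"
      by (simp add: power2_eq_square algebra_simps)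
    also have "\<dots> \<le> (2 * L + 1) * ((norm (y s))\<^sup>2 + e\<^sup>2)"
    proof -
      have "0 \<le> L * e\<^sup>2" using \<open>0 \<le> L\<close> by simp
      then show ?thesis
        using sum_squares_bound[of e "norm (y s)"] by (simp add: algebra_simps)
    qed
    finally have "2 * (y s \<bullet> y' s) - (2 * L + 1) * (y s \<bullet> y s + e\<^sup>2) \<le> 0"
      by (simp add: dot_square_norm)
    with d show "\<exists>l. (g has_real_derivative l) (at s) \<and> l \<le> 0"
      by (meson exp_ge_zero mult_nonpos_nonneg)
  qed
  then have "(norm (y t))\<^sup>2 + e\<^sup>2 \<le> ((norm (y 0))\<^sup>2 + e\<^sup>2) * exp ((2 * L + 1) * t)"
    by (simp add: g_def dot_square_norm exp_minus field_simps minus_add_distrib[symmetric]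
        del: minus_add_distrib mult_minus_left)
  \<comment> \<open>The exponential is at least 1, so it may be squared; then both sides are squares
    and the root can be taken.\<close>
  also have "\<dots> \<le> (norm (y 0) + e)\<^sup>2 * (exp ((2 * L + 1) * t))\<^sup>2"
  proof (rule mult_mono)
    have "1 \<le> exp ((2 * L + 1) * t)"
      using t \<open>0 \<le> L\<close> by simp
    then show "exp ((2 * L + 1) * t) \<le> (exp ((2 * L + 1) * t))\<^sup>2"
      by (simp add: power2_eq_square)
  qed (use \<open>0 \<le> e\<close> in \<open>auto simp: power2_sum\<close>)
  finally have "(norm (y t))\<^sup>2 \<le> ((norm (y 0) + e) * exp ((2 * L + 1) * t))\<^sup>2"
    by (smt (verit) power_mult_distrib zero_le_power2)
  then show ?thesis
    by (rule power2_le_imp_le) (use \<open>0 \<le> e\<close> in auto)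
qed

lemma step_tendsto: "(\<lambda>n. z + v /\<^sub>R real (Suc n)) \<longlonglongrightarrow> (z::'a::real_normed_vector)"
proof -
  have "(\<lambda>n. z + inverse (real (Suc n)) *\<^sub>R v) \<longlonglongrightarrow> z + 0 *\<^sub>R v"
    by (intro tendsto_add tendsto_const tendsto_scaleR LIMSEQ_inverse_real_of_nat)
  then show ?thesis by (simp only: scaleR_zero_left add_0_right)
qed

lemma has_derivative_sequential:
  assumes "(F has_derivative D) (at z)"
  shows "(\<lambda>n. (F (z + v /\<^sub>R real (Suc n)) - F z) /\<^sub>R inverse (real (Suc n))) \<longlonglongrightarrow> D v"
proof (rule LIMSEQ_I)
  fix e :: real assume "e > 0"
  define e1 where "e1 = e / (norm v + 1)"
  have v1: "norm v + 1 > 0" using norm_ge_zero[of v] by linarith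
  then have e1: "e1 > 0" using \<open>e > 0\<close> by (simp add: e1_def)
  then obtain d where d: "d > 0" "\<And>y. norm (y - z) < d \<Longrightarrow> norm (F y - F z - D (y - z)) \<le> e1 * norm (y - z)"
    using assms unfolding has_derivative_at_alt by blast
  have lin: "linear D" using assms by (rule has_derivative_linear)
  have "\<forall>\<^sub>F n in sequentially. dist (z + v /\<^sub>R real (Suc n)) z < d"
    using step_tendsto d(1) by (rule tendstoD)
  then obtain N where N: "\<And>n. n \<ge> N \<Longrightarrow> norm (v /\<^sub>R real (Suc n)) < d"
    unfolding eventually_sequentially by (auto simp: dist_norm)
  have "norm ((F (z + v /\<^sub>R real (Suc n)) - F z) /\<^sub>R inverse (real (Suc n)) - D v) < e" if n: "n \<ge> N" for n
  proof -
    define k where "k = real (Suc n)"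
    have k: "k > 0" by (simp add: k_def)
    have "norm (F (z + v /\<^sub>R k) - F z - D (v /\<^sub>R k)) \<le> e1 * norm (v /\<^sub>R k)"
      using d(2)[of "z + v /\<^sub>R k"] N[OF n] by (simp add: k_def)
    then have "k * norm (F (z + v /\<^sub>R k) - F z - D (v /\<^sub>R k)) \<le> k * (e1 * norm (v /\<^sub>R k))"
      using k by simp
    also have "k * (e1 * norm (v /\<^sub>R k)) = e1 * norm v" using k by simp
    also have "k * norm (F (z + v /\<^sub>R k) - F z - D (v /\<^sub>R k)) = norm (k *\<^sub>R (F (z + v /\<^sub>R k) - F z - D (v /\<^sub>R k)))"
      using k by simp
    also have "k *\<^sub>R (F (z + v /\<^sub>R k) - F z - D (v /\<^sub>R k)) = (F (z + v /\<^sub>R k) - F z) /\<^sub>R inverse k - D v"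
      using k by (simp add: linear_scale[OF lin] scaleR_diff_right)
    finally have "norm ((F (z + v /\<^sub>R k) - F z) /\<^sub>R inverse k - D v) \<le> e1 * norm v" .
    also have "\<dots> < e1 * (norm v + 1)" using e1 by simp
    also have "\<dots> = e" using v1 by (simp add: e1_def)
    finally show ?thesis by (simp add: k_def)
  qed
  then show "\<exists>N. \<forall>n\<ge>N. norm ((F (z + v /\<^sub>R real (Suc n)) - F z) /\<^sub>R inverse (real (Suc n)) - D v) < e"
    by blast
qed

text \<open>A limit along the fixed steps \<open>1 / Suc n\<close>, so that the term makes sense
  before any differentiability in space is known; \<open>D_limit\<close> shows later that other
  sequences of difference quotients give the same vector.\<close>

definition flow_deriv :: "(real \<Rightarrow> 'a::real_normed_vector \<Rightarrow> 'a) \<Rightarrow> real \<Rightarrow> 'a \<Rightarrow> 'a \<Rightarrow> 'a"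
  where "flow_deriv \<Phi> t z v = lim (\<lambda>n. (\<Phi> t (z + v /\<^sub>R real (Suc n)) - \<Phi> t z) /\<^sub>R inverse (real (Suc n)))"

text \<open>\<open>strict\<close> compares the increment of \<open>X\<close> between two points with
  \<open>DX\<close> at a third one nearby, uniformly on \<open>S\<close>; quotients with two moving
  end points require this form. As \<open>S\<close> may fail to be convex, \<open>lip\<close> is
  assumed separately from the bound on \<open>DX\<close>.\<close>

locale lipschitz_flow =
  fixes X :: "'a::euclidean_space \<Rightarrow> 'a" and DX :: "'a \<Rightarrow> 'a \<Rightarrow> 'a"
    and \<Phi> :: "real \<Rightarrow> 'a \<Rightarrow> 'a" and S :: "'a set" and L :: real
  assumes open_S: "open S"
    and flow_in: "z \<in> S \<Longrightarrow> \<Phi> t z \<in> S"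
    and flow_0: "z \<in> S \<Longrightarrow> \<Phi> 0 z = z"
    and flow_deriv: "z \<in> S \<Longrightarrow> ((\<lambda>t. \<Phi> t z) has_vector_derivative X (\<Phi> t z)) (at t)"
    and lip: "a \<in> S \<Longrightarrow> b \<in> S \<Longrightarrow> norm (X a - X b) \<le> L * norm (a - b)"
    and strict: "e > 0 \<Longrightarrow> \<exists>d>0. \<forall>a\<in>S. \<forall>b\<in>S. \<forall>c\<in>S. norm (a - c) < d \<longrightarrow> norm (b - c) < d \<longrightarrow>
        norm (X a - X b - DX c (a - b)) \<le> e * norm (a - b)"
    and linear_DX: "c \<in> S \<Longrightarrow> linear (DX c)"
    and DX_le: "c \<in> S \<Longrightarrow> norm (DX c v) \<le> L * norm v"
    and L_nonneg: "0 \<le> L"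
begin

lemma flow_dist_le:
  assumes "a \<in> S" "b \<in> S" "0 \<le> t"
  shows "norm (\<Phi> t a - \<Phi> t b) \<le> norm (a - b) * exp ((2 * L + 1) * t)"
  using gronwall[of t "\<lambda>t. \<Phi> t a - \<Phi> t b" "\<lambda>t. X (\<Phi> t a) - X (\<Phi> t b)" L 0 t] assms
  by (simp add: flow_0 lip flow_in L_nonneg has_vector_derivative_at_within
      has_vector_derivative_diff[OF flow_deriv flow_deriv])

lemma flow_unique:
  assumes \<gamma>: "\<And>t. (\<gamma> has_vector_derivative X (\<gamma> t)) (at t)" "\<And>t. \<gamma> t \<in> S" and "0 \<le> t"
  shows "\<gamma> t = \<Phi> t (\<gamma> 0)"
proof -
  have "norm (\<gamma> t - \<Phi> t (\<gamma> 0)) \<le> 0"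
    using gronwall[of t "\<lambda>t. \<gamma> t - \<Phi> t (\<gamma> 0)" "\<lambda>t. X (\<gamma> t) - X (\<Phi> t (\<gamma> 0))" L 0 t] assms
    by (simp add: flow_0 lip flow_in L_nonneg has_vector_derivative_at_within
      has_vector_derivative_diff[OF \<gamma>(1) flow_deriv])
  then show ?thesis by simp
qed

lemma flow_add:
  assumes "z \<in> S" "0 \<le> t" "0 \<le> s"
  shows "\<Phi> (t + s) z = \<Phi> t (\<Phi> s z)"
proof -
  have "((\<lambda>t. \<Phi> (t + s) z) has_vector_derivative X (\<Phi> (u + s) z)) (at u)" for u
  proof -
    have "((\<lambda>t. t + s) has_vector_derivative 1) (at u)"
      by (auto intro!: derivative_eq_intros)
    from vector_diff_chain_at[OF this, of "\<lambda>t. \<Phi> t z"] flow_deriv[OF assms(1), of "u + s"]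
    show ?thesis by (simp add: o_def)
  qed
  from flow_unique[OF this flow_in[OF assms(1)] assms(2)] show ?thesis by simp
qed

text \<open>The variational equation along the orbit of \<open>z\<close>.\<close>

definition solves :: "'a \<Rightarrow> real \<Rightarrow> (real \<Rightarrow> 'a) \<Rightarrow> bool"
  where "solves z \<tau> Y \<longleftrightarrow> (\<forall>t\<in>{0..\<tau>}. (Y has_vector_derivative DX (\<Phi> t z) (Y t)) (at t within {0..\<tau>}))"

lemma solves_le:
  assumes "z \<in> S" "solves z \<tau> Y" "t \<in> {0..\<tau>}"
  shows "norm (Y t) \<le> norm (Y 0) * exp ((2 * L + 1) * t)"
  using gronwall[of \<tau> Y "\<lambda>t. DX (\<Phi> t z) (Y t)" L 0 t] assms
  by (auto simp: solves_def DX_le flow_in L_nonneg)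

lemma solves_lincomb:
  assumes "z \<in> S" "solves z \<tau> Y" "solves z \<tau> W"
  shows "solves z \<tau> (\<lambda>t. a *\<^sub>R Y t + b *\<^sub>R W t)"
  using assms unfolding solves_def
  by (auto intro!: derivative_eq_intros simp: linear_add linear_scale linear_DX flow_in)

lemma solves_unique:
  assumes "z \<in> S" "solves z \<tau> Y" "solves z \<tau> W" "Y 0 = W 0" "t \<in> {0..\<tau>}"
  shows "Y t = W t"
  using solves_le[OF assms(1) solves_lincomb[OF assms(1-3), of 1 "-1"] assms(5)] assms(4) by simp

text \<open>The quotients solve the variational equation up to an error that tends to 0 uniformly in
  time. Gronwall makes them uniformly Cauchy, and uniform convergence of the derivatives shows that
  the limit is a solution, whose existence is thus a by-product.\<close>

lemma difference_quotients_converge: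
  assumes z: "z \<in> S" and Z: "\<And>n. Z n \<in> S" "\<And>n. W n \<in> S" "Z \<longlonglongrightarrow> z" "W \<longlonglongrightarrow> z"
    and eps: "\<And>n. \<epsilon> n > (0::real)" and v: "(\<lambda>n. (Z n - W n) /\<^sub>R \<epsilon> n) \<longlonglongrightarrow> v" and "0 \<le> \<tau>"
  shows "\<exists>Y. Y 0 = v \<and> solves z \<tau> Y \<and> (\<forall>t\<in>{0..\<tau>}. (\<lambda>n. (\<Phi> t (Z n) - \<Phi> t (W n)) /\<^sub>R \<epsilon> n) \<longlonglongrightarrow> Y t)"
proof -
  define \<delta> where "\<delta> n t = (\<Phi> t (Z n) - \<Phi> t (W n)) /\<^sub>R \<epsilon> n" for n t
  define \<delta>' where "\<delta>' n t = (X (\<Phi> t (Z n)) - X (\<Phi> t (W n))) /\<^sub>R \<epsilon> n" for n t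
  define E where "E = exp ((2 * L + 1) * \<tau>)"
  have E1: "E \<ge> 1" using \<open>0 \<le> \<tau>\<close> L_nonneg by (simp add: E_def)
  have Et: "exp ((2 * L + 1) * t) \<le> E" if "t \<in> {0..\<tau>}" for t
    unfolding E_def using that L_nonneg by (auto intro!: mult_left_mono)
  have der: "(\<delta> n has_vector_derivative \<delta>' n t) (at t within {0..\<tau>})" for n t
    unfolding \<delta>_def \<delta>'_def
    by (rule has_vector_derivative_at_within,
        rule bounded_linear.has_vector_derivative[OF bounded_linear_scaleR_right],
        rule has_vector_derivative_diff[OF flow_deriv[OF Z(1)] flow_deriv[OF Z(2)]])
  have \<delta>0: "\<delta> n 0 = (Z n - W n) /\<^sub>R \<epsilon> n" for n
    by (simp add: \<delta>_def flow_0 Z)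
  have lim0: "(\<lambda>n. \<delta> n 0) \<longlonglongrightarrow> v" using v by (simp add: \<delta>0)
  then obtain M where M: "M > 0" "\<And>n. norm (\<delta> n 0) \<le> M"
    by (metis Bseq_def convergentI convergent_imp_Bseq)
  have \<delta>_le: "norm (\<delta> n t) \<le> M * E" if t: "t \<in> {0..\<tau>}" for n t
  proof -
    have "norm (\<delta> n t) \<le> (norm (\<delta> n 0) + 0) * exp ((2 * L + 1) * t)"
    proof (rule gronwall[OF der])
      fix s
      have "norm (X (\<Phi> s (Z n)) - X (\<Phi> s (W n))) / \<epsilon> n \<le> L * norm (\<Phi> s (Z n) - \<Phi> s (W n)) / \<epsilon> n"
        using eps[of n] by (intro divide_right_mono lip flow_in Z) auto
      then show "norm (\<delta>' n s) \<le> L * norm (\<delta> n s) + 0"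
        using eps[of n] by (simp add: \<delta>_def \<delta>'_def divide_inverse_commute mult.left_commute)
    qed (use t L_nonneg in auto)
    also have "\<dots> \<le> M * E"
      using M Et[OF t] by (intro mult_mono) auto
    finally show ?thesis .
  qed
  \<comment> \<open>The tolerance is \<open>e\<close> divided by \<open>M * E\<close>, the uniform
    bound of the quotients; orbits that start within \<open>d / E\<close> of \<open>z\<close> stay
    within \<open>d\<close> on the whole time interval.\<close>
  have resid: "\<forall>\<^sub>F n in sequentially. \<forall>t\<in>{0..\<tau>}. norm (\<delta>' n t - DX (\<Phi> t z) (\<delta> n t)) \<le> e" if "e > 0" for e
  proof -
    obtain d where d: "d > 0" "\<And>a b c. a\<in>S \<Longrightarrow> b\<in>S \<Longrightarrow> c\<in>S \<Longrightarrow> norm (a - c) < d \<Longrightarrow> norm (b - c) < d \<Longrightarrow>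
        norm (X a - X b - DX c (a - b)) \<le> (e / (M * E)) * norm (a - b)"
      using strict[of "e / (M * E)"] \<open>e > 0\<close> M E1 by auto
    have "\<forall>\<^sub>F n in sequentially. dist (Z n) z < d / E" "\<forall>\<^sub>F n in sequentially. dist (W n) z < d / E"
      using tendstoD[OF Z(3), of "d / E"] tendstoD[OF Z(4), of "d / E"] d E1 by auto
    then show ?thesis
    proof eventually_elim
      case (elim n)
      show ?case
      proof
        fix t assume t: "t \<in> {0..\<tau>}"
        have close: "norm (\<Phi> t a - \<Phi> t z) < d" if "a \<in> S" "dist a z < d / E" for a
        proof -
          have "norm (\<Phi> t a - \<Phi> t z) \<le> norm (a - z) * exp ((2 * L + 1) * t)"
            using t that z by (intro flow_dist_le) auto
          also have "\<dots> \<le> norm (a - z) * E"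
            using Et[OF t] by (intro mult_left_mono) auto
          also have "\<dots> < d"
            using that E1 by (simp add: dist_norm field_simps)
          finally show ?thesis .
        qed
        have "norm (X (\<Phi> t (Z n)) - X (\<Phi> t (W n)) - DX (\<Phi> t z) (\<Phi> t (Z n) - \<Phi> t (W n)))
           \<le> e / (M * E) * norm (\<Phi> t (Z n) - \<Phi> t (W n))"
          using close elim Z z by (intro d flow_in) auto
        from divide_right_mono[OF this less_imp_le[OF eps[of n]]]
        have "norm (X (\<Phi> t (Z n)) - X (\<Phi> t (W n)) - DX (\<Phi> t z) (\<Phi> t (Z n) - \<Phi> t (W n))) / \<epsilon> n
           \<le> e / (M * E) * (norm (\<Phi> t (Z n) - \<Phi> t (W n)) / \<epsilon> n)"
          by simp
        moreover have "\<delta>' n t - DX (\<Phi> t z) (\<delta> n t) =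
           (X (\<Phi> t (Z n)) - X (\<Phi> t (W n)) - DX (\<Phi> t z) (\<Phi> t (Z n) - \<Phi> t (W n))) /\<^sub>R \<epsilon> n"
          by (simp add: \<delta>_def \<delta>'_def scaleR_diff_right linear_scale[OF linear_DX[OF flow_in[OF z]]]
              linear_diff[OF linear_DX[OF flow_in[OF z]]])
        ultimately have "norm (\<delta>' n t - DX (\<Phi> t z) (\<delta> n t)) \<le> e / (M * E) * norm (\<delta> n t)"
          using eps[of n] by (simp add: \<delta>_def divide_inverse_commute)
        also have "\<dots> \<le> e / (M * E) * (M * E)"
          using \<delta>_le[OF t] \<open>e > 0\<close> M E1 by (intro mult_left_mono) auto
        finally show "norm (\<delta>' n t - DX (\<Phi> t z) (\<delta> n t)) \<le> e"
          using M E1 by simp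
      qed
    qed
  qed
  have "uniformly_Cauchy_on {0..\<tau>} \<delta>"
    unfolding uniformly_Cauchy_on_def
  proof (intro allI impI)
    fix e :: real assume "e > 0"
    \<comment> \<open>Initial values and errors contribute at most \<open>2 * e1\<close> each, so
      the Cauchy bound is \<open>4 * e1 * E\<close>, which is below \<open>e\<close>.\<close>
    define e1 where "e1 = e / (6 * E)"
    have e1: "e1 > 0" using \<open>e > 0\<close> E1 by (simp add: e1_def)
    have "\<forall>\<^sub>F n in sequentially. dist (\<delta> n 0) v < e1"
      using lim0 e1 by (rule tendstoD)
    then have "\<forall>\<^sub>F n in sequentially. (\<forall>t\<in>{0..\<tau>}. norm (\<delta>' n t - DX (\<Phi> t z) (\<delta> n t)) \<le> e1) \<and> dist (\<delta> n 0) v < e1"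
      using resid[OF e1] by (simp add: eventually_conj)
    then obtain N where N: "\<And>n t. n \<ge> N \<Longrightarrow> t\<in>{0..\<tau>} \<Longrightarrow> norm (\<delta>' n t - DX (\<Phi> t z) (\<delta> n t)) \<le> e1"
        "\<And>n. n \<ge> N \<Longrightarrow> dist (\<delta> n 0) v < e1"
      unfolding eventually_sequentially by blast
    have "dist (\<delta> m t) (\<delta> n t) < e" if t: "t \<in> {0..\<tau>}" and mn: "m \<ge> N" "n \<ge> N" for m n t
    proof -
      have "norm (\<delta> m t - \<delta> n t) \<le> (norm (\<delta> m 0 - \<delta> n 0) + 2 * e1) * exp ((2 * L + 1) * t)"
      proof (rule gronwall[OF has_vector_derivative_diff[OF der der]])
        fix s assume "0 \<le> s" "s \<le> \<tau>"
        then have s: "s \<in> {0..\<tau>}" by simp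
        have tri: "norm (a - b + c) \<le> norm a + norm b + norm c" for a b c :: 'a
          using norm_triangle_ineq[of "a - b" c] norm_triangle_ineq4[of a b] by linarith
        have eq: "\<delta>' m s - \<delta>' n s = (\<delta>' m s - DX (\<Phi> s z) (\<delta> m s)) - (\<delta>' n s - DX (\<Phi> s z) (\<delta> n s))
            + DX (\<Phi> s z) (\<delta> m s - \<delta> n s)"
          using linear_diff[OF linear_DX[OF flow_in[OF z]]] by simp
        have "norm (\<delta>' m s - \<delta>' n s) \<le> norm (\<delta>' m s - DX (\<Phi> s z) (\<delta> m s)) + norm (\<delta>' n s - DX (\<Phi> s z) (\<delta> n s))
            + norm (DX (\<Phi> s z) (\<delta> m s - \<delta> n s))"
          unfolding eq by (rule tri)
        also have "\<dots> \<le> e1 + e1 + L * norm (\<delta> m s - \<delta> n s)"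
          using N(1)[OF mn(1) s] N(1)[OF mn(2) s] DX_le[OF flow_in[OF z]]
          by (intro add_mono) auto
        finally show "norm (\<delta>' m s - \<delta>' n s) \<le> L * norm (\<delta> m s - \<delta> n s) + 2 * e1" by simp
      qed (use L_nonneg e1 t in auto)
      also have "\<dots> \<le> (norm (\<delta> m 0 - \<delta> n 0) + 2 * e1) * E"
        using Et[OF t] e1 by (intro mult_left_mono) auto
      also have "\<dots> < (2 * e1 + 2 * e1) * E"
      proof -
        have "norm (\<delta> m 0 - \<delta> n 0) < 2 * e1"
          using N(2)[OF mn(1)] N(2)[OF mn(2)] dist_triangle2[of "\<delta> m 0" "\<delta> n 0" v]
          by (simp add: dist_norm)
        then show ?thesis using E1 by (intro mult_strict_right_mono) auto
      qed
      also have "\<dots> < e" using \<open>e > 0\<close> E1 by (simp add: e1_def)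
      finally show ?thesis by (simp add: dist_norm)
    qed
    then show "\<exists>M. \<forall>x\<in>{0..\<tau>}. \<forall>m\<ge>M. \<forall>n\<ge>M. dist (\<delta> m x) (\<delta> n x) < e" by blast
  qed
  then obtain Y where Y: "uniform_limit {0..\<tau>} \<delta> Y sequentially"
    by (metis uniformly_convergent_eq_Cauchy uniformly_convergent_on_def)
  have Yt: "(\<lambda>n. \<delta> n t) \<longlonglongrightarrow> Y t" if "t \<in> {0..\<tau>}" for t
    using tendsto_uniform_limitI[OF Y that] .
  have "\<exists>g. \<forall>t\<in>{0..\<tau>}. (\<lambda>n. \<delta> n t) \<longlonglongrightarrow> g t \<and>
      (g has_derivative (\<lambda>h. h *\<^sub>R DX (\<Phi> t z) (Y t))) (at t within {0..\<tau>})"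
  proof (rule has_derivative_sequence[where f' = "\<lambda>n t h. h *\<^sub>R \<delta>' n t"])
    show "(\<delta> n has_derivative (\<lambda>h. h *\<^sub>R \<delta>' n t)) (at t within {0..\<tau>})" for n t
      using der by (simp add: has_vector_derivative_def)
    show "0 \<in> {0..\<tau>}" "(\<lambda>n. \<delta> n 0) \<longlonglongrightarrow> v" using \<open>0 \<le> \<tau>\<close> lim0 by auto
    fix e :: real assume "e > 0"
    have "\<forall>\<^sub>F n in sequentially. \<forall>t\<in>{0..\<tau>}. dist (\<delta> n t) (Y t) < e / (2 * (L + 1))"
      using Y \<open>e > 0\<close> L_nonneg by (intro uniform_limitD) auto
    then show "\<forall>\<^sub>F n in sequentially. \<forall>t\<in>{0..\<tau>}. \<forall>h. norm (h *\<^sub>R \<delta>' n t - h *\<^sub>R DX (\<Phi> t z) (Y t)) \<le> e * norm h"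
      using resid[of "e/2", simplified, OF \<open>e > 0\<close>]
    proof eventually_elim
      case (elim n)
      show ?case
      proof (intro ballI allI)
        fix t h assume t: "t \<in> {0..\<tau>}"
        have eq: "\<delta>' n t - DX (\<Phi> t z) (Y t) = (\<delta>' n t - DX (\<Phi> t z) (\<delta> n t)) + DX (\<Phi> t z) (\<delta> n t - Y t)"
          using linear_diff[OF linear_DX[OF flow_in[OF z]]] by simp
        have "norm (\<delta>' n t - DX (\<Phi> t z) (Y t)) \<le> norm (\<delta>' n t - DX (\<Phi> t z) (\<delta> n t)) + L * norm (\<delta> n t - Y t)"
          unfolding eq using DX_le[OF flow_in[OF z, of t], of "\<delta> n t - Y t"]
            norm_triangle_ineq[of "\<delta>' n t - DX (\<Phi> t z) (\<delta> n t)" "DX (\<Phi> t z) (\<delta> n t - Y t)"]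
          by linarith
        also have "\<dots> \<le> e / 2 + (L + 1) * (e / (2 * (L + 1)))"
          using elim t L_nonneg
          by (intro add_mono mult_mono) (auto simp: dist_norm less_imp_le)
        also have "\<dots> = e" using L_nonneg by (simp add: divide_simps) (simp add: algebra_simps)
        finally have "norm (\<delta>' n t - DX (\<Phi> t z) (Y t)) \<le> e" .
        then show "norm (h *\<^sub>R \<delta>' n t - h *\<^sub>R DX (\<Phi> t z) (Y t)) \<le> e * norm h"
          using mult_left_mono[of "norm (\<delta>' n t - DX (\<Phi> t z) (Y t))" e "\<bar>h\<bar>"]
          by (simp add: scaleR_diff_right[symmetric] mult.commute)
      qed
    qed
  qed auto
  then obtain g where g: "\<And>t. t \<in> {0..\<tau>} \<Longrightarrow> (\<lambda>n. \<delta> n t) \<longlonglongrightarrow> g t"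
      "\<And>t. t \<in> {0..\<tau>} \<Longrightarrow> (g has_vector_derivative DX (\<Phi> t z) (Y t)) (at t within {0..\<tau>})"
    unfolding has_vector_derivative_def by blast
  have gY: "g t = Y t" if "t \<in> {0..\<tau>}" for t
    using LIMSEQ_unique g(1) Yt that by blast
  have "solves z \<tau> g"
    using g(2) gY by (simp add: solves_def)
  moreover have "g 0 = v"
    using g(1)[of 0] lim0 LIMSEQ_unique \<open>0 \<le> \<tau>\<close> by auto
  ultimately show ?thesis
    using g(1) by (auto simp: \<delta>_def)
qed

section \<open>The derivative of the flow in space, for forward times\<close>

abbreviation D where "D \<equiv> flow_deriv \<Phi>"

lemma D_solution:
  assumes z: "z \<in> S" and "0 \<le> \<tau>"
  obtains Y where "Y 0 = v" "solves z \<tau> Y" "\<And>t. t \<in> {0..\<tau>} \<Longrightarrow> D t z v = Y t"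
proof -
  have lim: "(\<lambda>n. z + v /\<^sub>R real (Suc n)) \<longlonglongrightarrow> z"
    by (rule step_tendsto)
  then have "\<forall>\<^sub>F n in sequentially. z + v /\<^sub>R real (Suc n) \<in> S"
    using open_S z topological_tendstoD by blast
  then obtain N where N: "\<And>n. n \<ge> N \<Longrightarrow> z + v /\<^sub>R real (Suc n) \<in> S"
    unfolding eventually_sequentially by blast
  have "\<exists>Y. Y 0 = v \<and> solves z \<tau> Y \<and> (\<forall>t\<in>{0..\<tau>}. (\<lambda>n. (\<Phi> t (z + v /\<^sub>R real (Suc (n + N))) - \<Phi> t z) /\<^sub>R inverse (real (Suc (n + N)))) \<longlonglongrightarrow> Y t)"
    by (rule difference_quotients_converge[OF z])
      (use N[of "_ + N"] z LIMSEQ_ignore_initial_segment[OF lim, of N] \<open>0 \<le> \<tau>\<close> in auto)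
  then obtain Y where Y: "Y 0 = v" "solves z \<tau> Y"
      "\<And>t. t \<in> {0..\<tau>} \<Longrightarrow> (\<lambda>n. (\<Phi> t (z + v /\<^sub>R real (Suc (n + N))) - \<Phi> t z) /\<^sub>R inverse (real (Suc (n + N)))) \<longlonglongrightarrow> Y t"
    by blast
  have "D t z v = Y t" if "t \<in> {0..\<tau>}" for t
    unfolding flow_deriv_def by (rule limI, rule LIMSEQ_offset[where k=N]) (rule Y(3)[OF that])
  with Y show thesis using that by blast
qed

text \<open>\<open>Z\<close> and \<open>W\<close> may approach \<open>z\<close> in any manner;
  uniqueness for the variational equation identifies their limit with the one that defines
  \<open>D\<close>.\<close>

theorem D_limit:
  assumes z: "z \<in> S" and Z: "Z \<longlonglongrightarrow> z" "W \<longlonglongrightarrow> z"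
    and eps: "\<And>n. \<epsilon> n > (0::real)" and v: "(\<lambda>n. (Z n - W n) /\<^sub>R \<epsilon> n) \<longlonglongrightarrow> v" and "0 \<le> t"
  shows "(\<lambda>n. (\<Phi> t (Z n) - \<Phi> t (W n)) /\<^sub>R \<epsilon> n) \<longlonglongrightarrow> D t z v"
proof -
  have "\<forall>\<^sub>F n in sequentially. Z n \<in> S \<and> W n \<in> S"
    using topological_tendstoD[OF Z(1) open_S z] topological_tendstoD[OF Z(2) open_S z] by (rule eventually_conj)
  then obtain N where N: "\<And>n. n \<ge> N \<Longrightarrow> Z n \<in> S" "\<And>n. n \<ge> N \<Longrightarrow> W n \<in> S"
    unfolding eventually_sequentially by blast
  have "\<exists>Y. Y 0 = v \<and> solves z t Y \<and> (\<forall>s\<in>{0..t}. (\<lambda>n. (\<Phi> s (Z (n + N)) - \<Phi> s (W (n + N))) /\<^sub>R \<epsilon> (n + N)) \<longlonglongrightarrow> Y s)"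
    by (rule difference_quotients_converge[OF z])
      (use N z LIMSEQ_ignore_initial_segment[OF Z(1), of N] LIMSEQ_ignore_initial_segment[OF Z(2), of N]
         LIMSEQ_ignore_initial_segment[OF v, of N] \<open>0 \<le> t\<close> eps in auto)
  then obtain Y where Y: "Y 0 = v" "solves z t Y" "(\<lambda>n. (\<Phi> t (Z (n + N)) - \<Phi> t (W (n + N))) /\<^sub>R \<epsilon> (n + N)) \<longlonglongrightarrow> Y t"
    using \<open>0 \<le> t\<close> by auto
  obtain Y' where Y': "Y' 0 = v" "solves z t Y'" "\<And>s. s \<in> {0..t} \<Longrightarrow> D s z v = Y' s"
    using D_solution[OF z \<open>0 \<le> t\<close>] by blast
  have "Y t = D t z v"
    using solves_unique[OF z Y(2) Y'(2), of t] Y(1) Y'(1,3) \<open>0 \<le> t\<close> by auto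
  with Y(3) show ?thesis by (auto intro: LIMSEQ_offset[where k=N])
qed

lemma D_deriv:
  assumes z: "z \<in> S" and "0 \<le> t"
  shows "((\<lambda>t. D t z v) has_vector_derivative DX (\<Phi> t z) (D t z v)) (at t within {0..})"
proof -
  \<comment> \<open>Solving up to \<open>t + 1\<close> keeps \<open>t\<close> away from the right
    end, so that the derivative within \<open>{0..}\<close> is obtained.\<close>
  have "0 \<le> t + 1" using \<open>0 \<le> t\<close> by simp
  from D_solution[OF z this] obtain Y where Y: "Y 0 = v" "solves z (t + 1) Y" "\<And>s. s \<in> {0..t+1} \<Longrightarrow> D s z v = Y s"
    by blast
  have t: "t \<in> {0..t+1}" using \<open>0 \<le> t\<close> by simp
  have "(Y has_vector_derivative DX (\<Phi> t z) (Y t)) (at t within {0..t+1})"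
    using Y(2) t by (auto simp: solves_def)
  then have "((\<lambda>t. D t z v) has_vector_derivative DX (\<Phi> t z) (D t z v)) (at t within {0..t+1})"
    unfolding Y(3)[OF t] using has_vector_derivative_transform[OF t, of "\<lambda>t. D t z v" Y] Y(3) by blast
  moreover have "at t within {0..t+1} = at t within {0..}"
    by (rule at_within_nhd[where S="{..<t+1}"]) auto
  ultimately show ?thesis by simp
qed

lemma D_0: "z \<in> S \<Longrightarrow> D 0 z v = v"
  using D_solution[of z 0 v] by (metis atLeastAtMost_iff order_refl)

lemma D_le:
  assumes "z \<in> S" "0 \<le> t"
  shows "norm (D t z v) \<le> norm v * exp ((2 * L + 1) * t)"
proof -
  obtain Y where "Y 0 = v" "solves z t Y" "D t z v = Y t"
    using D_solution[OF assms] assms(2) by (metis atLeastAtMost_iff order_refl)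
  then show ?thesis using solves_le[OF assms(1), of t Y t] assms(2) by simp
qed

lemma linear_D:
  assumes z: "z \<in> S" and t: "0 \<le> t"
  shows "linear (D t z)"
proof -
  have comb: "D t z (a *\<^sub>R u + b *\<^sub>R v) = a *\<^sub>R D t z u + b *\<^sub>R D t z v" for a b u v
  proof -
    obtain Yu where Yu: "Yu 0 = u" "solves z t Yu" "D t z u = Yu t"
      using D_solution[OF z t] t by (metis atLeastAtMost_iff order_refl)
    obtain Yv where Yv: "Yv 0 = v" "solves z t Yv" "D t z v = Yv t"
      using D_solution[OF z t] t by (metis atLeastAtMost_iff order_refl)
    obtain Y where Y: "Y 0 = a *\<^sub>R u + b *\<^sub>R v" "solves z t Y" "D t z (a *\<^sub>R u + b *\<^sub>R v) = Y t"
      using D_solution[OF z t] t by (metis atLeastAtMost_iff order_refl)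
    show ?thesis
      using solves_unique[OF z Y(2) solves_lincomb[OF z Yu(2) Yv(2), of a b], of t] Y Yu Yv t by simp
  qed
  show ?thesis
    by (rule linearI) (use comb[of 1 _ 1] comb[of _ _ 0 0] in simp_all)
qed

text \<open>The chain rule. \<open>\<Phi> s\<close> moves the points of a segment at
  \<open>z\<close> to points that need not lie on a line, which is why \<open>D_limit\<close> has to
  allow arbitrary sequences.\<close>

lemma D_add:
  assumes z: "z \<in> S" and t: "0 \<le> t" "0 \<le> s"
  shows "D (t + s) z v = D t (\<Phi> s z) (D s z v)"
proof -
  let ?Z = "\<lambda>n. z + v /\<^sub>R real (Suc n)"
  have lim: "?Z \<longlonglongrightarrow> z"
    by (rule step_tendsto)
  have v: "(\<lambda>n. (?Z n - z) /\<^sub>R inverse (real (Suc n))) \<longlonglongrightarrow> v" by simp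
  have q: "(\<lambda>n. (\<Phi> r (?Z n) - \<Phi> r z) /\<^sub>R inverse (real (Suc n))) \<longlonglongrightarrow> D r z v" if "0 \<le> r" for r
    by (rule D_limit[OF z lim tendsto_const _ v that]) simp
  have "(\<lambda>n. \<Phi> s (?Z n) - \<Phi> s z) \<longlonglongrightarrow> 0"
    using tendsto_scaleR[OF LIMSEQ_inverse_real_of_nat q[OF t(2)]] by simp
  then have lims: "(\<lambda>n. \<Phi> s (?Z n)) \<longlonglongrightarrow> \<Phi> s z"
    using Lim_null by blast
  have "(\<lambda>n. (\<Phi> t (\<Phi> s (?Z n)) - \<Phi> t (\<Phi> s z)) /\<^sub>R inverse (real (Suc n))) \<longlonglongrightarrow> D t (\<Phi> s z) (D s z v)"
    by (rule D_limit[OF flow_in[OF z] lims tendsto_const _ q[OF t(2)] t(1)]) simp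
  moreover have "\<forall>\<^sub>F n in sequentially. ?Z n \<in> S"
    using topological_tendstoD[OF lim open_S z] .
  then have "\<forall>\<^sub>F n in sequentially. (\<Phi> t (\<Phi> s (?Z n)) - \<Phi> t (\<Phi> s z)) /\<^sub>R inverse (real (Suc n)) =
      (\<Phi> (t + s) (?Z n) - \<Phi> (t + s) z) /\<^sub>R inverse (real (Suc n))"
    by eventually_elim (use flow_add z t in simp)
  ultimately have "(\<lambda>n. (\<Phi> (t + s) (?Z n) - \<Phi> (t + s) z) /\<^sub>R inverse (real (Suc n))) \<longlonglongrightarrow> D t (\<Phi> s z) (D s z v)"
    by (rule Lim_transform_eventually)
  then show ?thesis
    using LIMSEQ_unique q[of "t + s"] t by simp
qed

end

section \<open>Linear Hamiltonian systems without conjugate points\<close>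

lemma omega_simps:
  "omega (u + v) w = omega u w + omega v w" "omega w (u + v) = omega w u + omega w v"
  "omega (u - v) w = omega u w - omega v w" "omega w (u - v) = omega w u - omega w v"
  "omega (a *\<^sub>R u) w = a * omega u w" "omega w (a *\<^sub>R u) = a * omega w u"
  "omega 0 w = 0" "omega w 0 = 0"
  by (auto simp: omega_def inner_simps algebra_simps)

lemma omega_nondegenerate:
  assumes "\<And>w. omega u w = 0" shows "u = 0"
proof -
  have "omega u (- snd u, fst u) = 0" by (rule assms)
  then have "fst u \<bullet> fst u + snd u \<bullet> snd u = 0" by (simp add: omega_def)
  then have "fst u = 0 \<and> snd u = 0"
    using inner_ge_zero[of "fst u"] inner_ge_zero[of "snd u"] by (smt (verit) inner_eq_zero_iff)
  then show ?thesis by (simp add: prod_eq_iff)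
qed

lemma has_vector_derivative_omega:
  assumes "(f has_vector_derivative f') (at t within S)" "(g has_vector_derivative g') (at t within S)"
  shows "((\<lambda>t. omega (f t) (g t)) has_vector_derivative omega (f t) g' + omega f' (g t)) (at t within S)"
proof -
  have "((\<lambda>t. fst (f t)) has_vector_derivative fst f') (at t within S)"
       "((\<lambda>t. snd (f t)) has_vector_derivative snd f') (at t within S)"
       "((\<lambda>t. fst (g t)) has_vector_derivative fst g') (at t within S)"
       "((\<lambda>t. snd (g t)) has_vector_derivative snd g') (at t within S)"
    using assms by (auto intro: bounded_linear.has_vector_derivative bounded_linear_fst bounded_linear_snd)
  note d = this
  have "((\<lambda>t. fst (f t) \<bullet> snd (g t) - snd (f t) \<bullet> fst (g t)) has_vector_derivative
     ((fst (f t) \<bullet> snd g' + fst f' \<bullet> snd (g t)) - (snd (f t) \<bullet> fst g' + snd f' \<bullet> fst (g t)))) (at t within S)"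
    by (intro has_vector_derivative_diff bounded_bilinear.has_vector_derivative[OF bounded_bilinear_inner] d)
  then show ?thesis by (simp add: omega_def algebra_simps)
qed

lemma differentiable_prod:
  fixes f :: "'i \<Rightarrow> 'a::real_normed_vector \<Rightarrow> real"
  assumes "\<And>i. i \<in> I \<Longrightarrow> f i differentiable (at x within S)"
  shows "(\<lambda>x. \<Prod>i\<in>I. f i x) differentiable (at x within S)"
  using assms
proof (induction I rule: infinite_finite_induct)
  case (insert i I)
  then show ?case by (simp add: differentiable_mult)
qed auto

lemma differentiable_det:
  fixes M :: "'a::real_normed_vector \<Rightarrow> real^'n^'n"
  assumes "\<And>i j. (\<lambda>t. M t $ i $ j) differentiable (at x within S)"
  shows "(\<lambda>t. det (M t)) differentiable (at x within S)"
  unfolding det_def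
  by (intro differentiable_sum differentiable_mult differentiable_prod differentiable_const assms finite_permutations finite ballI)

text \<open>\<open>Z\<close> is the fundamental solution for forward times. \<open>skew\<close> says
  that \<open>A t\<close> is a Hamiltonian matrix, \<open>coercive\<close> is the uniform bound on
  the fiber Hessian along an orbit, and \<open>twist\<close> excludes points conjugate to time 0;
  that \<open>c = 0\<close> follows from it because a symplectic \<open>Z t\<close> is
  injective.\<close>

locale linear_hamiltonian =
  fixes Z A :: "real \<Rightarrow> 'n::finite lifted \<Rightarrow> 'n lifted" and \<kappa> :: real
  assumes lin: "t \<ge> 0 \<Longrightarrow> linear (Z t)"
    and Z_0: "Z 0 v = v"
    and Z_deriv: "t \<ge> 0 \<Longrightarrow> ((\<lambda>t. Z t v) has_vector_derivative A t (Z t v)) (at t within {0..})"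
    and lin_A: "t \<ge> 0 \<Longrightarrow> linear (A t)"
    and skew: "t \<ge> 0 \<Longrightarrow> omega (A t u) w + omega u (A t w) = 0"
    and coercive: "t \<ge> 0 \<Longrightarrow> \<kappa> * (norm c)\<^sup>2 \<le> fst (A t (0, c)) \<bullet> c"
    and \<kappa>_pos: "\<kappa> > 0"
    and twist: "t > 0 \<Longrightarrow> fst (Z t (0, c)) = 0 \<Longrightarrow> Z t (0, c) = 0"
begin

lemma omega_Z:
  assumes "t \<ge> 0" shows "omega (Z t u) (Z t w) = omega u w"
proof -
  have "((\<lambda>t. omega (Z t u) (Z t w)) has_vector_derivative 0) (at t within {0..})" if "t \<in> {0..}" for t
    using has_vector_derivative_omega[OF Z_deriv Z_deriv, of t u w] skew[of t "Z t u" "Z t w"] that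
    by (simp add: add.commute)
  then obtain c where "\<And>t. t \<in> {0..} \<Longrightarrow> omega (Z t u) (Z t w) = c"
    using has_vector_derivative_zero_constant[of "{0..}" "\<lambda>t. omega (Z t u) (Z t w)"] by auto
  from this[of t] this[of 0] show ?thesis using assms by (simp add: Z_0)
qed

lemma Z_eq_0: 
  assumes "t \<ge> 0" "Z t u = 0" shows "u = 0"
  by (rule omega_nondegenerate) (metis assms omega_Z omega_simps(7))

lemma no_conjugate:
  assumes "t > 0" "fst (Z t (0, c)) = 0" shows "c = 0"
proof -
  have "(0, c) = (0 :: 'n lifted)"
    by (rule Z_eq_0[OF less_imp_le[OF assms(1)] twist[OF assms]])
  then show ?thesis by (simp add: zero_prod_def)
qed

lemma Z_deriv_at:
  assumes "t > 0" shows "((\<lambda>t. Z t v) has_vector_derivative A t (Z t v)) (at t)"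
proof -
  have "at t within {0..} = at t"
    by (rule at_within_interior) (use assms in auto)
  then show ?thesis using Z_deriv[of t v] assms by simp
qed

text \<open>Derivatives of \<open>Z\<close> are given for fixed vectors only; expansion in the basis
  yields the product rule for a moving one.\<close>

lemma Z_moving_deriv:
  assumes t: "t > 0" and c: "(c has_vector_derivative c') (at t)"
  shows "((\<lambda>t. Z t (c t)) has_vector_derivative Z t c' + A t (Z t (c t))) (at t)"
proof -
  have expand: "Z s v = (\<Sum>b\<in>Basis. (v \<bullet> b) *\<^sub>R Z s b)" if "s \<ge> 0" for s v
  proof -
    have "Z s v = Z s (\<Sum>b\<in>Basis. (v \<bullet> b) *\<^sub>R b)" by (simp add: euclidean_representation)
    also have "\<dots> = (\<Sum>b\<in>Basis. (v \<bullet> b) *\<^sub>R Z s b)"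
      using lin[OF that] by (simp add: linear_sum linear_scale)
    finally show ?thesis .
  qed
  have "((\<lambda>t. \<Sum>b\<in>Basis. (c t \<bullet> b) *\<^sub>R Z t b) has_vector_derivative
      (\<Sum>b\<in>Basis. (c t \<bullet> b) *\<^sub>R A t (Z t b) + (c' \<bullet> b) *\<^sub>R Z t b)) (at t)"
    by (intro has_vector_derivative_sum bounded_bilinear.has_vector_derivative[OF bounded_bilinear_scaleR] Z_deriv_at[OF t]
        bounded_linear.has_vector_derivative[OF bounded_linear_inner_left c])
  moreover have "(\<Sum>b\<in>Basis. (c t \<bullet> b) *\<^sub>R A t (Z t b) + (c' \<bullet> b) *\<^sub>R Z t b) = Z t c' + A t (Z t (c t))"
    using t lin_A[of t] by (simp add: sum.distrib expand[of t c'] expand[of t "c t"] linear_sum linear_scale)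
  ultimately have "((\<lambda>t. \<Sum>b\<in>Basis. (c t \<bullet> b) *\<^sub>R Z t b) has_vector_derivative Z t c' + A t (Z t (c t))) (at t)"
    by simp
  then show ?thesis
    by (rule has_vector_derivative_transform_within_open[where S="{0<..}"]) (use t expand in auto)
qed

text \<open>The block of \<open>Z t\<close> from the fiber to the base. It is invertible for
  \<open>t > 0\<close> by \<open>no_conjugate\<close> but vanishes at \<open>t = 0\<close>, so
  everything below that divides by its determinant is meaningful for positive times only.\<close>

definition vert :: "real \<Rightarrow> real^'n^'n"
  where "vert t = matrix (\<lambda>c. fst (Z t (0, c)))"

text \<open>Cramer's rule, so that differentiability in \<open>t\<close> is visible.\<close>

definition lam :: "'n lifted \<Rightarrow> real \<Rightarrow> real^'n"
  where "lam u t = (\<Sum>k\<in>UNIV. (det (\<chi> i j. if j = k then fst (Z t u) $ i else vert t $ i $ j) / det (vert t)) *\<^sub>R axis k 1)"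

definition eta :: "'n lifted \<Rightarrow> real \<Rightarrow> real^'n"
  where "eta u t = snd (Z t (u - (0, lam u t)))"

lemma linear_fst_Z: 
  assumes "t \<ge> 0" shows "linear (\<lambda>c. fst (Z t (0, c)))"
proof -
  have "linear (\<lambda>c::real^'n. (0::real^'n, c))" by (auto simp: linear_iff)
  from linear_compose[OF linear_compose[OF this lin[OF assms]] linear_fst]
  show ?thesis by (simp add: o_def)
qed

lemma det_vert: 
  assumes "t > 0" shows "det (vert t) \<noteq> 0"
proof -
  have "inj (\<lambda>c. fst (Z t (0, c)))"
    using linear_fst_Z[of t] assms no_conjugate[OF assms] by (auto simp: linear_injective_0)
  then show ?thesis
    using linear_fst_Z[of t] assms by (simp add: vert_def det_nz_iff_inj)
qed

lemma fst_Z_lam: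
  assumes "t > 0" shows "fst (Z t (0, lam u t)) = fst (Z t u)"
proof -
  have lam: "lam u t = (\<chi> k. det (\<chi> i j. if j = k then fst (Z t u) $ i else vert t $ i $ j) / det (vert t))"
    unfolding lam_def by (simp add: vec_eq_iff axis_def sum.delta' if_distrib cong: if_cong)
  have "vert t *v lam u t = fst (Z t u)"
    using cramer[OF det_vert[OF assms], of "lam u t" "fst (Z t u)"] lam by simp
  then show ?thesis
    using linear_fst_Z[of t] assms by (simp add: vert_def matrix_works)
qed

lemma Z_lam_eta:
  assumes "t > 0" shows "Z t (u - (0, lam u t)) = (0, eta u t)"
  using fst_Z_lam[OF assms, of u] lin[of t] assms by (simp add: prod_eq_iff eta_def linear_diff)

lemma lam_differentiable:
  assumes "t > 0" shows "lam u differentiable (at t)"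
proof -
  have Z: "(\<lambda>t. Z t v) differentiable (at t)" for v
    using Z_deriv_at[OF assms] differentiableI_vector by blast
  have q: "(\<lambda>t. fst (Z t v) $ i) differentiable (at t)" for v i
  proof -
    obtain D where "((\<lambda>t. Z t v) has_derivative D) (at t)"
      using Z[of v] unfolding differentiable_def by blast
    then have "((\<lambda>t. fst (Z t v) $ i) has_derivative (\<lambda>h. fst (D h) $ i)) (at t)"
      by (intro bounded_linear.has_derivative[OF bounded_linear_vec_nth]
          bounded_linear.has_derivative[OF bounded_linear_fst])
    then show ?thesis unfolding differentiable_def by blast
  qed
  have v: "(\<lambda>t. vert t $ i $ j) differentiable (at t)" for i j
    by (simp add: vert_def matrix_def q)
  have if_q: "(\<lambda>t. if P then fst (Z t u) $ i else vert t $ i $ j) differentiable (at t)" for P i j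
    by (cases P) (simp_all add: q v)
  show ?thesis
    unfolding lam_def using det_vert[OF assms]
    by (intro differentiable_sum differentiable_scaleR differentiable_divide differentiable_const ballI
        differentiable_det v finite) (simp_all add: if_q)
qed

text \<open>\<open>u - (0, lam u t)\<close> lies in the Lagrangian subspace that \<open>Z t\<close>
  carries to the vertical, so up to sign this is the momentum of \<open>u\<close> relative to that
  subspace, paired with \<open>fst u\<close>. Its growth in \<open>t\<close> is the monotonicity on
  which Green bundles rest.\<close>

definition energy :: "'n lifted \<Rightarrow> real \<Rightarrow> real"
  where "energy u t = omega (0, lam u t) u"

text \<open>Replacing \<open>u\<close> by \<open>u - (0, lam u t)\<close> does not change the
  pairing with a vertical vector. Then both arguments are transported by the symplectic
  \<open>Z t\<close>, after which the second one is vertical.\<close>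

lemma energy_eq:
  assumes t: "t > 0" shows "energy u t = fst (Z t u) \<bullet> eta u t"
proof -
  have "energy u t = omega (0, lam u t) (u - (0, lam u t))"
    by (simp add: energy_def omega_def)
  also have "\<dots> = omega (Z t (0, lam u t)) (0, eta u t)"
    using omega_Z[of t] Z_lam_eta[OF t] t by (metis less_imp_le)
  also have "\<dots> = fst (Z t u) \<bullet> eta u t"
    using fst_Z_lam[OF t] by (simp add: omega_def)
  finally show ?thesis .
qed

text \<open>Together with \<open>energy_eq\<close> this is a Riccati inequality for \<open>energy u\<close> when \<open>u\<close> stays bounded.\<close>

lemma energy_deriv:
  assumes t: "t > 0"
  obtains d where "(energy u has_real_derivative d) (at t)" "\<kappa> * (norm (eta u t))\<^sup>2 \<le> d"
proof -
  obtain l where l: "(lam u has_vector_derivative l) (at t)"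
    using lam_differentiable[OF t] vector_derivative_works by blast
  have pair: "((\<lambda>t. (0, lam u t)) has_vector_derivative (0, l)) (at t)"
    by (intro has_vector_derivative_Pair has_vector_derivative_const l)
  have "((\<lambda>t. Z t (u - (0, lam u t))) has_vector_derivative Z t (0 - (0, l)) + A t (Z t (u - (0, lam u t)))) (at t)"
    by (intro Z_moving_deriv t has_vector_derivative_diff has_vector_derivative_const pair)
  from bounded_linear.has_vector_derivative[OF bounded_linear_fst this]
  have "((\<lambda>t. fst (Z t (u - (0, lam u t)))) has_vector_derivative fst (Z t (0 - (0, l))) + fst (A t (0, eta u t))) (at t)"
    using Z_lam_eta[OF t] by simp
  \<comment> \<open>This base component vanishes at all positive times. Equating the two derivatives
    expresses the derivative \<open>l\<close> of \<open>lam u\<close> through the block of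
    \<open>A t\<close> to which \<open>coercive\<close> applies.\<close>
  moreover have "((\<lambda>t. fst (Z t (u - (0, lam u t)))) has_vector_derivative 0) (at t)"
    by (rule has_vector_derivative_transform_within_open[where S="{0<..}" and f="\<lambda>_. 0"])
      (use t Z_lam_eta in auto)
  ultimately have "fst (Z t (0 - (0, l))) + fst (A t (0, eta u t)) = 0"
    by (rule vector_derivative_unique_at)
  then have l': "fst (Z t (0, l)) = fst (A t (0, eta u t))"
  proof -
    have "fst (Z t (0 - (0, l))) = - fst (Z t (0, l))"
      using linear_neg[OF lin[of t], of "(0, l)"] t by (simp only: diff_0 fst_uminus)
    with \<open>fst (Z t (0 - (0, l))) + _ = 0\<close> show ?thesis
      by (simp only: neg_eq_iff_add_eq_0[symmetric] minus_minus)
  qed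
  have "((\<lambda>t. omega (0, lam u t) u) has_vector_derivative omega (0, l) u) (at t)"
    using has_vector_derivative_omega[OF pair has_vector_derivative_const, of u] by (simp add: omega_simps)
  then have "(energy u has_real_derivative omega (0, l) u) (at t)"
    by (simp add: energy_def[abs_def] has_real_derivative_iff_has_vector_derivative)
  \<comment> \<open>The same replacement as in \<open>energy_eq\<close>, now for the derivative of
    \<open>lam u\<close>.\<close>
  moreover have "omega (0, l) u = omega (0, l) (u - (0, lam u t))"
    by (simp add: omega_def)
  then have "omega (0, l) u = omega (Z t (0, l)) (0, eta u t)"
    using omega_Z[of t] Z_lam_eta[OF t] t by (metis less_imp_le)
  then have "omega (0, l) u = fst (A t (0, eta u t)) \<bullet> eta u t"
    by (simp add: omega_def l')
  then have "\<kappa> * (norm (eta u t))\<^sup>2 \<le> omega (0, l) u"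
    using coercive[of t] t by simp
  ultimately show thesis using that by blast
qed

lemma energy_mono:
  assumes "0 < s" "s \<le> t" shows "energy u s \<le> energy u t"
  by (rule DERIV_nonneg_imp_nondecreasing[OF assms(2)])
    (meson assms(1) energy_deriv less_imp_le less_le_trans mult_nonneg_nonneg order_trans zero_le_power2 \<kappa>_pos)

section \<open>Consequences of boundedness in forward time\<close>

lemma energy_nonpos:
  assumes K: "\<And>t. t \<ge> 0 \<Longrightarrow> norm (Z t u) \<le> K" and s: "s > 0"
  shows "energy u s \<le> 0"
proof (rule ccontr)
  assume "\<not> energy u s \<le> 0"
  then have pos: "energy u t > 0" if "s \<le> t" for t
    using energy_mono[OF s that, of u] by simp
  have K0: "K > 0"
  proof (rule ccontr)
    assume "\<not> K > 0"
    then have "norm (Z s u) \<le> 0" using K[of s] s by linarith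
    then have "Z s u = 0" by simp
    then show False using energy_eq[OF s, of u] pos[of s] by simp
  qed
  \<comment> \<open>Boundedness gives
    \<open>\<bar>energy u r\<bar> \<le> K * norm (eta u r)\<close>, so \<open>energy_deriv\<close>
    becomes the Riccati inequality with this \<open>k\<close>.\<close>
  define k where "k = \<kappa> / K\<^sup>2"
  have k: "k > 0" using K0 \<kappa>_pos by (simp add: k_def)
  \<comment> \<open>The blow-up time of the comparison solution:
    \<open>- inverse (energy u r) - k * r\<close> is nondecreasing in \<open>r\<close> and equals
    \<open>- k * t\<close> at \<open>r = s\<close>, which is incompatible with
    \<open>energy u t\<close> being positive.\<close>
  define t where "t = s + inverse (energy u s) / k"
  have st: "s \<le> t" using pos[of s] k by (simp add: t_def)
  have "- inverse (energy u s) - k * s \<le> - inverse (energy u t) - k * t"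
  proof (rule DERIV_nonneg_imp_nondecreasing[OF st])
    fix r assume r: "s \<le> r" "r \<le> t"
    then have r0: "r > 0" using s by simp
    obtain d where d: "(energy u has_real_derivative d) (at r)" "\<kappa> * (norm (eta u r))\<^sup>2 \<le> d"
      using energy_deriv[OF r0] by blast
    have "((\<lambda>r. - inverse (energy u r) - k * r) has_real_derivative d / (energy u r)\<^sup>2 - k) (at r)"
      using pos[OF r(1)] d(1) by (auto intro!: derivative_eq_intros simp: power2_eq_square divide_inverse mult_ac)
    moreover have "k * (energy u r)\<^sup>2 \<le> d"
    proof -
      have "\<bar>energy u r\<bar> \<le> norm (fst (Z r u)) * norm (eta u r)"
        unfolding energy_eq[OF r0] by (rule Cauchy_Schwarz_ineq2)
      also have "\<dots> \<le> K * norm (eta u r)"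
        using K[of r] r0 norm_fst_le[of "fst (Z r u)" "snd (Z r u)"] by (intro mult_right_mono) auto
      finally have "(energy u r)\<^sup>2 \<le> (K * norm (eta u r))\<^sup>2"
        using abs_le_square_iff K0 by (metis abs_of_nonneg mult_nonneg_nonneg norm_ge_zero less_imp_le)
      then have "k * (energy u r)\<^sup>2 \<le> k * (K * norm (eta u r))\<^sup>2"
        using k by simp
      also have "\<dots> = \<kappa> * (norm (eta u r))\<^sup>2"
        using K0 by (simp add: k_def power_mult_distrib)
      finally show ?thesis using d(2) by simp
    qed
    then have "0 \<le> d / (energy u r)\<^sup>2 - k"
      using pos[OF r(1)] by (simp add: field_simps)
    ultimately show "\<exists>y. ((\<lambda>r. - inverse (energy u r) - k * r) has_real_derivative y) (at r) \<and> 0 \<le> y"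
      by blast
  qed
  also have "\<dots> < - k * t" using pos[OF st] by simp
  finally show False
    using k pos[of s] by (simp add: t_def field_simps)
qed

theorem isotropic:
  assumes Ku: "\<And>t. t \<ge> 0 \<Longrightarrow> norm (Z t u) \<le> K" and Kw: "\<And>t. t \<ge> 0 \<Longrightarrow> norm (Z t w) \<le> K"
  shows "omega u w = 0"
proof (rule ccontr)
  assume neq: "omega u w \<noteq> 0"
  have K0: "K \<ge> 0" using Ku[of 0] norm_ge_zero order.trans by blast
  \<comment> \<open>\<open>omega u w\<close> is bounded by \<open>K + 1\<close> times the sum of the
    norms of the two \<open>eta\<close> vectors, and the square of a sum is at most twice the sum of
    the squares. The summand 1 keeps the denominator positive.\<close>
  define e where "e = (omega u w)\<^sup>2 / (2 * (K + 1)\<^sup>2)"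
  have e: "e > 0" using neq K0 by (simp add: e_def)
  have big: "e \<le> (norm (eta u t))\<^sup>2 + (norm (eta w t))\<^sup>2" if t: "t > 0" for t
  proof -
    have "omega u w = omega (Z t (0, lam u t) + (0, eta u t)) (Z t (0, lam w t) + (0, eta w t))"
      using omega_Z[of t u w] Z_lam_eta[OF t, of u] Z_lam_eta[OF t, of w] lin[of t] t
      by (simp add: linear_diff algebra_simps)
    also have "\<dots> = omega (Z t (0, lam u t)) (Z t (0, lam w t)) + fst (Z t u) \<bullet> eta w t - eta u t \<bullet> fst (Z t w)"
      unfolding omega_simps by (simp add: omega_def fst_Z_lam[OF t])
    also have "omega (Z t (0, lam u t)) (Z t (0, lam w t)) = 0"
      using omega_Z[of t] t by (simp add: omega_def)
    finally have "\<bar>omega u w\<bar> \<le> norm (fst (Z t u)) * norm (eta w t) + norm (eta u t) * norm (fst (Z t w))"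
      using Cauchy_Schwarz_ineq2[of "fst (Z t u)" "eta w t"] Cauchy_Schwarz_ineq2[of "eta u t" "fst (Z t w)"]
      by linarith
    also have "\<dots> \<le> (K + 1) * norm (eta w t) + norm (eta u t) * (K + 1)"
      using K0 Ku[of t] Kw[of t] t norm_fst_le[of "fst (Z t u)" "snd (Z t u)"] norm_fst_le[of "fst (Z t w)" "snd (Z t w)"]
      by (intro add_mono mult_mono) auto
    also have "\<dots> = (K + 1) * (norm (eta w t) + norm (eta u t))" by (simp add: algebra_simps)
    finally have "(omega u w)\<^sup>2 \<le> ((K + 1) * (norm (eta w t) + norm (eta u t)))\<^sup>2"
      by (metis abs_ge_zero power2_abs power_mono)
    also have "\<dots> \<le> (K + 1)\<^sup>2 * (2 * ((norm (eta u t))\<^sup>2 + (norm (eta w t))\<^sup>2))"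
      unfolding power_mult_distrib
    proof (rule mult_left_mono)
      show "(norm (eta w t) + norm (eta u t))\<^sup>2 \<le> 2 * ((norm (eta u t))\<^sup>2 + (norm (eta w t))\<^sup>2)"
        using sum_squares_bound[of "norm (eta w t)" "norm (eta u t)"] by (simp add: power2_sum)
    qed simp
    finally show ?thesis
      using K0 by (simp add: e_def field_simps)
  qed
  define F where "F t = energy u t + energy w t" for t
  \<comment> \<open>By this time the linear growth of \<open>F\<close> from its value at time 1
    would have lifted it to \<open>\<kappa> * e\<close>, which is positive.\<close>
  define t where "t = 2 - F 1 / (\<kappa> * e)"
  have F0: "F t \<le> 0" if "t > 0" for t
    unfolding F_def using energy_nonpos[OF Ku that] energy_nonpos[OF Kw that] by simp
  have ke: "\<kappa> * e > 0" using \<kappa>_pos e by simp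
  have "F 1 / (\<kappa> * e) \<le> 0" using F0[of 1] ke by (simp add: divide_nonpos_pos)
  then have t1: "1 \<le> t" by (simp add: t_def)
  have "F 1 - \<kappa> * e * 1 \<le> F t - \<kappa> * e * t"
  proof (rule DERIV_nonneg_imp_nondecreasing[OF t1])
    fix r assume "1 \<le> r" "r \<le> t"
    then have r: "r > 0" by simp
    obtain d1 where d1: "(energy u has_real_derivative d1) (at r)" "\<kappa> * (norm (eta u r))\<^sup>2 \<le> d1"
      using energy_deriv[OF r] by blast
    obtain d2 where d2: "(energy w has_real_derivative d2) (at r)" "\<kappa> * (norm (eta w r))\<^sup>2 \<le> d2"
      using energy_deriv[OF r] by blast
    have "((\<lambda>r. F r - \<kappa> * e * r) has_real_derivative d1 + d2 - \<kappa> * e) (at r)"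
      unfolding F_def by (auto intro!: derivative_eq_intros d1 d2)
    moreover have "\<kappa> * e \<le> \<kappa> * ((norm (eta u r))\<^sup>2 + (norm (eta w r))\<^sup>2)"
      using big[OF r] \<kappa>_pos by simp
    then have "0 \<le> d1 + d2 - \<kappa> * e"
      using d1(2) d2(2) by (simp add: algebra_simps)
    ultimately show "\<exists>y. ((\<lambda>r. F r - \<kappa> * e * r) has_real_derivative y) (at r) \<and> 0 \<le> y" by blast
  qed
  then have "F t \<ge> F 1 + \<kappa> * e * (t - 1)" by (simp add: algebra_simps)
  also have "F 1 + \<kappa> * e * (t - 1) = \<kappa> * e" using ke \<kappa>_pos e by (simp add: t_def field_simps)
  finally show False using F0[of t] t1 ke by simp
qed

text \<open>The energy vanishes at \<open>s\<close>; being nondecreasing and nonpositive it vanishes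
  from then on, so its derivative kills \<open>eta\<close> and \<open>u\<close> itself is vertical.
  Then \<open>u\<close> is vertical at time 0 and at time \<open>s\<close>, and
  \<open>no_conjugate\<close> applies.\<close>

theorem vertical_unbounded:
  assumes K: "\<And>t. t \<ge> 0 \<Longrightarrow> norm (Z t u) \<le> K" and s: "s > 0" and vert: "fst (Z s u) = 0"
  shows "u = 0"
proof -
  have "lam u s = 0"
    using no_conjugate[OF s, of "lam u s"] fst_Z_lam[OF s, of u] vert by simp
  then have e0: "energy u s = 0" by (simp add: energy_def omega_def)
  have flat: "energy u t = 0" if "s \<le> t" for t
    using energy_mono[OF s that, of u] energy_nonpos[OF K, of t] e0 s that by simp
  \<comment> \<open>The energy is known to vanish only from \<open>s\<close> on, so its derivative
    is taken at an interior time.\<close>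
  have s1: "s + 1 > 0" using s by simp
  obtain d where d: "(energy u has_real_derivative d) (at (s + 1))" "\<kappa> * (norm (eta u (s + 1)))\<^sup>2 \<le> d"
    using energy_deriv[OF s1] by blast
  have "(energy u has_real_derivative 0) (at (s + 1))"
    by (rule has_field_derivative_transform_within_open[where S="{s<..}" and f="\<lambda>_. 0"]) (use flat in auto)
  then have "d = 0" using d(1) DERIV_unique by blast
  then have "eta u (s + 1) = 0"
    using d(2) \<kappa>_pos by (simp add: mult_le_0_iff)
  then have "Z (s + 1) (u - (0, lam u (s + 1))) = 0"
    using Z_lam_eta[OF s1] by (simp add: zero_prod_def)
  then have "u = (0, lam u (s + 1))"
    using Z_eq_0[of "s + 1"] s by fastforce
  then have "u = (0, snd u)" by (metis snd_conv)
  then show ?thesis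
    using no_conjugate[OF s, of "snd u"] vert by (metis zero_prod_def)
qed

end

section \<open>The torus and its cotangent bundle\<close>

lemma circle_of_eq_iff: "circle_of x = circle_of y \<longleftrightarrow> x - y \<in> \<int>"
  by (rule circle.abs_eq_iff)

lemma circle_of_surj: obtains x where "c = circle_of x"
  by (metis Quotient_abs_rep Quotient_circle)

lemma dist_circle_of:
  assumes "\<bar>x - y\<bar> \<le> 1 / 2"
  shows "dist (circle_of x) (circle_of y) = \<bar>x - y\<bar>"
proof (rule antisym[OF dist_circle_of_le])
  obtain k where k: "k \<in> \<int>" "infdist (x - y) \<int> = dist (x - y) k"
    using infdist_Ints_attained by blast
  then obtain m :: int where m: "k = of_int m" by (auto elim: Ints_cases)
  have "\<bar>x - y\<bar> \<le> \<bar>x - y - of_int m\<bar>"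
  proof (cases "m = 0")
    case False
    then have "\<bar>real_of_int m\<bar> \<ge> 1" by linarith
    then show ?thesis using assms by linarith
  qed simp
  then show "\<bar>x - y\<bar> \<le> dist (circle_of x) (circle_of y)"
    using k m by (simp add: dist_circle.abs_eq dist_real_def)
qed

lemma has_derivative_shift:
  fixes f :: "'a::real_normed_vector \<Rightarrow> 'b::real_normed_vector"
  assumes "(f has_derivative f') (at (x + c))"
  shows "((\<lambda>x. f (x + c)) has_derivative f') (at x)"
proof -
  have "((\<lambda>x. x + c) has_derivative (\<lambda>h. h)) (at x)" by (auto intro!: derivative_eq_intros)
  from has_derivative_compose[OF this assms] show ?thesis .
qed

definition int_vec :: "(real ^ 'n) set"
  where "int_vec = {m. \<forall>i. m $ i \<in> \<int>}"

lemma int_vec_closed: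
  "0 \<in> int_vec" "a \<in> int_vec \<Longrightarrow> - a \<in> int_vec" "a \<in> int_vec \<Longrightarrow> b \<in> int_vec \<Longrightarrow> a + b \<in> int_vec"
  "a \<in> int_vec \<Longrightarrow> b \<in> int_vec \<Longrightarrow> a - b \<in> int_vec"
  by (auto simp: int_vec_def)

lemma int_vec_small:
  assumes "m \<in> int_vec" "norm m < 1" shows "m = 0"
proof -
  have "m $ i = 0" for i
  proof -
    obtain k :: int where k: "m $ i = of_int k"
      using assms(1) by (auto simp: int_vec_def elim: Ints_cases)
    have "\<bar>m $ i\<bar> < 1" using component_le_norm_cart[of m i] assms(2) by linarith
    then show ?thesis using k by simp
  qed
  then show ?thesis by (simp add: vec_eq_iff)
qed

lemma torus_of_eq_iff: "torus_of x = torus_of y \<longleftrightarrow> x - y \<in> int_vec"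
  by (simp add: torus_of_def vec_eq_iff circle_of_eq_iff int_vec_def)

lemma torus_of_add_int [simp]: "m \<in> int_vec \<Longrightarrow> torus_of (x + m) = torus_of x"
  by (simp add: torus_of_eq_iff)

lemma torus_of_surj: obtains x where "\<theta> = torus_of x"
proof -
  have "\<forall>i. \<exists>x. \<theta> $ i = circle_of x" by (metis circle_of_surj)
  then obtain f where "\<And>i. \<theta> $ i = circle_of (f i)" by metis
  then have "\<theta> = torus_of (\<chi> i. f i)" by (simp add: torus_of_def vec_eq_iff)
  with that show thesis .
qed

lemma int_vec_floor: obtains m where "m \<in> int_vec" "x - m \<in> cbox 0 1"
proof -
  have "(\<chi> i. of_int \<lfloor>x $ i\<rfloor>) \<in> int_vec" "x - (\<chi> i. of_int \<lfloor>x $ i\<rfloor>) \<in> cbox 0 1"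
    by (auto simp: int_vec_def mem_box_cart) linarith
  with that show thesis .
qed

lemma dist_torus_of_le: "dist (torus_of x) (torus_of y) \<le> dist x y"
  unfolding dist_vec_def torus_of_def
  by (rule L2_set_mono) (auto simp: dist_real_def dist_circle_of_le)

lemma dist_torus_of:
  assumes "dist x y \<le> 1 / 2" shows "dist (torus_of x) (torus_of y) = dist x y"
proof -
  have "\<bar>x $ i - y $ i\<bar> \<le> 1 / 2" for i
    using component_le_norm_cart[of "x - y" i] assms by (simp add: dist_norm)
  then show ?thesis
    by (simp add: dist_vec_def torus_of_def dist_circle_of dist_real_def)
qed

lemma dist_cotangent_of_le: "dist (cotangent_of a) (cotangent_of b) \<le> dist a b"
  unfolding dist_prod_def cotangent_of_def
  by (auto intro!: add_right_mono power_mono simp: dist_torus_of_le)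

lemma dist_cotangent_of:
  assumes "dist a b \<le> 1 / 2" shows "dist (cotangent_of a) (cotangent_of b) = dist a b"
proof -
  have "dist (fst a) (fst b) \<le> 1 / 2" using dist_fst_le[of a b] assms by linarith
  then show ?thesis by (simp add: dist_prod_def cotangent_of_def dist_torus_of)
qed

lemma continuous_on_torus_of: "continuous_on S torus_of"
  unfolding continuous_on_iff by (meson dist_torus_of_le le_less_trans)

lemma continuous_on_cotangent_of: "continuous_on S cotangent_of"
  unfolding continuous_on_iff by (meson dist_cotangent_of_le le_less_trans)

lemma cotangent_of_eq_iff: "cotangent_of a = cotangent_of b \<longleftrightarrow> fst a - fst b \<in> int_vec \<and> snd a = snd b"
  by (simp add: cotangent_of_def torus_of_eq_iff)

lemma cotangent_of_add_int [simp]: "m \<in> int_vec \<Longrightarrow> cotangent_of (z + (m, 0)) = cotangent_of z"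
  by (simp add: cotangent_of_eq_iff)

lemma cotangent_of_surj: obtains z where "x = cotangent_of z"
proof -
  obtain q where "fst x = torus_of q" by (rule torus_of_surj)
  then have "x = cotangent_of (q, snd x)" by (simp add: cotangent_of_def prod_eq_iff)
  with that show thesis .
qed

lemma torus_of_cbox: "torus_of ` cbox 0 1 = UNIV"
proof -
  have "\<theta> \<in> torus_of ` cbox 0 1" for \<theta> :: "'a torus"
  proof -
    obtain x where x: "\<theta> = torus_of x" by (rule torus_of_surj)
    obtain m where m: "m \<in> int_vec" "x - m \<in> cbox 0 1" by (rule int_vec_floor)
    have "torus_of (x - m) = \<theta>"
      using m x int_vec_closed(2)[of m] by (simp add: torus_of_eq_iff)
    then show ?thesis using m(2) by blast
  qed
  then show ?thesis by auto
qed

lemma compact_torus: "compact (UNIV :: 'n::finite torus set)"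
  using compact_continuous_image[OF continuous_on_torus_of compact_cbox, of 0 1] by (simp add: torus_of_cbox)

lemma compact_torus_image:
  assumes "homeomorphism (UNIV :: 'n::finite torus set) N h h'" shows "compact N"
  using compact_continuous_image[OF homeomorphism_cont1[OF assms] compact_torus] homeomorphism_image1[OF assms] by simp

lemma closed_cotangent_lift: "compact N \<Longrightarrow> closed (cotangent_of -` N)"
  by (rule closed_vimage[OF compact_imp_closed continuous_on_cotangent_of])

lemma bounded_fiber_component:
  assumes "compact (N :: 'n::finite cotangent set)"
  obtains R where "\<And>x. x \<in> N \<Longrightarrow> norm (snd x) \<le> R"
proof -
  have "bounded (snd ` N)"
    by (rule compact_imp_bounded[OF compact_continuous_image[OF _ assms]]) (intro continuous_intros)
  with that show thesis by (auto simp: bounded_iff)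
qed

text \<open>The embedding of the circle as the unit circle of the complex plane, which turns lifts
  into continuous logarithms.\<close>

lift_definition circle_exp :: "circle \<Rightarrow> complex" is "\<lambda>x. cis (2 * pi * x)"
proof -
  fix x y :: real assume "x - y \<in> \<int>"
  then have "cis (2 * pi * (x - y)) = 1" by (rule cis_multiple_2pi)
  then have "cis (2 * pi * (x - y)) * cis (2 * pi * y) = cis (2 * pi * y)" by simp
  then show "cis (2 * pi * x) = cis (2 * pi * y)" by (simp add: cis_mult algebra_simps)
qed

lemma circle_exp_inj: 
  assumes "circle_exp a = circle_exp b" shows "a = b"
  using assms
proof transfer
  fix x y :: real assume "cis (2 * pi * x) = cis (2 * pi * y)"
  then have "cis (2 * pi * x) / cis (2 * pi * y) = 1" by simp
  then have "cis (2 * pi * x - 2 * pi * y) = 1" by (simp add: cis_divide)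
  then have "cos (2 * pi * x - 2 * pi * y) = 1" by (metis cis.sel(1) one_complex.sel(1))
  then obtain k :: int where "2 * pi * x - 2 * pi * y = real_of_int k * 2 * pi" using cos_one_2pi_int by blast
  then have "2 * pi * (x - y) = 2 * pi * k" by (simp add: algebra_simps)
  then have "x - y = k" by simp
  then show "x - y \<in> \<int>" by simp
qed

lemma continuous_circle_exp: "continuous_on UNIV circle_exp"
proof (rule continuous_on_open_vimage[THEN iffD2, OF open_UNIV, rule_format])
  fix U :: "complex set" assume "open U"
  have "circle_of -` (circle_exp -` U) = (\<lambda>x. cis (2 * pi * x)) -` U"
    by (auto simp: circle_exp.abs_eq)
  moreover have "open ((\<lambda>x. cis (2 * pi * x)) -` U)"
    by (rule open_vimage[OF \<open>open U\<close>]) (intro continuous_intros)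
  ultimately show "open (circle_exp -` U \<inter> UNIV)"
    by (simp add: open_circle_iff_quotient)
qed

text \<open>A normed space is simply connected, so each coordinate composed with
  \<open>circle_exp\<close> has a continuous logarithm; its real part is 0 and its imaginary part
  over \<open>2 * pi\<close> is the lift.\<close>

lemma torus_lift:
  fixes f :: "'a::real_normed_vector \<Rightarrow> 'n::finite torus"
  assumes f: "continuous_on UNIV f"
  obtains g where "continuous_on UNIV g" "\<And>x. torus_of (g x) = f x"
proof -
  have "\<exists>G. continuous_on UNIV G \<and> (\<forall>x. circle_exp (f x $ i) = exp (G x))" for i
  proof -
    have "continuous_on UNIV (\<lambda>x. f x $ i)"
      using f by (intro continuous_intros)
    then have "continuous_on UNIV (\<lambda>x. circle_exp (f x $ i))"
      by (rule continuous_on_compose2[OF continuous_circle_exp]) auto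
    moreover have "circle_exp c \<noteq> 0" for c
      by transfer simp
    ultimately show ?thesis
      using continuous_logarithm_on_simply_connected[of UNIV "\<lambda>x. circle_exp (f x $ i)"]
      by (metis UNIV_I convex_UNIV convex_imp_simply_connected convex_imp_locally_path_connected)
  qed
  then obtain G where G: "\<And>i. continuous_on UNIV (G i)" "\<And>i x. circle_exp (f x $ i) = exp (G i x)" by metis
  define g where "g x = (\<chi> i. Im (G i x) / (2 * pi))" for x
  have "continuous_on UNIV g"
    unfolding g_def by (intro continuous_intros G) auto
  moreover have "torus_of (g x) = f x" for x
  proof -
    have "circle_of (Im (G i x) / (2 * pi)) = f x $ i" for i
    proof (rule circle_exp_inj)
      have "norm (circle_exp c) = 1" for c by transfer simp
      then have "exp (Re (G i x)) = 1" by (metis G(2) norm_exp_eq_Re)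
      then have "Re (G i x) = 0" by simp
      then show "circle_exp (circle_of (Im (G i x) / (2 * pi))) = circle_exp (f x $ i)"
        by (simp add: G circle_exp.abs_eq exp_eq_polar)
    qed
    then show ?thesis by (simp add: torus_of_def g_def vec_eq_iff)
  qed
  ultimately show thesis using that by blast
qed

section \<open>Locally expanding maps, paratingent directions and potentials\<close>

text \<open>Invariance of domain makes \<open>Q\<close> open on small balls, and expansion bounds
  the size of their images from below uniformly. So the range is open and closed, and
  \<open>Q\<close> is a covering of a simply connected space by a connected one.\<close>

lemma expanding_homeomorphism:
  fixes Q :: "'a::euclidean_space \<Rightarrow> 'a"
  assumes cont: "continuous_on UNIV Q" and "\<rho> > 0" "c > 0"
    and exp: "\<And>x y. norm (x - y) < \<rho> \<Longrightarrow> norm (x - y) \<le> c * norm (Q x - Q y)"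
  shows "\<exists>g. homeomorphism UNIV UNIV Q g"
    and "\<And>x r. 0 < r \<Longrightarrow> r < \<rho> \<Longrightarrow> 2 * r < \<rho> \<Longrightarrow> ball (Q x) (r / c) \<subseteq> Q ` ball x r"
proof -
  have inj: "inj_on Q (ball x r)" if "2 * r < \<rho>" for x r
  proof (rule inj_onI)
    fix y z assume yz: "y \<in> ball x r" "z \<in> ball x r" "Q y = Q z"
    then have "norm (y - z) < 2 * r"
      using dist_triangle_less_add[of y x r z r] by (simp add: dist_norm norm_minus_commute)
    then show "y = z" using exp[of y z] that yz by simp
  qed
  show sub: "ball (Q x) (r / c) \<subseteq> Q ` ball x r" if r: "0 < r" "r < \<rho>" "2 * r < \<rho>" for x r
  proof -
    let ?B = "ball (Q x) (r / c)"
    have op: "open (Q ` ball x r)"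
      by (rule invariance_of_domain) (use cont continuous_on_subset inj[OF r(3)] in auto)
    have "compact (Q ` cball x r)"
      by (rule compact_continuous_image) (use cont continuous_on_subset in auto)
    then have cl: "closed (Q ` cball x r)" by (rule compact_imp_closed)
    \<comment> \<open>Boundary points of the ball are moved by at least \<open>r / c\<close>, so
      inside \<open>?B\<close> the images of the closed and of the open ball agree; their common
      trace is open and closed in a connected set.\<close>
    have eq: "?B \<inter> Q ` cball x r = ?B \<inter> Q ` ball x r"
    proof -
      have "y \<in> ball x r" if "Q y \<in> ?B" "y \<in> cball x r" for y
      proof -
        have "norm (x - y) \<le> c * norm (Q x - Q y)"
          using that r by (intro exp) (auto simp: dist_norm)
        also have "\<dots> < r" using that \<open>c > 0\<close> by (simp add: dist_norm field_simps)
        finally show ?thesis by (simp add: dist_norm)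
      qed
      then show ?thesis by fastforce
    qed
    have "openin (top_of_set ?B) (?B \<inter> Q ` ball x r)"
      using op by (rule openin_open_Int)
    moreover have "closedin (top_of_set ?B) (?B \<inter> Q ` ball x r)"
      using closedin_closed_Int[OF cl, of ?B] eq by simp
    ultimately have "?B \<inter> Q ` ball x r = {} \<or> ?B \<inter> Q ` ball x r = ?B"
      using connected_clopen[of ?B] connected_ball by blast
    moreover have "Q x \<in> ?B \<inter> Q ` ball x r" using r \<open>c > 0\<close> by auto
    ultimately show ?thesis by blast
  qed
  define r where "r = \<rho> / 4"
  have r: "0 < r" "r < \<rho>" "2 * r < \<rho>" using \<open>\<rho> > 0\<close> by (auto simp: r_def)
  have rc: "r / c > 0" using r \<open>c > 0\<close> by simp
  have near: "y \<in> range Q" if "dist y (Q x) < r / c" for x y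
    using subsetD[OF sub[OF r, of x], of y] that by (auto simp: dist_commute)
  have "open (range Q)"
    unfolding open_dist
  proof (intro ballI exI conjI allI impI)
    fix y z assume "y \<in> range Q" "dist z y < r / c"
    then show "z \<in> range Q" using near by auto
  qed (rule rc)
  moreover have "closed (range Q)"
    unfolding closed_def open_dist
  proof (intro ballI exI conjI allI impI)
    fix y z assume "y \<in> - range Q" "dist z y < r / c"
    then show "z \<in> - range Q" using near[of y] by (auto simp: dist_commute)
  qed (rule rc)
  ultimately have range: "range Q = UNIV"
    using clopen[of "range Q"] by auto
  have "covering_space UNIV Q UNIV"
  proof
    show "continuous_on UNIV Q" "range Q = UNIV" by fact+
    fix y :: 'a
    let ?T = "ball y (r / c)"
    \<comment> \<open>One sheet around each preimage of \<open>y\<close>. Preimages of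
      \<open>y\<close> closer than \<open>2 * r\<close> coincide, so the sheets are disjoint; a
      point \<open>w\<close> over \<open>?T\<close> is caught because \<open>sub\<close> centred at
      \<open>w\<close> finds a preimage of \<open>y\<close> within \<open>r\<close>.\<close>
    let ?U = "\<lambda>x. ball x r \<inter> Q -` ?T"
    let ?v = "?U ` (Q -` {y})"
    have opU: "open (?U x)" for x
      using cont by (auto intro: open_vimage)
    have "\<Union>?v = UNIV \<inter> Q -` ?T"
    proof -
      have "w \<in> \<Union>?v" if "Q w \<in> ?T" for w
      proof -
        have "y \<in> ball (Q w) (r / c)" using that by (simp add: dist_commute)
        then obtain x where "x \<in> ball w r" "Q x = y" using sub[OF r] by blast
        then show ?thesis using that by (auto simp: dist_commute)
      qed
      then show ?thesis by auto
    qed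
    moreover have "pairwise disjnt ?v"
    proof (rule pairwiseI)
      fix A B assume AB: "A \<in> ?v" "B \<in> ?v" "A \<noteq> B"
      then obtain a b where ab: "A = ?U a" "B = ?U b" "Q a = y" "Q b = y" by auto
      show "disjnt A B"
      proof (rule ccontr)
        assume "\<not> disjnt A B"
        then obtain w where w: "w \<in> ball a r" "w \<in> ball b r" by (auto simp: ab disjnt_def)
        then have "norm (a - b) < 2 * r"
          using dist_triangle_less_add[of a w r b r] by (simp add: dist_norm norm_minus_commute)
        then have "a = b" using exp[of a b] ab r by simp
        then show False using AB ab by simp
      qed
    qed
    moreover have "\<exists>q. homeomorphism u ?T Q q" if u: "u \<in> ?v" for u
    proof -
      obtain x where x: "u = ?U x" "Q x = y" using u by blast
      have "inj_on Q u" using inj[OF r(3), of x] by (auto simp: x inj_on_def)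
      then obtain g where "homeomorphism u (Q ` u) Q g"
        using invariance_of_domain_homeomorphism[of u Q] opU cont continuous_on_subset x(1) by blast
      moreover have "Q ` u = ?T"
        using sub[OF r, of x] by (auto simp: x)
      ultimately show ?thesis by auto
    qed
    ultimately show "\<exists>T. y \<in> T \<and> openin (top_of_set UNIV) T \<and>
         (\<exists>v. \<Union>v = UNIV \<inter> Q -` T \<and> (\<forall>u\<in>v. openin (top_of_set UNIV) u) \<and> pairwise disjnt v \<and>
            (\<forall>u\<in>v. \<exists>q. homeomorphism u T Q q))"
      using rc opU by (intro exI[of _ ?T] conjI exI[of _ ?v]) auto
  qed
  note cov = this
  obtain g where g: "continuous_on UNIV g" "\<And>y. Q (g y) = y"
    using covering_space_lift[OF cov, of UNIV id]
    by (auto simp: convex_imp_simply_connected convex_imp_locally_path_connected)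
  \<comment> \<open>\<open>g\<close> lifts the identity, so \<open>g \<circ> Q\<close> and
    \<open>id\<close> are both lifts of \<open>Q\<close>; they agree at \<open>g 0\<close>.\<close>
  have gQ: "g (Q x) = x" for x
  proof -
    have "(g \<circ> Q) x = id x"
    proof (rule covering_space_lift_unique[OF cov, where a="g 0" and f=Q and T=UNIV and ?g1.0="g \<circ> Q" and ?g2.0=id])
      show "(g \<circ> Q) (g 0) = id (g 0)" by (simp add: g(2))
      show "continuous_on UNIV (g \<circ> Q)"
        using continuous_on_compose[OF cont] g(1) continuous_on_subset by blast
    qed (use cont g(2) in auto)
    then show ?thesis by simp
  qed
  have "range g = UNIV" using gQ by (metis surjI)
  then have "homeomorphism UNIV UNIV Q g"
    using g cont gQ by (simp add: homeomorphism_def range)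
  then show "\<exists>g. homeomorphism UNIV UNIV Q g" by blast
qed

text \<open>By \<open>para\<close> and \<open>vert\<close> each \<open>E q\<close> is the graph of a
  linear map. Quotients with both end points moving make this map a strict derivative, and strict
  differentiability at every point forces the derivative to be continuous.\<close>

lemma paratingent_imp_C1:
  fixes s :: "'a::euclidean_space \<Rightarrow> 'b::euclidean_space" and E :: "'a \<Rightarrow> ('a \<times> 'b) set"
  assumes "\<delta> > 0" and lip: "\<And>q q'. norm (q - q') < \<delta> \<Longrightarrow> norm (s q - s q') \<le> C * norm (q - q')"
    and sub: "\<And>q. subspace (E q)" and vert: "\<And>q b. (0, b) \<in> E q \<Longrightarrow> b = 0"
    and para: "\<And>q u w \<epsilon> v. u \<longlonglongrightarrow> q \<Longrightarrow> w \<longlonglongrightarrow> q \<Longrightarrow> (\<And>n. \<epsilon> n > (0::real)) \<Longrightarrow>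
       (\<lambda>n. ((u n, s (u n)) - (w n, s (w n))) /\<^sub>R \<epsilon> n) \<longlonglongrightarrow> v \<Longrightarrow> v \<in> E q"
  obtains s' where "\<And>q. (s has_derivative s' q) (at q)" "\<And>v. continuous_on UNIV (\<lambda>q. s' q v)"
    "\<And>q v. (v, s' q v) \<in> E q"
proof -
  \<comment> \<open>The local Lipschitz bound keeps the quotients of \<open>s\<close> bounded, so a
    subsequence converges.\<close>
  have key: "\<exists>b r. strict_mono r \<and> (\<lambda>n. (s (u (r n)) - s (w (r n))) /\<^sub>R \<epsilon> (r n)) \<longlonglongrightarrow> b \<and> (v, b) \<in> E q"
    if u: "u \<longlonglongrightarrow> q" and w: "w \<longlonglongrightarrow> q" and eps: "\<And>n. \<epsilon> n > (0::real)" and v: "(\<lambda>n. (u n - w n) /\<^sub>R \<epsilon> n) \<longlonglongrightarrow> v"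
    for u w \<epsilon> v q
  proof -
    let ?b = "\<lambda>n. (s (u n) - s (w n)) /\<^sub>R \<epsilon> n"
    have "(\<lambda>n. u n - w n) \<longlonglongrightarrow> 0" using tendsto_diff[OF u w] by simp
    then have "\<forall>\<^sub>F n in sequentially. norm (u n - w n) < \<delta>"
      using tendstoD[OF _ \<open>\<delta> > 0\<close>] by fastforce
    then have ev: "\<forall>\<^sub>F n in sequentially. norm (?b n) \<le> C * norm ((u n - w n) /\<^sub>R \<epsilon> n)"
    proof eventually_elim
      case (elim n)
      have "norm (s (u n) - s (w n)) / \<epsilon> n \<le> C * norm (u n - w n) / \<epsilon> n"
        using lip[OF elim] eps[of n] by (intro divide_right_mono) auto
      then show ?case using eps[of n] by (simp add: divide_inverse_commute mult.left_commute)
    qed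
    have "Bseq (\<lambda>n. C * norm ((u n - w n) /\<^sub>R \<epsilon> n))"
      by (rule convergent_imp_Bseq[OF convergentI[OF tendsto_mult[OF tendsto_const tendsto_norm[OF v]]]])
    then have "Bseq ?b"
      by (rule Bseq_eventually_mono[rotated]) (use ev in \<open>auto elim: eventually_mono\<close>)
    then have "bounded (range ?b)" by (simp add: Bseq_eq_bounded)
    then obtain b r where br: "strict_mono (r::nat\<Rightarrow>nat)" "(?b \<circ> r) \<longlonglongrightarrow> b"
      using bounded_imp_convergent_subsequence by blast
    have "(v, b) \<in> E q"
    proof (rule para[of "u \<circ> r" q "w \<circ> r" "\<epsilon> \<circ> r"])
      show "(u \<circ> r) \<longlonglongrightarrow> q" "(w \<circ> r) \<longlonglongrightarrow> q" using u w br(1) LIMSEQ_subseq_LIMSEQ by blast+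
      have "(\<lambda>n. ((u (r n) - w (r n)) /\<^sub>R \<epsilon> (r n), ?b (r n))) \<longlonglongrightarrow> (v, b)"
        using LIMSEQ_subseq_LIMSEQ[OF v br(1)] br(2) by (intro tendsto_Pair) (auto simp: o_def)
      then show "(\<lambda>n. (((u \<circ> r) n, s ((u \<circ> r) n)) - ((w \<circ> r) n, s ((w \<circ> r) n))) /\<^sub>R (\<epsilon> \<circ> r) n) \<longlonglongrightarrow> (v, b)"
        by simp
    qed (use eps in auto)
    with br show ?thesis by (auto simp: o_def)
  qed
  \<comment> \<open>Quotients along the straight line in direction \<open>v\<close> show that
    \<open>E q\<close> projects onto the whole base.\<close>
  have ex: "\<exists>b. (v, b) \<in> E q" for v q
    using key[OF step_tendsto[of q v] tendsto_const, of "\<lambda>n. inverse (real (Suc n))" v] by auto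
  have uniq: "b = b'" if "(v, b) \<in> E q" "(v, b') \<in> E q" for v b b' q
    using subspace_diff[OF sub that] vert[of "b - b'" q] by simp
  define s' where "s' q v = (THE b. (v, b) \<in> E q)" for q v
  have s': "(v, s' q v) \<in> E q" for q v
    unfolding s'_def using ex uniq theI'[of "\<lambda>b. (v, b) \<in> E q"] by metis
  have s'_eq: "s' q v = b" if "(v, b) \<in> E q" for q v b
    using uniq s' that by blast
  have lin: "linear (s' q)" for q
  proof (rule linearI)
    show "s' q (a + b) = s' q a + s' q b" for a b
      using subspace_add[OF sub s' s', of a q b] by (intro s'_eq) simp
    show "s' q (r *\<^sub>R a) = r *\<^sub>R s' q a" for a r
      using subspace_scale[OF sub s', of r a q] by (intro s'_eq) simp
  qed
  \<comment> \<open>Counterexamples, normalised by the distance of their two points, would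
    accumulate at a vector of \<open>E q\<close>; but there the second component is given by
    \<open>s' q\<close>, so the defect tends to 0.\<close>
  have strict: "\<exists>d>0. \<forall>u w. norm (u - q) < d \<longrightarrow> norm (w - q) < d \<longrightarrow> norm (s u - s w - s' q (u - w)) \<le> e * norm (u - w)"
    if "e > 0" for q e
  proof (rule ccontr)
    assume "\<not> ?thesis"
    then have "\<exists>u w. norm (u - q) < inverse (real (Suc n)) \<and> norm (w - q) < inverse (real (Suc n)) \<and>
        norm (s u - s w - s' q (u - w)) > e * norm (u - w)" for n
      by (metis inverse_positive_iff_positive not_le of_nat_0_less_iff zero_less_Suc)
    then obtain u w where uw: "\<And>n. norm (u n - q) < inverse (real (Suc n))" "\<And>n. norm (w n - q) < inverse (real (Suc n))"
        "\<And>n. norm (s (u n) - s (w n) - s' q (u n - w n)) > e * norm (u n - w n)" by metis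
    have conv: "x \<longlonglongrightarrow> q" if "\<And>n. norm (x n - q) < inverse (real (Suc n))" for x
    proof -
      have "(\<lambda>n. x n - q) \<longlonglongrightarrow> 0"
        by (rule Lim_null_comparison[OF _ LIMSEQ_inverse_real_of_nat]) (use that less_imp_le in \<open>auto intro: always_eventually\<close>)
      then show ?thesis using Lim_null by blast
    qed
    define \<epsilon> where "\<epsilon> n = norm (u n - w n)" for n
    have eps: "\<epsilon> n > 0" for n
      using uw(3)[of n] linear_0[OF lin, of q] by (cases "u n = w n") (auto simp: \<epsilon>_def)
    have "\<forall>n. (u n - w n) /\<^sub>R \<epsilon> n \<in> sphere 0 1"
      using eps by (auto simp: \<epsilon>_def)
    then obtain v r where r: "strict_mono (r::nat\<Rightarrow>nat)" "((\<lambda>n. (u n - w n) /\<^sub>R \<epsilon> n) \<circ> r) \<longlonglongrightarrow> v"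
      using seq_compactE[OF compact_sphere[of "0::'a" 1, unfolded compact_eq_seq_compact_metric],
          of "\<lambda>n. (u n - w n) /\<^sub>R \<epsilon> n"] by blast
    obtain b r' where r': "strict_mono r'" "(\<lambda>n. (s (u (r (r' n))) - s (w (r (r' n)))) /\<^sub>R \<epsilon> (r (r' n))) \<longlonglongrightarrow> b" "(v, b) \<in> E q"
      using key[of "u \<circ> r" q "w \<circ> r" "\<epsilon> \<circ> r" v] LIMSEQ_subseq_LIMSEQ[OF conv[OF uw(1)] r(1)]
        LIMSEQ_subseq_LIMSEQ[OF conv[OF uw(2)] r(1)] eps r(2) by (auto simp: o_def)
    have "(\<lambda>n. s' q ((u (r (r' n)) - w (r (r' n))) /\<^sub>R \<epsilon> (r (r' n)))) \<longlonglongrightarrow> s' q v"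
      using LIMSEQ_subseq_LIMSEQ[OF r(2) r'(1)] linear_continuous_at[OF linear_conv_bounded_linear[THEN iffD1, OF lin]]
      by (intro isCont_tendsto_compose[of _ "s' q"]) (auto simp: o_def)
    then have "(\<lambda>n. norm ((s (u (r (r' n))) - s (w (r (r' n)))) /\<^sub>R \<epsilon> (r (r' n)) - s' q ((u (r (r' n)) - w (r (r' n))) /\<^sub>R \<epsilon> (r (r' n))))) \<longlonglongrightarrow> norm (b - s' q v)"
      by (intro tendsto_norm tendsto_diff r'(2))
    then have "(\<lambda>n. norm ((s (u (r (r' n))) - s (w (r (r' n)))) /\<^sub>R \<epsilon> (r (r' n)) - s' q ((u (r (r' n)) - w (r (r' n))) /\<^sub>R \<epsilon> (r (r' n))))) \<longlonglongrightarrow> 0"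
      using s'_eq[OF r'(3)] by simp
    moreover have "e \<le> norm ((s (u n) - s (w n)) /\<^sub>R \<epsilon> n - s' q ((u n - w n) /\<^sub>R \<epsilon> n))" for n
    proof -
      have "(s (u n) - s (w n)) /\<^sub>R \<epsilon> n - s' q ((u n - w n) /\<^sub>R \<epsilon> n) = (s (u n) - s (w n) - s' q (u n - w n)) /\<^sub>R \<epsilon> n"
        by (simp add: scaleR_diff_right linear_scale[OF lin] linear_diff[OF lin])
      moreover have "e * \<epsilon> n \<le> norm (s (u n) - s (w n) - s' q (u n - w n))"
        using uw(3)[of n] by (simp add: \<epsilon>_def)
      then have "e \<le> norm (s (u n) - s (w n) - s' q (u n - w n)) / \<epsilon> n"
        using eps[of n] by (simp add: pos_le_divide_eq)
      moreover have "norm (x /\<^sub>R \<epsilon> n) = norm x / \<epsilon> n" for x :: 'b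
        using eps[of n] by (simp add: divide_inverse_commute)
      ultimately show ?thesis by simp
    qed
    ultimately have "e \<le> 0"
      by (meson LIMSEQ_le_const)
    with \<open>e > 0\<close> show False by simp
  qed
  have deriv: "(s has_derivative s' q) (at q)" for q
    unfolding has_derivative_at_alt
  proof (intro conjI allI impI)
    show "bounded_linear (s' q)" using lin by (simp add: linear_conv_bounded_linear)
    fix e :: real assume "e > 0"
    from strict[OF this, of q] obtain d where "d > 0"
      "\<And>u w. norm (u - q) < d \<Longrightarrow> norm (w - q) < d \<Longrightarrow> norm (s u - s w - s' q (u - w)) \<le> e * norm (u - w)" by blast
    then show "\<exists>d>0. \<forall>y. norm (y - q) < d \<longrightarrow> norm (s y - s q - s' q (y - q)) \<le> e * norm (y - q)"
      by (intro exI[of _ d]) auto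
  qed
  have "continuous_on UNIV (\<lambda>q. s' q v)" for v
    unfolding continuous_on_iff
  proof (intro ballI allI impI)
    fix q :: 'a and e :: real assume "e > 0"
    define e1 where "e1 = e / (4 * (norm v + 1))"
    have v1: "norm v + 1 > 0" using norm_ge_zero[of v] by linarith
    have e1: "e1 > 0" using \<open>e > 0\<close> v1 by (simp add: e1_def)
    from strict[OF e1, of q] obtain d where d: "d > 0"
      "\<And>u w. norm (u - q) < d \<Longrightarrow> norm (w - q) < d \<Longrightarrow> norm (s u - s w - s' q (u - w)) \<le> e1 * norm (u - w)" by blast
    have "norm (s' q' v - s' q v) < e" if q': "norm (q' - q) < d / 2" for q'
    proof -
      from strict[OF e1, of q'] obtain d' where d': "d' > 0"
        "\<And>u w. norm (u - q') < d' \<Longrightarrow> norm (w - q') < d' \<Longrightarrow> norm (s u - s w - s' q' (u - w)) \<le> e1 * norm (u - w)" by blast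
      \<comment> \<open>A step so short that it stays inside the strict neighbourhoods of
        \<open>q\<close> and of \<open>q'\<close> at once; both estimates then concern the same
        increment of \<open>s\<close>. The summand 1 covers \<open>v = 0\<close>.\<close>
      define \<tau> where "\<tau> = min d' (d / 2) / (2 * (norm v + 1))"
      have \<tau>: "\<tau> > 0" using d(1) d'(1) v1 by (simp add: \<tau>_def)
      have "\<tau> * norm v \<le> \<tau> * (norm v + 1)" using \<tau> by simp
      also have "\<dots> = min d' (d / 2) / 2"
      proof -
        have "x / (2 * k) * k = x / 2" if "k > 0" for x k :: real using that by simp
        from this[OF v1] show ?thesis by (simp add: \<tau>_def)
      qed
      also have "\<dots> < min d' (d / 2)" using d(1) d'(1) by linarith
      finally have small: "norm (\<tau> *\<^sub>R v) < d'" "norm (\<tau> *\<^sub>R v) < d / 2" using \<tau> by auto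
      have "norm (s (q' + \<tau> *\<^sub>R v) - s q' - s' q' (\<tau> *\<^sub>R v)) \<le> e1 * norm (\<tau> *\<^sub>R v)"
        using d'(2)[of "q' + \<tau> *\<^sub>R v" q'] d'(1) small by simp
      moreover have "norm (q' + \<tau> *\<^sub>R v - q) < d"
        using norm_triangle_ineq[of "q' - q" "\<tau> *\<^sub>R v"] small q' by (simp add: algebra_simps)
      then have "norm (s (q' + \<tau> *\<^sub>R v) - s q' - s' q (\<tau> *\<^sub>R v)) \<le> e1 * norm (\<tau> *\<^sub>R v)"
        using d(2)[of "q' + \<tau> *\<^sub>R v" q'] d(1) q' by simp
      ultimately have "norm (s' q' (\<tau> *\<^sub>R v) - s' q (\<tau> *\<^sub>R v)) \<le> 2 * e1 * norm (\<tau> *\<^sub>R v)"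
        using norm_triangle_ineq4[of "s (q' + \<tau> *\<^sub>R v) - s q' - s' q (\<tau> *\<^sub>R v)" "s (q' + \<tau> *\<^sub>R v) - s q' - s' q' (\<tau> *\<^sub>R v)"]
        by (simp add: algebra_simps)
      then have "\<tau> * norm (s' q' v - s' q v) \<le> \<tau> * (2 * e1 * norm v)"
        using \<tau> by (simp add: linear_scale[OF lin] scaleR_diff_right[symmetric] mult_ac)
      then have "norm (s' q' v - s' q v) \<le> 2 * e1 * norm v" using \<tau> by simp
      also have "\<dots> \<le> 2 * e1 * (norm v + 1)" using e1 by simp
      also have "\<dots> = e / 2"
      proof -
        have "2 * (e / (4 * k)) * k = e / 2" if "k > 0" for k :: real using that by simp
        from this[OF v1] show ?thesis by (simp add: e1_def)
      qed
      finally show ?thesis using \<open>e > 0\<close> by simp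
    qed
    then show "\<exists>d>0. \<forall>x'\<in>UNIV. dist x' q < d \<longrightarrow> dist (s' x' v) (s' q v) < e"
      using d(1) by (intro exI[of _ "d / 2"]) (auto simp: dist_norm)
  qed
  with deriv s' that show thesis by blast
qed

lemma poincare_potential:
  fixes s :: "'a::euclidean_space \<Rightarrow> 'a"
  assumes der: "\<And>q. (s has_derivative s' q) (at q)" and cont: "\<And>v. continuous_on UNIV (\<lambda>q. s' q v)"
    and sym: "\<And>q v w. s' q v \<bullet> w = s' q w \<bullet> v"
  obtains u where "\<And>q. (u has_derivative (\<lambda>v. s q \<bullet> v)) (at q)"
proof -
  have lin: "linear (s' q)" for q
    using der has_derivative_linear by blast
  have s_cont: "continuous_on UNIV s"
    using der by (meson continuous_at_imp_continuous_on has_derivative_continuous)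
  \<comment> \<open>The \<open>t\<close>-derivative of \<open>t *\<^sub>R s (t *\<^sub>R x)\<close>
    and, by symmetry of \<open>s'\<close>, also the gradient in \<open>x\<close> of the integrand of
    \<open>u\<close> below; so differentiation under the integral leaves \<open>s x\<close>.\<close>
  define G where "G x t = t *\<^sub>R s' (t *\<^sub>R x) x + s (t *\<^sub>R x)" for x :: 'a and t :: real
  have expand: "s' q x = (\<Sum>b\<in>Basis. (x \<bullet> b) *\<^sub>R s' q b)" for q x
    by (subst euclidean_representation[of x, symmetric]) (simp add: linear_sum[OF lin] linear_scale[OF lin] del: euclidean_representation)
  have G_cont: "continuous_on UNIV (\<lambda>(x, t). G x t)"
  proof -
    have "continuous_on UNIV (\<lambda>z::'a\<times>real. snd z *\<^sub>R (\<Sum>b\<in>Basis. (fst z \<bullet> b) *\<^sub>R s' (snd z *\<^sub>R fst z) b) + s (snd z *\<^sub>R fst z))"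
      by (intro continuous_intros continuous_on_compose2[OF cont] continuous_on_compose2[OF s_cont]) auto
    then show ?thesis
      unfolding G_def case_prod_beta by (simp add: expand[symmetric])
  qed
  have path: "((\<lambda>t. s (t *\<^sub>R x)) has_vector_derivative s' (t *\<^sub>R x) x) (at t within S)" for x t S
  proof -
    have "((\<lambda>t. t *\<^sub>R x) has_vector_derivative x) (at t within S)"
      by (auto intro!: derivative_eq_intros)
    from vector_derivative_diff_chain_within[OF this has_derivative_at_withinI[OF der]]
    show ?thesis by (simp add: o_def)
  qed
  define u where "u x = integral (cbox 0 1) (\<lambda>t::real. s (t *\<^sub>R x) \<bullet> x)" for x
  have "(u has_derivative (\<lambda>v. s q \<bullet> v)) (at q)" for q
  proof -
    have "((\<lambda>x. integral (cbox 0 1) (\<lambda>t::real. s (t *\<^sub>R x) \<bullet> x)) has_derivative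
        integral (cbox 0 1) (\<lambda>t. blinfun_inner_left (G q t))) (at q within UNIV)"
    proof (rule leibniz_rule)
      fix x :: 'a and t :: real
      have "((\<lambda>x. s (t *\<^sub>R x)) has_derivative (\<lambda>h. s' (t *\<^sub>R x) (t *\<^sub>R h))) (at x)"
        using has_derivative_compose[OF has_derivative_scaleR_right[OF has_derivative_ident] der, of t x UNIV] by simp
      from has_derivative_inner[OF this has_derivative_ident]
      have "((\<lambda>x. s (t *\<^sub>R x) \<bullet> x) has_derivative (\<lambda>h. s (t *\<^sub>R x) \<bullet> h + s' (t *\<^sub>R x) (t *\<^sub>R h) \<bullet> x)) (at x)" .
      moreover have "(\<lambda>h. s (t *\<^sub>R x) \<bullet> h + s' (t *\<^sub>R x) (t *\<^sub>R h) \<bullet> x) = blinfun_apply (blinfun_inner_left (G x t))"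
        using sym[of "t *\<^sub>R x" _ x]
        by (auto simp: fun_eq_iff G_def linear_scale[OF lin] inner_add_right inner_add_left inner_commute)
      ultimately show "((\<lambda>x. s (t *\<^sub>R x) \<bullet> x) has_derivative blinfun_apply (blinfun_inner_left (G x t))) (at x within UNIV)"
        by simp
    next
      fix x :: 'a
      show "(\<lambda>t::real. s (t *\<^sub>R x) \<bullet> x) integrable_on cbox 0 1"
        by (intro integrable_continuous continuous_intros continuous_on_compose2[OF s_cont]) auto
      have "continuous_on (UNIV \<times> cbox (0::real) 1) (\<lambda>z. blinfun_inner_left (case z of (x, t) \<Rightarrow> G x t))"
        by (intro bounded_linear.continuous_on[OF bounded_linear_blinfun_inner_left] continuous_on_subset[OF G_cont]) auto
      then show "continuous_on (UNIV \<times> cbox (0::real) 1) (\<lambda>(x, t). blinfun_inner_left (G x t))"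
        by (simp add: case_prod_beta)
    qed auto
    moreover have "((\<lambda>t. G q t) has_integral s q) (cbox 0 1)"
    proof -
      have "((\<lambda>t. G q t) has_integral (1 *\<^sub>R s (1 *\<^sub>R q) - 0 *\<^sub>R s (0 *\<^sub>R q))) {0..1}"
      proof (rule fundamental_theorem_of_calculus)
        fix t :: real
        have "((\<lambda>t. t *\<^sub>R s (t *\<^sub>R q)) has_vector_derivative t *\<^sub>R s' (t *\<^sub>R q) q + 1 *\<^sub>R s (t *\<^sub>R q)) (at t within {0..1})"
          by (intro bounded_bilinear.has_vector_derivative[OF bounded_bilinear_scaleR] path has_vector_derivative_id)
        then show "((\<lambda>t. t *\<^sub>R s (t *\<^sub>R q)) has_vector_derivative G q t) (at t within {0..1})"
          by (simp add: G_def)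
      qed simp
      then show ?thesis by simp
    qed
    then have "integral (cbox 0 1) (\<lambda>t. blinfun_inner_left (G q t)) = blinfun_inner_left (s q)"
      by (intro integral_unique has_integral_linear[OF _ bounded_linear_blinfun_inner_left, unfolded o_def])
    ultimately show ?thesis
      by (simp add: u_def[abs_def] inner_commute)
  qed
  with that show thesis by blast
qed

section \<open>Tori with isotropic, nowhere vertical paratingent spaces\<close>

text \<open>\<open>E z\<close> encloses all limits of difference quotients at \<open>z\<close> with
  both end points moving. Its dimension is not prescribed; that it projects onto the whole base is a
  consequence.\<close>

locale paratingent_torus =
  fixes N :: "'n::finite cotangent set" and h :: "'n torus \<Rightarrow> 'n cotangent" and h' :: "'n cotangent \<Rightarrow> 'n torus"
    and C :: real and E :: "'n lifted \<Rightarrow> 'n lifted set"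
  assumes homeo: "homeomorphism UNIV N h h'" and lip_h': "C-lipschitz_on N h'"
    and subspace_E: "cotangent_of z \<in> N \<Longrightarrow> subspace (E z)"
    and vertical_E: "cotangent_of z \<in> N \<Longrightarrow> (0, c) \<in> E z \<Longrightarrow> c = 0"
    and isotropic_E: "cotangent_of z \<in> N \<Longrightarrow> u \<in> E z \<Longrightarrow> w \<in> E z \<Longrightarrow> omega u w = 0"
    and paratingent: "(\<And>n. cotangent_of (a n) \<in> N) \<Longrightarrow> (\<And>n. cotangent_of (b n) \<in> N) \<Longrightarrow> a \<longlonglongrightarrow> z \<Longrightarrow> b \<longlonglongrightarrow> z \<Longrightarrow>
      (\<And>n. \<epsilon> n > (0::real)) \<Longrightarrow> (\<lambda>n. (a n - b n) /\<^sub>R \<epsilon> n) \<longlonglongrightarrow> v \<Longrightarrow> v \<in> E z"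
begin

lemma h_in: "h \<theta> \<in> N"
  using homeomorphism_image1[OF homeo] by blast

text \<open>Otherwise steeper and steeper difference quotients, normalised and moved to a compact
  set, accumulate at a unit vertical vector of \<open>E\<close>, contrary to
  \<open>vertical_E\<close>. One \<open>n\<close> serves both as inverse radius and as
  constant.\<close>

lemma fst_expanding:
  obtains r c where "r > 0" "c > 0"
    "\<And>a b. cotangent_of a \<in> N \<Longrightarrow> cotangent_of b \<in> N \<Longrightarrow> norm (a - b) < r \<Longrightarrow> norm (a - b) \<le> c * norm (fst a - fst b)"
proof -
  have "\<exists>n. \<forall>a b. cotangent_of a \<in> N \<longrightarrow> cotangent_of b \<in> N \<longrightarrow> norm (a - b) < inverse (real (Suc n)) \<longrightarrow>
      norm (a - b) \<le> real (Suc n) * norm (fst a - fst b)"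
  proof (rule ccontr)
    assume "\<not> ?thesis"
    then have "\<forall>n. \<exists>a b. cotangent_of a \<in> N \<and> cotangent_of b \<in> N \<and> norm (a - b) < inverse (real (Suc n)) \<and>
      real (Suc n) * norm (fst a - fst b) < norm (a - b)" by (simp add: not_le)
    then obtain a0 b0 where ab0: "\<And>n. cotangent_of (a0 n) \<in> N" "\<And>n. cotangent_of (b0 n) \<in> N"
      "\<And>n. norm (a0 n - b0 n) < inverse (real (Suc n))"
      "\<And>n. real (Suc n) * norm (fst (a0 n) - fst (b0 n)) < norm (a0 n - b0 n)" by metis
    have "\<forall>n. \<exists>m. m \<in> int_vec \<and> fst (a0 n) - m \<in> cbox 0 1" by (metis int_vec_floor)
    then obtain m where m: "\<And>n. m n \<in> int_vec" "\<And>n. fst (a0 n) - m n \<in> cbox 0 1" by metis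
    \<comment> \<open>Both points are moved by the same integer vector, so that only
      \<open>a\<close> has to lie over the unit cell and the difference is unchanged.\<close>
    define a b where "a n = a0 n + (- m n, 0)" and "b n = b0 n + (- m n, 0)" for n
    have diff: "a n - b n = a0 n - b0 n" for n by (simp add: a_def b_def)
    have ab: "cotangent_of (a n) \<in> N" "cotangent_of (b n) \<in> N" for n
      using ab0(1,2) m(1)[THEN int_vec_closed(2)] by (simp_all add: a_def b_def)
    have small: "norm (a n - b n) < inverse (real (Suc n))" for n
      using ab0(3) by (simp add: diff)
    have steep: "real (Suc n) * norm (fst (a n - b n)) < norm (a n - b n)" for n
      using ab0(4)[of n] unfolding diff by simp
    obtain R where R: "\<And>x. x \<in> N \<Longrightarrow> norm (snd x) \<le> R"
      by (rule bounded_fiber_component[OF compact_torus_image[OF homeo]]) blast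
    have snd_cot: "snd (cotangent_of z) = snd z" for z :: "'n lifted" by (simp add: cotangent_of_def)
    have comp: "compact (cotangent_of -` N \<inter> cbox 0 1 \<times> cball 0 R)"
      by (intro closed_Int_compact closed_cotangent_lift[OF compact_torus_image[OF homeo]] compact_Times compact_cbox compact_cball)
    define \<epsilon> where "\<epsilon> n = norm (a n - b n)" for n
    have eps: "\<epsilon> n > 0" for n
    proof -
      have "0 \<le> real (Suc n) * norm (fst (a n - b n))" by simp
      then show ?thesis using steep[of n] unfolding \<epsilon>_def by linarith
    qed
    have "\<forall>n. (a n, (a n - b n) /\<^sub>R \<epsilon> n) \<in> (cotangent_of -` N \<inter> cbox 0 1 \<times> cball 0 R) \<times> sphere 0 1"
    proof
      fix n
      have "fst (a n) \<in> cbox 0 1" using m(2)[of n] by (simp add: a_def)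
      moreover have "norm (snd (a n)) \<le> R" using R[OF ab(1)[of n]] by (simp add: snd_cot)
      moreover have "norm ((a n - b n) /\<^sub>R \<epsilon> n) = 1" using eps[of n] by (simp add: \<epsilon>_def)
      ultimately show "(a n, (a n - b n) /\<^sub>R \<epsilon> n) \<in> (cotangent_of -` N \<inter> cbox 0 1 \<times> cball 0 R) \<times> sphere 0 1"
        using ab(1)[of n] by (auto simp: mem_Times_iff)
    qed
    then obtain l r where l: "l \<in> (cotangent_of -` N \<inter> cbox 0 1 \<times> cball 0 R) \<times> sphere 0 1" and
      r: "strict_mono (r::nat\<Rightarrow>nat)" "((\<lambda>n. (a n, (a n - b n) /\<^sub>R \<epsilon> n)) \<circ> r) \<longlonglongrightarrow> l"
      using seq_compactE[OF compact_Times[OF comp compact_sphere, unfolded compact_eq_seq_compact_metric],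
          of "\<lambda>n. (a n, (a n - b n) /\<^sub>R \<epsilon> n)"] by blast
    have az: "(\<lambda>n. a (r n)) \<longlonglongrightarrow> fst l" and v: "(\<lambda>n. (a (r n) - b (r n)) /\<^sub>R \<epsilon> (r n)) \<longlonglongrightarrow> snd l"
      using tendsto_fst[OF r(2)] tendsto_snd[OF r(2)] by (simp_all add: o_def)
    have inv: "(\<lambda>n. inverse (real (Suc (r n)))) \<longlonglongrightarrow> 0"
      using LIMSEQ_subseq_LIMSEQ[OF LIMSEQ_inverse_real_of_nat r(1)] by (simp add: o_def)
    have "(\<lambda>n. a (r n) - b (r n)) \<longlonglongrightarrow> 0"
      by (rule Lim_null_comparison[OF _ inv]) (use small less_imp_le in \<open>auto intro!: always_eventually\<close>)
    from tendsto_diff[OF az this] have bz: "(\<lambda>n. b (r n)) \<longlonglongrightarrow> fst l" by simp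
    have "snd l \<in> E (fst l)"
      by (rule paratingent[OF ab(1) ab(2) az bz eps v])
    moreover have "(\<lambda>n. fst ((a (r n) - b (r n)) /\<^sub>R \<epsilon> (r n))) \<longlonglongrightarrow> 0"
    proof (rule Lim_null_comparison[OF always_eventually inv], rule allI)
      fix n
      have "norm (fst (a (r n) - b (r n))) * real (Suc (r n)) \<le> \<epsilon> (r n)"
        using steep[of "r n"] by (simp add: \<epsilon>_def mult.commute)
      then have "norm (fst (a (r n) - b (r n))) / \<epsilon> (r n) \<le> inverse (real (Suc (r n)))"
        using eps[of "r n"] by (simp add: field_simps del: of_nat_Suc)
      then show "norm (fst ((a (r n) - b (r n)) /\<^sub>R \<epsilon> (r n))) \<le> inverse (real (Suc (r n)))"
        using eps[of "r n"] by (simp add: divide_inverse_commute del: fst_diff of_nat_Suc)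
    qed
    then have "fst (snd l) = 0"
      using LIMSEQ_unique tendsto_fst[OF v] by blast
    ultimately have "snd (snd l) = 0"
      using vertical_E[of "fst l" "snd (snd l)"] l by (metis IntD1 mem_Times_iff prod.collapse vimageE)
    with \<open>fst (snd l) = 0\<close> have "snd l = 0" by (simp add: prod_eq_iff)
    with l show False by auto
  qed
  then obtain n where "\<forall>a b. cotangent_of a \<in> N \<longrightarrow> cotangent_of b \<in> N \<longrightarrow> norm (a - b) < inverse (real (Suc n)) \<longrightarrow>
      norm (a - b) \<le> real (Suc n) * norm (fst a - fst b)" ..
  then show thesis
    by (intro that[of "inverse (real (Suc n))" "real (Suc n)"]) auto
qed

text \<open>The increment of \<open>Q\<close> over an integer vector \<open>m\<close> is continuous
  and integral, hence constant. It is not claimed to be \<open>m\<close>, as the homotopy class of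
  \<open>h\<close> is unknown.\<close>

lemma lift_parametrization:
  obtains Q P where "continuous_on UNIV Q" "continuous_on UNIV P" "\<And>x. cotangent_of (Q x, P x) = h (torus_of x)"
    "\<And>m x y. m \<in> int_vec \<Longrightarrow> Q (x + m) - Q x = Q (y + m) - Q y" "\<And>m x. m \<in> int_vec \<Longrightarrow> P (x + m) = P x"
proof -
  have hc: "continuous_on UNIV (\<lambda>x. h (torus_of x))"
    using continuous_on_compose2[OF homeomorphism_cont1[OF homeo] continuous_on_torus_of] by simp
  then have "continuous_on UNIV (\<lambda>x. fst (h (torus_of x)))" by (intro continuous_intros)
  then obtain Q where Q: "continuous_on UNIV Q" "\<And>x. torus_of (Q x) = fst (h (torus_of x))"
    using torus_lift by blast
  define P where "P x = snd (h (torus_of x))" for x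
  have "Q (x + m) - Q x = Q (y + m) - Q y" if m: "m \<in> int_vec" for m x y
  proof -
    define d where "d x = Q (x + m) - Q x" for x
    have int: "d x \<in> int_vec" for x
      using Q(2) m by (simp add: d_def torus_of_eq_iff[symmetric])
    have "(\<lambda>x. d x $ i) constant_on UNIV" for i
    proof (rule continuous_discrete_range_constant)
      show "continuous_on UNIV (\<lambda>x. d x $ i)"
        unfolding d_def by (intro continuous_intros continuous_on_compose2[OF Q(1)] Q(1)) auto
      fix x
      have "1 \<le> norm (d y $ i - d x $ i)" if "d y $ i \<noteq> d x $ i" for y
        using Ints_nonzero_abs_ge1[of "d y $ i - d x $ i"] int that by (auto simp: int_vec_def)
      then show "\<exists>e>0. \<forall>y. y \<in> UNIV \<and> d y $ i \<noteq> d x $ i \<longrightarrow> e \<le> norm (d y $ i - d x $ i)"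
        by (intro exI[of _ 1]) auto
    qed (rule connected_UNIV)
    then have "d x = d y" unfolding vec_eq_iff constant_on_def by (metis UNIV_I)
    then show ?thesis by (simp add: d_def)
  qed
  moreover have "continuous_on UNIV P" unfolding P_def using hc by (intro continuous_intros)
  moreover have "cotangent_of (Q x, P x) = h (torus_of x)" for x
    by (simp add: cotangent_of_def Q P_def)
  moreover have "P (x + m) = P x" if "m \<in> int_vec" for m x using that by (simp add: P_def)
  ultimately show thesis using Q(1) that by blast
qed

text \<open>The last clause is conditional because \<open>s\<close> is only locally Lipschitz at
  this stage and its potential comes later, whereas the proof of periodicity needs the
  parametrization, which is visible only here.\<close>

lemma global_section:
  obtains s where "continuous_on UNIV s" "\<And>q. cotangent_of (q, s q) \<in> N"
    "\<exists>\<delta>>0. \<exists>c. \<forall>q q'. norm (q - q') < \<delta> \<longrightarrow> norm (s q - s q') \<le> c * norm (q - q')"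
    "\<And>z. cotangent_of z \<in> N \<Longrightarrow> \<exists>q. cotangent_of z = cotangent_of (q, s q)"
    "\<And>a q. (\<And>u. (\<And>q. (u has_derivative (\<lambda>v. s q \<bullet> v)) (at q)) \<Longrightarrow> a \<in> int_vec \<Longrightarrow> s (q + a) = s q)"
proof -
  obtain Q P where Q: "continuous_on UNIV Q" and P: "continuous_on UNIV P" and QP: "\<And>x. cotangent_of (Q x, P x) = h (torus_of x)"
    and Q_add: "\<And>m x y. m \<in> int_vec \<Longrightarrow> Q (x + m) - Q x = Q (y + m) - Q y" and P_add: "\<And>m x. m \<in> int_vec \<Longrightarrow> P (x + m) = P x"
    by (rule lift_parametrization) blast
  obtain r c where r: "r > 0" "c > 0"
    and exp: "\<And>a b. cotangent_of a \<in> N \<Longrightarrow> cotangent_of b \<in> N \<Longrightarrow> norm (a - b) < r \<Longrightarrow> norm (a - b) \<le> c * norm (fst a - fst b)"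
    by (rule fst_expanding) blast
  define w where "w x = (Q x, P x)" for x
  have w_cont: "continuous_on UNIV w" unfolding w_def by (intro continuous_intros Q P)
  have w_N: "cotangent_of (w x) \<in> N" for x by (simp add: w_def QP h_in)
  \<comment> \<open>\<open>w\<close> need not be periodic, but its differences are; so uniform
    continuity on the unit cell enlarged by 1 on each side is enough.\<close>
  obtain \<rho>0 where \<rho>0: "\<rho>0 > 0" "\<And>x y. norm (x - y) < \<rho>0 \<Longrightarrow> norm (w x - w y) < min r (1/2)"
  proof -
    have "uniformly_continuous_on (cbox (- 1) (2::real^'n)) w"
      by (intro compact_uniformly_continuous compact_cbox continuous_on_subset[OF w_cont]) auto
    then obtain d where d: "d > 0" "\<And>x y. x \<in> cbox (- 1) 2 \<Longrightarrow> y \<in> cbox (- 1) 2 \<Longrightarrow> dist y x < d \<Longrightarrow> dist (w y) (w x) < min r (1/2)"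
      unfolding uniformly_continuous_on_def using r(1) by (metis half_gt_zero_iff min_less_iff_conj zero_less_one)
    have "norm (w x - w y) < min r (1/2)" if xy: "norm (x - y) < min d 1" for x y
    proof -
      obtain m where m: "m \<in> int_vec" "x - m \<in> cbox 0 1" by (rule int_vec_floor)
      have m': "- m \<in> int_vec" using m int_vec_closed by blast
      have "\<bar>x $ i - y $ i\<bar> < 1" for i
        using component_le_norm_cart[of "x - y" i] xy by simp
      then have y: "y - m \<in> cbox (- 1) 2" "x - m \<in> cbox (- 1) 2"
        using m(2) unfolding mem_box_cart by (auto simp: abs_less_iff) (smt (verit))+
      have "w (x - m) - w (y - m) = w x - w y"
        using Q_add[OF m', of x y] P_add[OF m', of x] P_add[OF m', of y]
        by (simp add: w_def algebra_simps)
      moreover have "dist (w (x - m)) (w (y - m)) < min r (1/2)"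
        by (rule d(2)[OF y]) (use xy in \<open>simp add: dist_norm\<close>)
      ultimately show ?thesis by (simp add: dist_norm)
    qed
    then show thesis using that[of "min d 1"] d(1) by simp
  qed
  \<comment> \<open>Up to distance \<open>1 / 2\<close> the projection \<open>torus_of\<close>
    preserves distances.\<close>
  define \<rho> where "\<rho> = min \<rho>0 (1/2)"
  have C0: "C \<ge> 0" using lip_h' by (simp add: lipschitz_on_def)
  \<comment> \<open>\<open>C\<close> is the Lipschitz constant of the inverse parametrization,
    \<open>c\<close> that of the local inverse of the projection to the base; the summand 1 makes
    the product positive.\<close>
  define c' where "c' = (C + 1) * c"
  have c': "c' > 0" using C0 r by (simp add: c'_def)
  have Q_exp: "norm (x - y) \<le> c' * norm (Q x - Q y)" if xy: "norm (x - y) < \<rho>" for x y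
  proof -
    have ww: "norm (w x - w y) < min r (1/2)" using \<rho>0(2) xy by (simp add: \<rho>_def)
    have "norm (x - y) = dist (torus_of x) (torus_of y)"
      using dist_torus_of[of x y] xy by (simp add: dist_norm \<rho>_def)
    also have "\<dots> = dist (h' (h (torus_of x))) (h' (h (torus_of y)))"
      using homeomorphism_apply1[OF homeo] by simp
    also have "\<dots> \<le> C * dist (cotangent_of (w x)) (cotangent_of (w y))"
      using lipschitz_onD[OF lip_h' h_in h_in] by (simp add: w_def QP)
    also have "\<dots> \<le> (C + 1) * norm (w x - w y)"
      using dist_cotangent_of_le[of "w x" "w y"] C0 by (intro mult_mono) (auto simp: dist_norm)
    also have "\<dots> \<le> (C + 1) * (c * norm (fst (w x) - fst (w y)))"
      using exp[OF w_N w_N] ww C0 by (intro mult_left_mono) auto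
    finally show ?thesis by (simp add: w_def c'_def)
  qed
  have \<rho>: "\<rho> > 0" using \<rho>0 by (simp add: \<rho>_def)
  obtain g where g: "homeomorphism UNIV UNIV Q g"
    using expanding_homeomorphism(1)[OF Q \<rho> c' Q_exp] by blast
  have Qg: "Q (g q) = q" and gQ: "g (Q x) = x" for q x
    using homeomorphism_apply1[OF g] homeomorphism_apply2[OF g] by auto
  define s where "s q = P (g q)" for q
  have ws: "w (g q) = (q, s q)" for q by (simp add: w_def s_def Qg)
  have s_cont: "continuous_on UNIV s"
    unfolding s_def by (rule continuous_on_compose2[OF P homeomorphism_cont2[OF g]]) auto
  have lip: "norm (s q - s q') \<le> c * norm (q - q')" if qq': "norm (q - q') < \<rho> / 3 / c'" for q q'
  proof -
    \<comment> \<open>Points close in the base have close parameters, hence close lifts, and only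
      then does \<open>exp\<close> apply. A third of \<open>\<rho>\<close> meets the requirement
      \<open>2 * r < \<rho>\<close>.\<close>
    have "ball (Q (g q)) (\<rho> / 3 / c') \<subseteq> Q ` ball (g q) (\<rho> / 3)"
      by (rule expanding_homeomorphism(2)[OF Q \<rho> c' Q_exp]) (use \<rho> in auto)
    moreover have "q' \<in> ball (Q (g q)) (\<rho> / 3 / c')" using qq' by (simp add: Qg dist_norm)
    ultimately obtain x where x: "q' = Q x" "x \<in> ball (g q) (\<rho> / 3)" by blast
    then have "norm (g q - g q') < \<rho>0"
      using \<rho> by (simp add: gQ dist_norm \<rho>_def)
    then have "norm (w (g q) - w (g q')) < r" using \<rho>0(2) by simp
    then have "norm ((q, s q) - (q', s q')) \<le> c * norm (fst (q, s q) - fst (q', s q'))"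
      using exp[OF w_N w_N] ws by metis
    moreover have "norm (s q - s q') \<le> norm ((q, s q) - (q', s q'))"
      using norm_snd_le[of "s q - s q'" "q - q'"] by simp
    ultimately show ?thesis by simp
  qed
  have all: "\<exists>q. cotangent_of z = cotangent_of (q, s q)" if zN: "cotangent_of z \<in> N" for z
  proof -
    obtain \<theta> where "cotangent_of z = h \<theta>"
      using zN homeomorphism_image1[OF homeo] by blast
    moreover obtain x where "\<theta> = torus_of x" by (rule torus_of_surj)
    ultimately have "cotangent_of z = cotangent_of (w x)" by (simp add: w_def QP)
    moreover have "w x = (Q x, s (Q x))" by (simp add: w_def s_def gQ)
    ultimately show ?thesis by metis
  qed
  have periodic: "s (q + a) = s q" if u: "\<And>q. (u has_derivative (\<lambda>v. s q \<bullet> v)) (at q)" and a: "a \<in> int_vec" for a u q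
  proof -
    have deck: "s (q + (Q (x + m) - Q x)) = s q" if m: "m \<in> int_vec" for q x m
    proof -
      have "q + (Q (x + m) - Q x) = Q (g q + m)"
        using Q_add[OF m, of x "g q"] by (simp add: Qg)
      then show ?thesis using P_add[OF m] by (simp add: s_def gQ)
    qed
    have shift: "((\<lambda>q. u (q + b)) has_derivative (\<lambda>v. s (q + b) \<bullet> v)) (at q)" for q b
      by (rule has_derivative_shift[OF u])
    define \<Delta> where "\<Delta> q = u (q + a) - u q" for q
    have \<Delta>': "(\<Delta> has_derivative (\<lambda>v. s (q + a) \<bullet> v - s q \<bullet> v)) (at q)" for q
      unfolding \<Delta>_def by (intro has_derivative_diff shift u)
    have \<Delta>_per: "\<Delta> (Q (x + m)) = \<Delta> (Q x)" if m: "m \<in> int_vec" for x m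
    proof -
      \<comment> \<open>A deck translation. It leaves \<open>s\<close> invariant, so
        \<open>u\<close> changes by a constant along it, and this constant cancels in
        \<open>\<Delta>\<close>.\<close>
      define l where "l = Q (x + m) - Q x"
      have "((\<lambda>q. u (q + l) - u q) has_derivative (\<lambda>v. 0)) (at q)" for q
        using has_derivative_diff[OF shift[of l q] u[of q]] deck[OF m, of q x] by (simp add: l_def)
      then have "u (q + l) - u q = u (q' + l) - u q'" for q q'
        using has_derivative_zero_unique_connected[of UNIV "\<lambda>q. u (q + l) - u q"] by (metis UNIV_I connected_UNIV open_UNIV)
      from this[of "Q x + a" "Q x"] show ?thesis
        by (simp add: \<Delta>_def l_def algebra_simps)
    qed
    have "continuous_on UNIV \<Delta>"
      using \<Delta>' by (meson continuous_at_imp_continuous_on has_derivative_continuous)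
    then have "continuous_on (cbox 0 (1::real^'n)) (\<lambda>x. \<Delta> (Q x))"
      by (rule continuous_on_compose2) (use continuous_on_subset[OF Q] in auto)
    moreover have "(0::real^'n) \<in> cbox 0 1" by (simp add: mem_box_cart)
    then have "cbox 0 (1::real^'n) \<noteq> {}" by blast
    ultimately obtain x0 where x0: "\<And>x. x \<in> cbox 0 1 \<Longrightarrow> \<Delta> (Q x) \<le> \<Delta> (Q x0)"
      using continuous_attains_sup[OF compact_cbox] by metis
    \<comment> \<open>By \<open>\<Delta>_per\<close> every parameter \<open>g q\<close> may be moved
      into the unit cell without changing the value of \<open>\<Delta>\<close>.\<close>
    have max: "\<Delta> q \<le> \<Delta> (Q x0)" for q
    proof -
      obtain m where m: "m \<in> int_vec" "g q - m \<in> cbox 0 1" by (rule int_vec_floor)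
      have "\<Delta> (Q (g q - m + m)) = \<Delta> (Q (g q - m))" by (rule \<Delta>_per[OF m(1)])
      then show ?thesis using x0[OF m(2)] by (simp add: Qg)
    qed
    have "(\<lambda>v. s (Q x0 + a) \<bullet> v - s (Q x0) \<bullet> v) = (\<lambda>v. 0)"
      by (rule differential_zero_maxmin[OF _ open_UNIV \<Delta>']) (use max in auto)
    then have "(s (Q x0 + a) - s (Q x0)) \<bullet> (s (Q x0 + a) - s (Q x0)) = 0"
      unfolding inner_diff_left fun_eq_iff by blast
    then have eq: "s (Q x0 + a) = s (Q x0)" by simp
    define x1 where "x1 = g (Q x0 + a)"
    have "cotangent_of (w x1) = cotangent_of (w x0)"
      using ws[of "Q x0 + a"] ws[of "Q x0"] eq a by (simp add: x1_def gQ cotangent_of_eq_iff)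
    then have "h (torus_of x1) = h (torus_of x0)" by (simp add: w_def QP)
    then have "torus_of x1 = torus_of x0" by (metis UNIV_I homeo homeomorphism_apply1)
    then have m: "x1 - x0 \<in> int_vec" by (simp add: torus_of_eq_iff)
    have "Q (x0 + (x1 - x0)) - Q x0 = a" by (simp add: x1_def Qg)
    with deck[OF m, of q x0] show ?thesis by simp
  qed
  show thesis
  proof (rule that)
    show "continuous_on UNIV s" by (rule s_cont)
    show "cotangent_of (q, s q) \<in> N" for q using w_N ws by metis
    have "\<rho> / 3 / c' > 0" using \<rho> c' by simp
    then show "\<exists>\<delta>>0. \<exists>c. \<forall>q q'. norm (q - q') < \<delta> \<longrightarrow> norm (s q - s q') \<le> c * norm (q - q')"
      using lip by blast
    show "\<exists>q. cotangent_of z = cotangent_of (q, s q)" if "cotangent_of z \<in> N" for z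
      by (rule all[OF that])
    show "s (q + a) = s q" if "\<And>q. (u has_derivative (\<lambda>v. s q \<bullet> v)) (at q)" "a \<in> int_vec" for a q u
      by (rule periodic[OF that])
  qed
qed

theorem lagrangian_graph:
  "lagrangian N \<and> (\<exists>s :: 'n torus \<Rightarrow> real ^ 'n. Ck_on 1 UNIV (s \<circ> torus_of) \<and> N = {(q, s q) | q. True})"
proof -
  obtain s where s_cont: "continuous_on UNIV s" and s_N: "\<And>q. cotangent_of (q, s q) \<in> N"
    and lip: "\<exists>\<delta>>0. \<exists>c. \<forall>q q'. norm (q - q') < \<delta> \<longrightarrow> norm (s q - s q') \<le> c * norm (q - q')"
    and all: "\<And>z. cotangent_of z \<in> N \<Longrightarrow> \<exists>q. cotangent_of z = cotangent_of (q, s q)"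
    and grad: "\<And>a q u. (\<And>q. (u has_derivative (\<lambda>v. s q \<bullet> v)) (at q)) \<Longrightarrow> a \<in> int_vec \<Longrightarrow> s (q + a) = s q"
    by (rule global_section) blast
  obtain \<delta> c where \<delta>: "\<delta> > 0" "\<And>q q'. norm (q - q') < \<delta> \<Longrightarrow> norm (s q - s q') \<le> c * norm (q - q')"
    using lip by blast
  obtain s' where s': "\<And>q. (s has_derivative s' q) (at q)" "\<And>v. continuous_on UNIV (\<lambda>q. s' q v)"
    "\<And>q v. (v, s' q v) \<in> E (q, s q)"
  proof (rule paratingent_imp_C1[OF \<delta>, of "\<lambda>q. E (q, s q)"])
    show "subspace (E (q, s q))" for q by (rule subspace_E[OF s_N])
    show "b = 0" if "(0, b) \<in> E (q, s q)" for q b using vertical_E[OF s_N] that by blast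
    fix q u w \<epsilon> v
    assume u: "u \<longlonglongrightarrow> q" and w: "w \<longlonglongrightarrow> q" and e: "\<And>n. \<epsilon> n > (0::real)"
      and v: "(\<lambda>n. ((u n, s (u n)) - (w n, s (w n))) /\<^sub>R \<epsilon> n) \<longlonglongrightarrow> v"
    have lim: "(\<lambda>n. (x n, s (x n))) \<longlonglongrightarrow> (q, s q)" if "x \<longlonglongrightarrow> q" for x
      by (intro tendsto_Pair that continuous_on_tendsto_compose[OF s_cont]) auto
    show "v \<in> E (q, s q)"
      by (rule paratingent[OF s_N s_N lim[OF u] lim[OF w] e v])
  next
    fix s'
    assume H: "\<And>q. (s has_derivative s' q) (at q)" "\<And>v. continuous_on UNIV (\<lambda>q. s' q v)" "\<And>q v. (v, s' q v) \<in> E (q, s q)"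
    show thesis by (rule that[OF H])
  qed
  have lin: "linear (s' q)" for q using s'(1) has_derivative_linear by blast
  have sym: "s' q v \<bullet> w = s' q w \<bullet> v" for q v w
    using isotropic_E[OF s_N s'(3)[of v q] s'(3)[of w q]] by (simp add: omega_def inner_commute)
  obtain u where u: "\<And>q. (u has_derivative (\<lambda>v. s q \<bullet> v)) (at q)"
    using poincare_potential[OF s'(1,2) sym] by blast
  have per: "s (q + a) = s q" if "a \<in> int_vec" for q a
    using grad[OF u that] .
  have s_torus: "s x = s y" if "torus_of x = torus_of y" for x y
    using per[of "x - y" y] that by (simp add: torus_of_eq_iff)
  define S where "S \<theta> = s (SOME x. torus_of x = \<theta>)" for \<theta>
  have S: "S (torus_of x) = s x" for x
    unfolding S_def by (rule s_torus) (rule someI[of _ x], rule refl)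
  have S_torus: "S \<circ> torus_of = s" by (auto simp: S)
  have "Ck_on 1 UNIV s"
  proof -
    have "frechet_derivative s (at x) = s' x" for x
      using frechet_derivative_at[OF s'(1)] by simp
    then show ?thesis
      using s' by (auto simp: One_nat_def differentiable_def)
  qed
  moreover have "N = {(q, S q) | q. True}"
  proof (intro equalityI subsetI)
    fix x assume x: "x \<in> N"
    obtain z where "x = cotangent_of z" by (rule cotangent_of_surj)
    with all x obtain q where "x = cotangent_of (q, s q)" by metis
    then show "x \<in> {(q, S q) | q. True}" by (auto simp: cotangent_of_def S)
  next
    fix x assume "x \<in> {(q, S q) | q. True}"
    then obtain \<theta> where \<theta>: "x = (\<theta>, S \<theta>)" by blast
    obtain q where "\<theta> = torus_of q" by (rule torus_of_surj)
    then have "x = cotangent_of (q, s q)" by (simp add: \<theta> cotangent_of_def S)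
    then show "x \<in> N" using s_N by simp
  qed
  moreover have "lagrangian N"
    unfolding lagrangian_def
  proof
    fix x assume x: "x \<in> N"
    obtain z where z: "x = cotangent_of z" by (rule cotangent_of_surj)
    obtain q where q: "x = cotangent_of (q, s q)" using all[of z] x z by auto
    have snd_N: "snd y = s (fst y)" if yN: "cotangent_of y \<in> N" for y
    proof -
      obtain q where "cotangent_of y = cotangent_of (q, s q)" using all[OF yN] by blast
      then have "torus_of (fst y) = torus_of q" "snd y = s q" by (auto simp: cotangent_of_def)
      then show ?thesis using s_torus by metis
    qed
    \<comment> \<open>A curve through \<open>x\<close> may start at any lift of \<open>x\<close>, so
      the derivative has to be periodic as well.\<close>
    have s'_per: "s' q' = s' q" if "torus_of q' = torus_of q" for q'
    proof -
      define m where "m = q' - q"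
      have m: "m \<in> int_vec" "q' = q + m" using that by (simp_all add: m_def torus_of_eq_iff)
      have "((\<lambda>x. s (x + m)) has_derivative s' q') (at q)"
        unfolding m(2) by (rule has_derivative_shift[OF s'(1)])
      then have "(s has_derivative s' q') (at q)" using per[OF m(1)] by simp
      then show ?thesis using has_derivative_unique s'(1) by blast
    qed
    have "tangent_vectors N x = range (\<lambda>v. (v, s' q v))"
    proof (intro equalityI subsetI)
      fix v assume "v \<in> tangent_vectors N x"
      then obtain \<gamma> where \<gamma>: "cotangent_of (\<gamma> 0) = x" "\<And>t. cotangent_of (\<gamma> t) \<in> N" "(\<gamma> has_vector_derivative v) (at (0::real))"
        unfolding tangent_vectors_def by blast
      have f: "((\<lambda>t. fst (\<gamma> t)) has_vector_derivative fst v) (at 0)"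
        by (rule bounded_linear.has_vector_derivative[OF bounded_linear_fst \<gamma>(3)])
      have sn: "((\<lambda>t. snd (\<gamma> t)) has_vector_derivative snd v) (at 0)"
        by (rule bounded_linear.has_vector_derivative[OF bounded_linear_snd \<gamma>(3)])
      have "((s \<circ> (\<lambda>t. fst (\<gamma> t))) has_vector_derivative s' (fst (\<gamma> 0)) (fst v)) (at 0)"
        by (rule vector_derivative_diff_chain_within[OF f has_derivative_at_withinI[OF s'(1)]])
      moreover have "(s \<circ> (\<lambda>t. fst (\<gamma> t))) = (\<lambda>t. snd (\<gamma> t))" using snd_N[OF \<gamma>(2)] by auto
      ultimately have "snd v = s' (fst (\<gamma> 0)) (fst v)"
        using sn vector_derivative_unique_at by metis
      moreover have "torus_of (fst (\<gamma> 0)) = torus_of q"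
        using \<gamma>(1) q by (simp add: cotangent_of_def)
      then have "s' (fst (\<gamma> 0)) = s' q" by (rule s'_per)
      ultimately have "v = (fst v, s' q (fst v))" by (metis prod.collapse)
      then show "v \<in> range (\<lambda>v. (v, s' q v))" by blast
    next
      fix w assume "w \<in> range (\<lambda>v. (v, s' q v))"
      then obtain v where w: "w = (v, s' q v)" by blast
      have l: "((\<lambda>t. q + t *\<^sub>R v) has_vector_derivative v) (at 0)"
        by (auto intro!: derivative_eq_intros)
      have "((s \<circ> (\<lambda>t. q + t *\<^sub>R v)) has_vector_derivative s' (q + 0 *\<^sub>R v) v) (at 0)"
        by (rule vector_derivative_diff_chain_within[OF l has_derivative_at_withinI[OF s'(1)]])
      then have "((\<lambda>t. (q + t *\<^sub>R v, s (q + t *\<^sub>R v))) has_vector_derivative w) (at 0)"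
        unfolding w by (intro has_vector_derivative_Pair l) (simp add: o_def)
      then show "w \<in> tangent_vectors N x"
        unfolding tangent_vectors_def using s_N q
        by (intro CollectI exI[of _ "\<lambda>t. (q + t *\<^sub>R v, s (q + t *\<^sub>R v))"]) simp
    qed
    moreover have "lagrangian_subspace (range (\<lambda>v. (v, s' q v)))"
      unfolding lagrangian_subspace_def
    proof
      have "linear (\<lambda>v. (v, s' q v))"
        using lin[of q] by (auto simp: linear_iff)
      then show "subspace (range (\<lambda>v. (v, s' q v)))"
        using linear_subspace_image[OF _ subspace_UNIV] by blast
      show "range (\<lambda>v. (v, s' q v)) = {v. \<forall>w\<in>range (\<lambda>v. (v, s' q v)). omega v w = 0}"
      proof (intro equalityI subsetI CollectI ballI)
        fix v w assume "v \<in> range (\<lambda>v. (v, s' q v))" "w \<in> range (\<lambda>v. (v, s' q v))"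
        then show "omega v w = 0" using sym[of q] by (auto simp: omega_def inner_commute)
      next
        fix v assume "v \<in> {v. \<forall>w\<in>range (\<lambda>v. (v, s' q v)). omega v w = 0}"
        then have "fst v \<bullet> s' q w - snd v \<bullet> w = 0" for w by (auto simp: omega_def)
        then have "(s' q (fst v) - snd v) \<bullet> w = 0" for w
          using sym[of q "fst v" w] by (simp add: inner_diff_left inner_diff_right inner_commute)
        from this[of "s' q (fst v) - snd v"] have "snd v = s' q (fst v)" by simp
        then have "v = (fst v, s' q (fst v))" by (simp add: prod_eq_iff)
        then show "v \<in> range (\<lambda>v. (v, s' q v))" by blast
      qed
    qed
    ultimately show "lagrangian_subspace (tangent_vectors N x)" by simp
  qed
  ultimately show ?thesis using S_torus by (intro conjI exI[of _ S]) simp_all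
qed

end

section \<open>Tonelli Hamiltonian flows\<close>

text \<open>The second difference of \<open>f\<close> over a parallelogram is symmetric in its
  sides, and two mean value steps in either order express it by one second derivative near
  \<open>x\<close>. This symmetry is what makes the linearized field Hamiltonian.\<close>

lemma second_derivative_symmetric:
  fixes f :: "'a::real_normed_vector \<Rightarrow> real"
  assumes f': "\<And>x. (f has_derivative f' x) (at x)"
    and f'': "\<And>v x. ((\<lambda>x. f' x v) has_derivative f'' v x) (at x)"
    and cont: "\<And>v w. continuous_on UNIV (\<lambda>x. f'' v x w)"
  shows "f'' v x w = f'' w x v"
proof -
  have line: "((\<lambda>r. g (y + r *\<^sub>R v)) has_real_derivative g' (y + r *\<^sub>R v) v) (at r)"
    if "\<And>x. (g has_derivative g' x) (at x)" for g :: "'a \<Rightarrow> real" and g' y v r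
  proof -
    have l: "((\<lambda>r. y + r *\<^sub>R v) has_vector_derivative v) (at r)"
      by (auto intro!: derivative_eq_intros)
    have "((g \<circ> (\<lambda>r. y + r *\<^sub>R v)) has_vector_derivative g' (y + r *\<^sub>R v) v) (at r)"
      by (rule vector_derivative_diff_chain_within[OF l has_derivative_at_withinI[OF that]])
    then show ?thesis by (simp add: has_real_derivative_iff_has_vector_derivative o_def)
  qed
  have second: "\<exists>a b. 0 < a \<and> a < s \<and> 0 < b \<and> b < s \<and>
     f (x + s *\<^sub>R v + s *\<^sub>R w) - f (x + s *\<^sub>R v) - f (x + s *\<^sub>R w) + f x = s * (s * f'' v (x + a *\<^sub>R v + b *\<^sub>R w) w)"
    if s: "s > 0" for s v w
  proof -
    define g where "g r = f (x + s *\<^sub>R w + r *\<^sub>R v) - f (x + r *\<^sub>R v)" for r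
    have "(g has_real_derivative f' (x + s *\<^sub>R w + r *\<^sub>R v) v - f' (x + r *\<^sub>R v) v) (at r)" for r
      unfolding g_def by (intro DERIV_diff line f')
    then obtain a where a: "0 < a" "a < s" "g s - g 0 = (s - 0) * (f' (x + s *\<^sub>R w + a *\<^sub>R v) v - f' (x + a *\<^sub>R v) v)"
      using MVT2[OF s, of g "\<lambda>r. f' (x + s *\<^sub>R w + r *\<^sub>R v) v - f' (x + r *\<^sub>R v) v"] by blast
    have "((\<lambda>b. f' (x + a *\<^sub>R v + b *\<^sub>R w) v) has_real_derivative f'' v (x + a *\<^sub>R v + b *\<^sub>R w) w) (at b)" for b
      by (rule line[OF f''])
    then obtain b where b: "0 < b" "b < s"
      "f' (x + a *\<^sub>R v + s *\<^sub>R w) v - f' (x + a *\<^sub>R v + 0 *\<^sub>R w) v = (s - 0) * f'' v (x + a *\<^sub>R v + b *\<^sub>R w) w"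
      using MVT2[OF s, of "\<lambda>b. f' (x + a *\<^sub>R v + b *\<^sub>R w) v" "\<lambda>b. f'' v (x + a *\<^sub>R v + b *\<^sub>R w) w"] by blast
    have "f (x + s *\<^sub>R v + s *\<^sub>R w) - f (x + s *\<^sub>R v) - f (x + s *\<^sub>R w) + f x = g s - g 0"
      by (simp add: g_def algebra_simps)
    also have "\<dots> = s * (s * f'' v (x + a *\<^sub>R v + b *\<^sub>R w) w)"
      using a(3) b(3) by (simp add: algebra_simps)
    finally show ?thesis using a b by blast
  qed
  have "\<bar>f'' v x w - f'' w x v\<bar> \<le> e" if "e > 0" for e
  proof -
    have "e / 2 > 0" using \<open>e > 0\<close> by simp
    obtain d1 where d1: "d1 > 0" "\<And>y. dist y x < d1 \<Longrightarrow> dist (f'' v y w) (f'' v x w) < e / 2"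
      using cont[of v w] \<open>e / 2 > 0\<close> unfolding continuous_on_iff by (metis UNIV_I)
    obtain d2 where d2: "d2 > 0" "\<And>y. dist y x < d2 \<Longrightarrow> dist (f'' w y v) (f'' w x v) < e / 2"
      using cont[of w v] \<open>e / 2 > 0\<close> unfolding continuous_on_iff by (metis UNIV_I)
    define k where "k = norm v + norm w + 1"
    have k: "k > 0" using norm_ge_zero[of v] norm_ge_zero[of w] unfolding k_def by linarith
    define s where "s = min d1 d2 / k"
    have s: "s > 0" using d1(1) d2(1) k by (simp add: s_def)
    have sk: "s * k = min d1 d2" using k by (simp add: s_def)
    have near: "dist (x + a *\<^sub>R v' + b *\<^sub>R w') x < min d1 d2"
      if "0 < a" "a < s" "0 < b" "b < s" "norm v' + norm w' + 1 = k" for a b v' w'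
    proof -
      have "dist (x + a *\<^sub>R v' + b *\<^sub>R w') x \<le> a * norm v' + b * norm w'"
        using norm_triangle_ineq[of "a *\<^sub>R v'" "b *\<^sub>R w'"] that by (simp add: dist_norm)
      also have "\<dots> \<le> s * norm v' + s * norm w'"
        using that by (intro add_mono mult_right_mono) auto
      also have "\<dots> < s * (norm v' + norm w' + 1)" using s by (simp add: algebra_simps)
      finally show ?thesis using that sk by simp
    qed
    obtain a b where ab: "0 < a" "a < s" "0 < b" "b < s"
      "f (x + s *\<^sub>R v + s *\<^sub>R w) - f (x + s *\<^sub>R v) - f (x + s *\<^sub>R w) + f x = s * (s * f'' v (x + a *\<^sub>R v + b *\<^sub>R w) w)"
      using second[OF s, of v w] by blast
    obtain a' b' where ab': "0 < a'" "a' < s" "0 < b'" "b' < s"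
      "f (x + s *\<^sub>R w + s *\<^sub>R v) - f (x + s *\<^sub>R w) - f (x + s *\<^sub>R v) + f x = s * (s * f'' w (x + a' *\<^sub>R w + b' *\<^sub>R v) v)"
      using second[OF s, of w v] by blast
    have "s * (s * f'' v (x + a *\<^sub>R v + b *\<^sub>R w) w) = s * (s * f'' w (x + a' *\<^sub>R w + b' *\<^sub>R v) v)"
      using ab(5) ab'(5) by (simp add: algebra_simps)
    then have "f'' v (x + a *\<^sub>R v + b *\<^sub>R w) w = f'' w (x + a' *\<^sub>R w + b' *\<^sub>R v) v" using s by simp
    moreover have "dist (f'' v (x + a *\<^sub>R v + b *\<^sub>R w) w) (f'' v x w) < e / 2"
      using near[OF ab(1-4), of v w] by (intro d1(2)) (simp add: k_def)
    moreover have "dist (f'' w (x + a' *\<^sub>R w + b' *\<^sub>R v) v) (f'' w x v) < e / 2"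
      using near[OF ab'(1-4), of w v] by (intro d2(2)) (simp add: k_def)
    ultimately show ?thesis unfolding dist_real_def by linarith
  qed
  then have "\<bar>f'' v x w - f'' w x v\<bar> \<le> 0"
    using field_le_epsilon[of "\<bar>f'' v x w - f'' w x v\<bar>" 0] by simp
  then show ?thesis by simp
qed

lemma fundamental_strip: obtains m where "m \<in> int_vec" "z + (m, 0) \<in> cbox 0 1 \<times> UNIV"
proof -
  obtain m where "m \<in> int_vec" "fst z - m \<in> cbox 0 1" by (rule int_vec_floor)
  then show thesis using int_vec_closed(2) by (intro that[of "- m"]) (auto simp: mem_Times_iff)
qed

lemma periodic_bounded:
  fixes f :: "'n::finite lifted \<Rightarrow> 'b::metric_space"
  assumes cont: "continuous_on UNIV f" and per: "\<And>m z. m \<in> int_vec \<Longrightarrow> f (z + (m, 0)) = f z"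
  shows "bounded (f ` {z. norm (snd z) \<le> R})"
proof -
  have "compact (f ` (cbox 0 1 \<times> cball 0 R))"
    by (intro compact_continuous_image compact_Times compact_cbox compact_cball continuous_on_subset[OF cont]) auto
  moreover have "f ` {z. norm (snd z) \<le> R} \<subseteq> f ` (cbox 0 1 \<times> cball 0 R)"
  proof (rule image_subsetI)
    fix z :: "'n lifted" assume z: "z \<in> {z. norm (snd z) \<le> R}"
    obtain m where m: "m \<in> int_vec" "z + (m, 0) \<in> cbox 0 1 \<times> UNIV" by (rule fundamental_strip)
    then have "z + (m, 0) \<in> cbox 0 1 \<times> cball 0 R" using z by (auto simp: mem_Times_iff)
    then show "f z \<in> f ` (cbox 0 1 \<times> cball 0 R)" using per[OF m(1), of z] by (metis imageI)
  qed
  ultimately show ?thesis using compact_imp_bounded bounded_subset by blast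
qed

lemma periodic_uniformly_continuous:
  fixes f :: "'n::finite lifted \<Rightarrow> 'b::metric_space"
  assumes cont: "continuous_on UNIV f" and per: "\<And>m z. m \<in> int_vec \<Longrightarrow> f (z + (m, 0)) = f z" and "e > 0"
  shows "\<exists>d>0. \<forall>a b. norm (snd a) \<le> R \<longrightarrow> norm (snd b) \<le> R \<longrightarrow> norm (a - b) < d \<longrightarrow> dist (f a) (f b) < e"
proof -
  \<comment> \<open>Contains the unit cell and, in the base, everything within distance 1 of it,
    where the second point must lie.\<close>
  let ?K = "cbox (- 1) 2 \<times> cball 0 R"
  have "uniformly_continuous_on ?K f"
    by (intro compact_uniformly_continuous compact_Times compact_cbox compact_cball continuous_on_subset[OF cont]) auto
  then obtain d where d: "d > 0" "\<And>a b. a \<in> ?K \<Longrightarrow> b \<in> ?K \<Longrightarrow> dist b a < d \<Longrightarrow> dist (f b) (f a) < e"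
    unfolding uniformly_continuous_on_def using \<open>e > 0\<close> by metis
  show ?thesis
  proof (intro exI[of _ "min d 1"] conjI allI impI)
    show "min d 1 > 0" using d(1) by simp
    fix a b :: "'n lifted" assume ab: "norm (snd a) \<le> R" "norm (snd b) \<le> R" "norm (a - b) < min d 1"
    obtain m where m: "m \<in> int_vec" "a + (m, 0) \<in> cbox 0 1 \<times> UNIV" by (rule fundamental_strip)
    have m01: "0 \<le> fst a $ i + m $ i" "fst a $ i + m $ i \<le> 1" for i
      using m(2) by (auto simp: mem_Times_iff mem_box_cart)
    have "\<bar>fst a $ i - fst b $ i\<bar> < 1" for i
      using component_le_norm_cart[of "fst a - fst b" i] norm_fst_le[of "fst (a - b)" "snd (a - b)", unfolded prod.collapse] ab(3)
      by simp
    then have "- 1 \<le> fst b $ i + m $ i \<and> fst b $ i + m $ i \<le> 2" for i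
      using m01[of i] by (smt (verit))
    moreover have "- 1 \<le> fst a $ i + m $ i \<and> fst a $ i + m $ i \<le> 2" for i
      using m01[of i] by simp
    ultimately have K: "a + (m, 0) \<in> ?K" "b + (m, 0) \<in> ?K"
      using ab by (auto simp: mem_Times_iff mem_box_cart)
    have "dist (f (a + (m, 0))) (f (b + (m, 0))) < e"
      by (rule d(2)[OF K(2,1)]) (use ab(3) in \<open>simp add: dist_norm\<close>)
    then show "dist (f a) (f b) < e" by (simp add: per[OF m(1)])
  qed
qed

locale tonelli_flow =
  fixes H :: "'n::finite cotangent \<Rightarrow> real" and \<phi> :: "real \<Rightarrow> 'n cotangent \<Rightarrow> 'n cotangent"
  assumes tonelli: "tonelli H" and flow: "hamiltonian_flow H \<phi>"
begin

definition Hl :: "'n lifted \<Rightarrow> real" where "Hl = H \<circ> cotangent_of"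
definition dH :: "'n lifted \<Rightarrow> 'n lifted \<Rightarrow> real" where "dH z = frechet_derivative Hl (at z)"
definition ddH :: "'n lifted \<Rightarrow> 'n lifted \<Rightarrow> 'n lifted \<Rightarrow> real"
  where "ddH v z = frechet_derivative (\<lambda>z. dH z v) (at z)"
text \<open>The sign is such that \<open>omega (J g) w = g \<bullet> w\<close>, so \<open>J\<close>
  turns a gradient into the Hamiltonian vector.\<close>

definition J :: "'n lifted \<Rightarrow> 'n lifted" where "J z = (snd z, - fst z)"
definition X :: "'n lifted \<Rightarrow> 'n lifted" where "X z = J (\<Sum>b\<in>Basis. dH z b *\<^sub>R b)"
definition DX :: "'n lifted \<Rightarrow> 'n lifted \<Rightarrow> 'n lifted" where "DX z u = J (\<Sum>b\<in>Basis. ddH b z u *\<^sub>R b)"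

section \<open>Derivatives of the lifted Hamiltonian and of its vector field\<close>

lemma Hl_deriv: "(Hl has_derivative dH z) (at z)"
  and dH_deriv: "((\<lambda>z. dH z v) has_derivative ddH v z) (at z)"
  and ddH_cont: "continuous_on UNIV (\<lambda>z. ddH v z w)"
proof -
  have Ck: "Ck_on (Suc (Suc 0)) UNIV Hl"
    using tonelli by (simp add: tonelli_def Hl_def numeral_2_eq_2)
  have D1: "Hl differentiable (at z)" for z using Ck unfolding Ck_on.simps by blast
  have D2: "(\<lambda>z. dH z v) differentiable (at z)" for z v using Ck unfolding Ck_on.simps dH_def by blast
  show "(Hl has_derivative dH z) (at z)"
    unfolding dH_def using D1 frechet_derivative_works by blast
  show "((\<lambda>z. dH z v) has_derivative ddH v z) (at z)"
    unfolding ddH_def using D2 frechet_derivative_works by blast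
  show "continuous_on UNIV (\<lambda>z. ddH v z w)"
    using Ck unfolding Ck_on.simps dH_def ddH_def by blast
qed

lemma ddH_sym: "ddH v z w = ddH w z v"
  by (rule second_derivative_symmetric[OF Hl_deriv dH_deriv ddH_cont])

lemma linear_dH: "linear (dH z)" and linear_ddH: "linear (ddH v z)"
  using has_derivative_linear Hl_deriv dH_deriv by blast+

lemma linear_ddH_left: "linear (\<lambda>v. ddH v z w)"
  using linear_ddH[of w z] by (simp add: ddH_sym[of _ z w])

lemma omega_J: "omega (J g) w = g \<bullet> w"
  by (simp add: omega_def J_def inner_prod_def)

lemma linear_J: "linear J" by (auto simp: J_def linear_iff)

lemma gradient_inner:
  fixes f :: "'n lifted \<Rightarrow> real"
  assumes "linear f" shows "(\<Sum>b\<in>Basis. f b *\<^sub>R b) \<bullet> w = f w"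
proof -
  have "f w = f (\<Sum>b\<in>Basis. (w \<bullet> b) *\<^sub>R b)" by (simp add: euclidean_representation)
  also have "\<dots> = (\<Sum>b\<in>Basis. (w \<bullet> b) * f b)"
    by (simp add: linear_sum[OF assms] linear_scale[OF assms])
  finally show ?thesis by (simp add: inner_sum_left inner_commute[of w] mult.commute)
qed

lemma omega_X: "omega (X z) w = dH z w"
  by (simp add: X_def omega_J gradient_inner linear_dH)

lemma omega_DX: "omega (DX z u) w = ddH w z u"
  by (simp add: DX_def omega_J gradient_inner[OF linear_ddH_left])

lemma omega_skew: "omega u w = - omega w u"
  by (simp add: omega_def inner_commute)

lemma DX_skew: "omega (DX z u) w + omega u (DX z w) = 0"
  using omega_DX[of z u w] omega_DX[of z w u] omega_skew[of u "DX z w"] ddH_sym[of u z w] by simp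

lemma X_deriv: "(X has_derivative DX z) (at z)"
proof -
  have "((\<lambda>z. \<Sum>b\<in>Basis. dH z b *\<^sub>R b) has_derivative (\<lambda>u. \<Sum>b\<in>Basis. ddH b z u *\<^sub>R b)) (at z)"
    by (intro has_derivative_sum has_derivative_scaleR_left dH_deriv)
  from bounded_linear.has_derivative[OF linear_J[unfolded linear_conv_bounded_linear] this]
  show ?thesis unfolding X_def DX_def .
qed

lemma linear_DX: "linear (DX z)"
  using X_deriv has_derivative_linear by blast

lemma DX_cont: "continuous_on UNIV (\<lambda>z. DX z u)"
  unfolding DX_def
  by (intro linear_continuous_on_compose[OF _ linear_J] continuous_intros ddH_cont)

lemma Hl_periodic: "m \<in> int_vec \<Longrightarrow> Hl (z + (m, 0)) = Hl z"
  by (simp add: Hl_def)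

lemma dH_periodic: 
  assumes m: "m \<in> int_vec" shows "dH (z + (m, 0)) = dH z"
proof -
  have "((\<lambda>z. Hl (z + (m, 0))) has_derivative dH (z + (m, 0))) (at z)"
    by (rule has_derivative_shift[OF Hl_deriv])
  then have "(Hl has_derivative dH (z + (m, 0))) (at z)" by (simp only: Hl_periodic[OF m])
  then show ?thesis using has_derivative_unique Hl_deriv by blast
qed

lemma ddH_periodic: 
  assumes m: "m \<in> int_vec" shows "ddH v (z + (m, 0)) = ddH v z"
proof -
  have "((\<lambda>z. dH (z + (m, 0)) v) has_derivative ddH v (z + (m, 0))) (at z)"
    by (rule has_derivative_shift[OF dH_deriv])
  then have "((\<lambda>z. dH z v) has_derivative ddH v (z + (m, 0))) (at z)" by (simp only: dH_periodic[OF m])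
  then show ?thesis using has_derivative_unique dH_deriv by blast
qed

lemma X_periodic: "m \<in> int_vec \<Longrightarrow> X (z + (m, 0)) = X z"
  by (simp only: X_def dH_periodic)

lemma DX_periodic: "m \<in> int_vec \<Longrightarrow> DX (z + (m, 0)) u = DX z u"
  by (simp only: DX_def ddH_periodic)

text \<open>\<open>hamiltonian_flow\<close> provides some lift of each orbit; here one is chosen
  that starts at \<open>z\<close> itself. That these choices fit together is derived on energy
  sublevels, from the Lipschitz estimate.\<close>

definition \<Phi> :: "real \<Rightarrow> 'n lifted \<Rightarrow> 'n lifted"
  where "\<Phi> t z = (SOME \<gamma>. \<gamma> 0 = z \<and> (\<forall>t. cotangent_of (\<gamma> t) = \<phi> t (cotangent_of z) \<and>
     (\<gamma> has_vector_derivative X (\<gamma> t)) (at t))) t"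

lemma \<Phi>_0: "\<Phi> 0 z = z"
  and cotangent_of_\<Phi>: "cotangent_of (\<Phi> t z) = \<phi> t (cotangent_of z)"
  and \<Phi>_deriv: "((\<lambda>t. \<Phi> t z) has_vector_derivative X (\<Phi> t z)) (at t)"
proof -
  have "\<exists>\<gamma>. \<gamma> 0 = z \<and> (\<forall>t. cotangent_of (\<gamma> t) = \<phi> t (cotangent_of z) \<and>
     (\<gamma> has_vector_derivative X (\<gamma> t)) (at t))"
  proof -
    obtain \<gamma> where \<gamma>: "\<And>t. \<phi> t (cotangent_of z) = cotangent_of (\<gamma> t)"
      "\<And>t. \<exists>Y. (\<gamma> has_vector_derivative Y) (at t) \<and> (\<forall>w. omega Y w = frechet_derivative (H \<circ> cotangent_of) (at (\<gamma> t)) w)"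
      and \<phi>0: "\<phi> 0 (cotangent_of z) = cotangent_of z"
      using flow unfolding hamiltonian_flow_def by metis
    have der: "(\<gamma> has_vector_derivative X (\<gamma> t)) (at t)" for t
    proof -
      obtain Y where Y: "(\<gamma> has_vector_derivative Y) (at t)" "\<And>w. omega Y w = dH (\<gamma> t) w"
        using \<gamma>(2)[of t] unfolding dH_def Hl_def by blast
      have "Y - X (\<gamma> t) = 0"
        by (rule omega_nondegenerate) (simp add: omega_simps Y(2) omega_X)
      with Y(1) show ?thesis by simp
    qed
    define m where "m = fst z - fst (\<gamma> 0)"
    have "cotangent_of z = cotangent_of (\<gamma> 0)" using \<gamma>(1)[of 0] \<phi>0 by simp
    then have m: "m \<in> int_vec" "z = \<gamma> 0 + (m, 0)"
      unfolding cotangent_of_eq_iff m_def by (simp_all add: prod_eq_iff)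
    show ?thesis
    proof (intro exI[of _ "\<lambda>t. \<gamma> t + (m, 0)"] conjI allI)
      fix t
      show "((\<lambda>t. \<gamma> t + (m, 0)) has_vector_derivative X (\<gamma> t + (m, 0))) (at t)"
        using der[of t] by (simp add: X_periodic[OF m(1)] has_vector_derivative_add_const)
    qed (use m \<gamma>(1) in auto)
  qed
  from someI_ex[OF this]
  show "\<Phi> 0 z = z" "cotangent_of (\<Phi> t z) = \<phi> t (cotangent_of z)"
    "((\<lambda>t. \<Phi> t z) has_vector_derivative X (\<Phi> t z)) (at t)"
    unfolding \<Phi>_def by blast+
qed

text \<open>Conservation keeps each lifted orbit in its energy sublevel, so that estimates over
  bounded momenta hold for all times.\<close>

lemma Hl_\<Phi>: "Hl (\<Phi> t z) = Hl z"
proof -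
  have "((\<lambda>t. Hl (\<Phi> t z)) has_vector_derivative 0) (at t)" for t
  proof -
    have "((Hl \<circ> (\<lambda>t. \<Phi> t z)) has_vector_derivative dH (\<Phi> t z) (X (\<Phi> t z))) (at t)"
      by (rule vector_derivative_diff_chain_within[OF \<Phi>_deriv has_derivative_at_withinI[OF Hl_deriv]])
    moreover have "dH (\<Phi> t z) (X (\<Phi> t z)) = 0"
      using omega_X[of "\<Phi> t z" "X (\<Phi> t z)"] by (simp add: omega_def inner_commute)
    ultimately show ?thesis by (simp add: o_def)
  qed
  then obtain c where "\<And>t. Hl (\<Phi> t z) = c"
    using has_vector_derivative_zero_constant[of UNIV "\<lambda>t. Hl (\<Phi> t z)"] by auto
  then show ?thesis using \<Phi>_0 by metis
qed

section \<open>Uniform estimates on energy sublevels\<close>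

lemma sublevel_bounded: obtains R where "\<And>z. Hl z < c \<Longrightarrow> norm (snd z) \<le> R"
proof -
  \<comment> \<open>Superlinearity with slope 1: beyond \<open>B\<close> the energy itself bounds
    the momentum.\<close>
  obtain B where B: "\<And>q p. norm p \<ge> B \<Longrightarrow> H (q, p) \<ge> 1 * norm p"
    using tonelli unfolding tonelli_def by metis
  have "norm (snd z) \<le> max B c" if "Hl z < c" for z
    using B[of "snd z" "torus_of (fst z)"] that by (cases "norm (snd z) \<ge> B") (auto simp: Hl_def cotangent_of_def)
  with that show thesis by blast
qed

lemma DX_bounded:
  obtains L where "L \<ge> 0" "\<And>z u. norm (snd z) \<le> R \<Longrightarrow> norm (DX z u) \<le> L * norm u"
proof -
  have "\<exists>M. \<forall>z. norm (snd z) \<le> R \<longrightarrow> norm (DX z b) \<le> M" for b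
    using periodic_bounded[OF DX_cont DX_periodic, of b R] by (auto simp: bounded_iff)
  then obtain M where M: "\<And>z b. norm (snd z) \<le> R \<Longrightarrow> norm (DX z b) \<le> M b" by metis
  have "norm (DX z u) \<le> (\<Sum>b\<in>Basis. \<bar>M b\<bar>) * norm u" if z: "norm (snd z) \<le> R" for z u
  proof -
    have "DX z u = (\<Sum>b\<in>Basis. (u \<bullet> b) *\<^sub>R DX z b)"
      by (subst euclidean_representation[of u, symmetric])
        (simp add: linear_sum[OF linear_DX] linear_scale[OF linear_DX] del: euclidean_representation)
    then have "norm (DX z u) \<le> (\<Sum>b\<in>Basis. norm ((u \<bullet> b) *\<^sub>R DX z b))" by (metis norm_sum)
    also have "\<dots> \<le> (\<Sum>b\<in>Basis. norm u * \<bar>M b\<bar>)"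
      using M[OF z] by (intro sum_mono) (auto intro!: mult_mono Basis_le_norm order_trans[OF _ abs_ge_self])
    finally show ?thesis by (simp add: sum_distrib_left[symmetric] mult.commute)
  qed
  then show thesis by (intro that[of "\<Sum>b\<in>Basis. \<bar>M b\<bar>"]) (auto intro: sum_nonneg)
qed

lemma DX_uniformly_continuous:
  assumes "e > 0"
  shows "\<exists>d>0. \<forall>a b u. norm (snd a) \<le> R \<longrightarrow> norm (snd b) \<le> R \<longrightarrow> norm (a - b) < d \<longrightarrow>
     norm (DX a u - DX b u) \<le> e * norm u"
proof -
  define e1 where "e1 = e / real (DIM('n lifted))"
  have e1: "e1 > 0" using assms by (simp add: e1_def)
  have "\<exists>d>0. \<forall>a b. norm (snd a) \<le> R \<longrightarrow> norm (snd b) \<le> R \<longrightarrow> norm (a - b) < d \<longrightarrow> dist (DX a v) (DX b v) < e1" for v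
    by (rule periodic_uniformly_continuous[OF DX_cont DX_periodic e1])
  then obtain d where d: "\<And>v. d v > 0" "\<And>a b v. norm (snd a) \<le> R \<Longrightarrow> norm (snd b) \<le> R \<Longrightarrow> norm (a - b) < d v \<Longrightarrow>
      dist (DX a v) (DX b v) < e1" by metis
  show ?thesis
  proof (intro exI[of _ "Min (d ` Basis)"] conjI allI impI)
    show "Min (d ` Basis) > 0" using d(1) by (subst Min_gr_iff) auto
    fix a b u :: "'n lifted"
    assume ab: "norm (snd a) \<le> R" "norm (snd b) \<le> R" "norm (a - b) < Min (d ` Basis)"
    have "DX z u = (\<Sum>b\<in>Basis. (u \<bullet> b) *\<^sub>R DX z b)" for z
      by (subst euclidean_representation[of u, symmetric])
        (simp add: linear_sum[OF linear_DX] linear_scale[OF linear_DX] del: euclidean_representation)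
    then have eq: "DX a u - DX b u = (\<Sum>v\<in>Basis. (u \<bullet> v) *\<^sub>R (DX a v - DX b v))"
      by (simp add: scaleR_diff_right sum_subtractf)
    have "norm (DX a u - DX b u) \<le> (\<Sum>v\<in>Basis. norm ((u \<bullet> v) *\<^sub>R (DX a v - DX b v)))"
      unfolding eq by (rule norm_sum)
    also have "\<dots> \<le> (\<Sum>v\<in>(Basis::'n lifted set). norm u * e1)"
    proof (rule sum_mono)
      fix v :: "'n lifted" assume v: "v \<in> Basis"
      have "norm (a - b) < d v" using ab(3) v by (simp add: Min_gr_iff)
      then have "norm (DX a v - DX b v) \<le> e1" using d(2) ab by (simp add: dist_norm less_imp_le)
      then show "norm ((u \<bullet> v) *\<^sub>R (DX a v - DX b v)) \<le> norm u * e1"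
        using Basis_le_norm[OF v, of u] by (auto intro!: mult_mono)
    qed
    also have "\<dots> = e * norm u" by (simp add: e1_def)
    finally show "norm (DX a u - DX b u) \<le> e * norm u" .
  qed
qed

lemma convex_strip: "convex {z::'n lifted. norm (snd z) \<le> R}"
proof -
  have "{z::'n lifted. norm (snd z) \<le> R} = UNIV \<times> cball 0 R" by (auto simp: mem_Times_iff)
  then show ?thesis by (simp add: convex_Times)
qed

text \<open>A sublevel of \<open>Hl\<close> is open and invariant but may fail to be convex; the
  mean value estimates are made on a convex strip of bounded momentum that contains it.\<close>

lemma lipschitz_flow_sublevel:
  obtains L where "lipschitz_flow X DX \<Phi> {z. Hl z < c} L"
proof -
  obtain R where R: "\<And>z. Hl z < c \<Longrightarrow> norm (snd z) \<le> R" by (rule sublevel_bounded) blast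
  obtain L where L: "L \<ge> 0" "\<And>z u. norm (snd z) \<le> R \<Longrightarrow> norm (DX z u) \<le> L * norm u" by (rule DX_bounded) blast
  have Hl_cont: "continuous_on UNIV Hl"
    using Hl_deriv by (meson continuous_at_imp_continuous_on has_derivative_continuous)
  have "lipschitz_flow X DX \<Phi> {z. Hl z < c} L"
  proof (rule lipschitz_flow.intro)
    show "open {z. Hl z < c}" by (intro open_Collect_less Hl_cont continuous_on_const)
    show "norm (X a - X b) \<le> L * norm (a - b)" if "a \<in> {z. Hl z < c}" "b \<in> {z. Hl z < c}" for a b
      by (rule differentiable_bound[OF convex_strip[of R] has_derivative_at_withinI[OF X_deriv]])
        (use that R L in \<open>auto intro: onorm_le\<close>)
    show "\<exists>d>0. \<forall>a\<in>{z. Hl z < c}. \<forall>b\<in>{z. Hl z < c}. \<forall>w\<in>{z. Hl z < c}. norm (a - w) < d \<longrightarrow> norm (b - w) < d \<longrightarrow>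
        norm (X a - X b - DX w (a - b)) \<le> e * norm (a - b)" if "e > 0" for e
    proof -
      obtain d where d: "d > 0" "\<And>a b u. norm (snd a) \<le> R \<Longrightarrow> norm (snd b) \<le> R \<Longrightarrow> norm (a - b) < d \<Longrightarrow>
        norm (DX a u - DX b u) \<le> e * norm u" using DX_uniformly_continuous[OF \<open>e > 0\<close>] by metis
      have "norm (X a - X b - DX w (a - b)) \<le> e * norm (a - b)"
        if abw: "norm (snd a) \<le> R" "norm (snd b) \<le> R" "norm (snd w) \<le> R" "norm (a - w) < d" "norm (b - w) < d" for a b w
      proof -
        \<comment> \<open>The mean value estimate is applied to \<open>X\<close> minus its linear
          part at \<open>w\<close>, whose derivative \<open>DX y - DX w\<close> is uniformly small
          near \<open>w\<close>.\<close>
        have "norm ((X a - DX w a) - (X b - DX w b)) \<le> e * norm (a - b)"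
        proof (rule differentiable_bound[where S = "{z. norm (snd z) \<le> R} \<inter> ball w d" and f = "\<lambda>y. X y - DX w y" and f' = "\<lambda>y u. DX y u - DX w u"])
          show "convex ({z. norm (snd z) \<le> R} \<inter> ball w d)" by (intro convex_Int convex_strip convex_ball)
          show "((\<lambda>y. X y - DX w y) has_derivative (\<lambda>u. DX y u - DX w u)) (at y within {z. norm (snd z) \<le> R} \<inter> ball w d)" for y
            by (intro has_derivative_diff has_derivative_at_withinI[OF X_deriv]
                bounded_linear_imp_has_derivative linear_DX[unfolded linear_conv_bounded_linear])
          show "onorm (\<lambda>u. DX y u - DX w u) \<le> e" if "y \<in> {z. norm (snd z) \<le> R} \<inter> ball w d" for y
            by (rule onorm_le, rule d(2)) (use that abw in \<open>auto simp: dist_norm norm_minus_commute\<close>)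
        qed (use abw in \<open>auto simp: dist_norm norm_minus_commute\<close>)
        then show ?thesis by (simp add: linear_diff[OF linear_DX] algebra_simps)
      qed
      with d(1) R show ?thesis by blast
    qed
    show "linear (DX w)" for w by (rule linear_DX)
    show "norm (DX w v) \<le> L * norm v" if "w \<in> {z. Hl z < c}" for w v using that R L(2) by blast
    show "\<Phi> t z \<in> {z. Hl z < c}" if "z \<in> {z. Hl z < c}" for t z using that by (simp add: Hl_\<Phi>)
  qed (rule \<Phi>_0 \<Phi>_deriv L(1))+
  with that show thesis .
qed

lemma fiber_hessian_eq: "fiber_hessian H (cotangent_of z) v w = ddH (0, w) z (0, v)"
proof -
  have pair: "((\<lambda>p. (fst z, p)) has_derivative (\<lambda>h. (0, h))) (at p)" for p
    by (intro has_derivative_Pair has_derivative_const has_derivative_ident)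
  have "((\<lambda>p'. H (fst (cotangent_of z), p')) has_derivative (\<lambda>h. dH (fst z, p) (0, h))) (at p)" for p
    using has_derivative_compose[OF pair Hl_deriv, of p]
    by (simp add: Hl_def cotangent_of_def)
  then have 1: "frechet_derivative (\<lambda>p'. H (fst (cotangent_of z), p')) (at p) w = dH (fst z, p) (0, w)" for p
    using frechet_derivative_at by (metis (no_types, lifting))
  have "((\<lambda>p. dH (fst z, p) (0, w)) has_derivative (\<lambda>h. ddH (0, w) (fst z, snd z) (0, h))) (at (snd z))"
    by (rule has_derivative_compose[OF pair dH_deriv])
  then show ?thesis
    unfolding fiber_hessian_def 1 by (simp add: frechet_derivative_at[symmetric] cotangent_of_def)
qed

text \<open>The form is quadratic in \<open>c\<close> and periodic in the base, so its positive
  minimum over the unit cell, a ball of momenta and the unit sphere is the constant.\<close>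

lemma uniformly_coercive:
  obtains \<kappa> where "\<kappa> > 0" "\<And>z c. norm (snd z) \<le> R \<Longrightarrow> \<kappa> * (norm c)\<^sup>2 \<le> fst (DX z (0, c)) \<bullet> c"
proof -
  have fst_DX: "fst (DX z (0, c)) \<bullet> c = ddH (0, c) z (0, c)" for z c
    using omega_DX[of z "(0, c)" "(0, c)"] by (simp add: omega_def)
  have pos: "fst (DX z (0, c)) \<bullet> c > 0" if "c \<noteq> 0" for z c
    using tonelli that fiber_hessian_eq[of z c c] unfolding tonelli_def fst_DX by metis
  define F where "F w = fst (DX (fst w) (0, snd w)) \<bullet> snd w" for w :: "'n lifted \<times> (real^'n)"
  have exp: "DX z (0, c) = (\<Sum>b\<in>Basis. ((0, c) \<bullet> b) *\<^sub>R DX z b)" for z c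
    by (subst euclidean_representation[of "(0, c)", symmetric])
      (simp add: linear_sum[OF linear_DX] linear_scale[OF linear_DX] del: euclidean_representation)
  have F_cont: "continuous_on UNIV F"
    unfolding F_def exp
    by (intro continuous_intros continuous_on_compose2[OF DX_cont]) auto
  show thesis
  proof (cases "R \<ge> 0")
    case False
    then have "\<not> norm (snd z) \<le> R" for z :: "'n lifted" using norm_ge_zero[of "snd z"] by linarith
    then show thesis by (intro that[of 1]) auto
  next
    case True
    let ?K = "(cbox 0 (1::real^'n) \<times> cball (0::real^'n) R) \<times> sphere (0::real^'n) 1"
    have "axis undefined 1 \<in> sphere (0::real^'n) 1" by simp
    then have "((0, 0), axis undefined 1) \<in> ?K" using True by (simp add: mem_box_cart)
    then have ne: "?K \<noteq> {}" by blast
    have "compact ?K" by (intro compact_Times compact_cbox compact_cball compact_sphere)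
    then obtain w0 where w0: "w0 \<in> ?K" "\<And>w. w \<in> ?K \<Longrightarrow> F w0 \<le> F w"
      using continuous_attains_inf[OF _ ne continuous_on_subset[OF F_cont subset_UNIV]] by blast
    have "snd w0 \<noteq> 0" using w0(1) by auto
    then have k: "F w0 > 0" unfolding F_def by (rule pos)
    have "F w0 * (norm c)\<^sup>2 \<le> fst (DX z (0, c)) \<bullet> c" if z: "norm (snd z) \<le> R" for z c
    proof (cases "c = 0")
      case False
      obtain m where m: "m \<in> int_vec" "z + (m, 0) \<in> cbox 0 1 \<times> UNIV" by (rule fundamental_strip)
      have "(z + (m, 0), c /\<^sub>R norm c) \<in> ?K"
        using m z False by (auto simp: mem_Times_iff)
      then have "F w0 \<le> F (z + (m, 0), c /\<^sub>R norm c)" by (rule w0(2))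
      also have "\<dots> = fst (DX z (0, c /\<^sub>R norm c)) \<bullet> (c /\<^sub>R norm c)"
        by (simp add: F_def DX_periodic[OF m(1)])
      also have "(0, c /\<^sub>R norm c) = inverse (norm c) *\<^sub>R (0 :: real^'n, c)" by simp
      finally have "F w0 \<le> inverse (norm c) * (inverse (norm c) * (fst (DX z (0, c)) \<bullet> c))"
        by (simp only: linear_scale[OF linear_DX] fst_scaleR inner_scaleR_left inner_scaleR_right)
      then show ?thesis using False by (simp add: field_simps power2_eq_square)
    qed simp
    with k that show thesis by blast
  qed
qed

end

section \<open>Invariant tori conjugated to rotations\<close>

lemma dist_torus_add: "dist (x + a) (y + a) = dist x (y :: 'n::finite torus)"
proof -
  have "dist (s + b) (t + b) = dist s t" for s t b :: circle
    by transfer simp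
  then show ?thesis by (simp add: dist_vec_def)
qed

locale conjugated_torus = tonelli_flow H \<phi>
  for H :: "'n::finite cotangent \<Rightarrow> real" and \<phi> +
  fixes N :: "'n cotangent set" and T :: real and a :: "'n torus" and h h' C C'
  assumes invariant: "\<phi> t ` N = N" and T_pos: "T > 0"
    and homeo: "homeomorphism UNIV N h h'" and lip_h: "C-lipschitz_on UNIV h" and lip_h': "C'-lipschitz_on N h'"
    and conjugacy: "h (\<theta> + a) = \<phi> T (h \<theta>)"
    and no_conjugate: "x \<in> N \<Longrightarrow> no_conjugate_points \<phi> (orbit \<phi> x)"
begin

lemma energy_bound: obtains c where "\<And>z. cotangent_of z \<in> N \<Longrightarrow> Hl z < c"
proof -
  obtain R where R: "\<And>x. x \<in> N \<Longrightarrow> norm (snd x) \<le> R"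
    by (rule bounded_fiber_component[OF compact_torus_image[OF homeo]]) blast
  have "continuous_on UNIV Hl"
    using Hl_deriv by (meson continuous_at_imp_continuous_on has_derivative_continuous)
  then have "bounded (Hl ` {z. norm (snd z) \<le> R})" by (rule periodic_bounded[OF _ Hl_periodic])
  then obtain M where M0: "\<forall>y\<in>Hl ` {z. norm (snd z) \<le> R}. norm y \<le> M" unfolding bounded_iff by blast
  have M: "\<bar>Hl z\<bar> \<le> M" if "norm (snd z) \<le> R" for z
    using bspec[OF M0 imageI[of z]] that by simp
  have "Hl z < M + 1" if "cotangent_of z \<in> N" for z
    using M[of z] R[OF that] by (simp add: cotangent_of_def)
  with that show thesis .
qed

end

text \<open>The level \<open>c\<close> lies above the energies of the torus, so that the
  linearization \<open>D\<close> is available on an open invariant neighbourhood of the lifted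
  torus.\<close>

locale conjugated_torus_flow = conjugated_torus H \<phi> N T a h h' C C' + lipschitz_flow X DX \<Phi> "{z. Hl z < c}" L
  for H :: "'n::finite cotangent \<Rightarrow> real" and \<phi> N T a h h' C C' c L +
  assumes energy_less: "cotangent_of z \<in> N \<Longrightarrow> Hl z < c"
begin

text \<open>\<open>D'\<close> comes from some lift \<open>F\<close> near some preimage
  \<open>z0\<close>. Increments of \<open>F\<close> and of \<open>\<Phi> t\<close> have equal
  momentum parts and base parts that differ by an integer vector; near the point this vector has
  norm below 1, so it is 0.\<close>

lemma cotangent_derivative_eq:
  assumes D': "has_cotangent_derivative (\<phi> t) D' (cotangent_of z)" and z: "Hl z < c" and t: "t \<ge> 0"
  shows "D' v = D t z v"
proof -
  obtain F z0 where z0: "cotangent_of z0 = cotangent_of z" and F: "(F has_derivative D') (at z0)"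
    and ev: "\<forall>\<^sub>F y in nhds z0. cotangent_of (F y) = \<phi> t (cotangent_of y)"
    using D' unfolding has_cotangent_derivative_def by blast
  define m where "m = fst z - fst z0"
  have m: "m \<in> int_vec" "z = z0 + (m, 0)"
    using z0[symmetric] unfolding cotangent_of_eq_iff m_def by (simp_all add: prod_eq_iff)
  let ?y = "\<lambda>n. z0 + v /\<^sub>R real (Suc n)" and ?z = "\<lambda>n. z + v /\<^sub>R real (Suc n)"
  have q: "(\<lambda>n. (\<Phi> t (?z n) - \<Phi> t z) /\<^sub>R inverse (real (Suc n))) \<longlonglongrightarrow> D t z v"
    by (rule D_limit[OF _ step_tendsto tendsto_const _ _ t]) (use z in simp_all)
  have "(\<lambda>n. inverse (real (Suc n)) *\<^sub>R ((\<Phi> t (?z n) - \<Phi> t z) /\<^sub>R inverse (real (Suc n)))) \<longlonglongrightarrow> 0 *\<^sub>R D t z v"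
    by (rule tendsto_scaleR[OF LIMSEQ_inverse_real_of_nat q])
  then have \<Phi>_lim: "(\<lambda>n. \<Phi> t (?z n) - \<Phi> t z) \<longlonglongrightarrow> 0"
    by (simp del: of_nat_Suc)
  have F_lim: "(\<lambda>n. F (?y n)) \<longlonglongrightarrow> F z0"
    by (rule isCont_tendsto_compose[OF has_derivative_continuous[OF F] step_tendsto])
  have "(\<lambda>n. (F (?y n) - F z0) - (\<Phi> t (?z n) - \<Phi> t z)) \<longlonglongrightarrow> (F z0 - F z0) - 0"
    by (intro tendsto_diff F_lim \<Phi>_lim tendsto_const)
  then have "\<forall>\<^sub>F n in sequentially. dist ((F (?y n) - F z0) - (\<Phi> t (?z n) - \<Phi> t z)) 0 < 1"
    by (intro tendstoD) simp_all
  moreover have "\<forall>\<^sub>F n in sequentially. cotangent_of (F (?y n)) = \<phi> t (cotangent_of (?y n))"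
    using step_tendsto ev unfolding filterlim_iff by blast
  ultimately have "\<forall>\<^sub>F n in sequentially. (\<Phi> t (?z n) - \<Phi> t z) /\<^sub>R inverse (real (Suc n)) = (F (?y n) - F z0) /\<^sub>R inverse (real (Suc n))"
  proof eventually_elim
    case (elim n)
    have "cotangent_of (F z0) = cotangent_of (\<Phi> t z)"
      using eventually_nhds_x_imp_x[OF ev] z0 by (simp add: cotangent_of_\<Phi>)
    moreover have "cotangent_of (F (?y n)) = cotangent_of (\<Phi> t (?z n))"
    proof -
      have zy: "?z n = ?y n + (m, 0)" using m(2) by (simp only: ac_simps)
      have "cotangent_of (?z n) = cotangent_of (?y n)"
        unfolding zy using m(1) by (rule cotangent_of_add_int)
      then show ?thesis using elim(2) by (simp only: cotangent_of_\<Phi>)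
    qed
    ultimately have k: "fst (F (?y n)) - fst (\<Phi> t (?z n)) - (fst (F z0) - fst (\<Phi> t z)) \<in> int_vec"
      "snd (F (?y n)) = snd (\<Phi> t (?z n))" "snd (F z0) = snd (\<Phi> t z)"
      unfolding cotangent_of_eq_iff by (blast intro: int_vec_closed)+
    define w where "w = (F (?y n) - F z0) - (\<Phi> t (?z n) - \<Phi> t z)"
    have fw: "fst w = fst (F (?y n)) - fst (\<Phi> t (?z n)) - (fst (F z0) - fst (\<Phi> t z))"
      by (simp add: w_def)
    have "norm w < 1" using elim(1) unfolding w_def dist_norm diff_0_right .
    then have "norm (fst w) < 1"
      using norm_fst_le[of "fst w" "snd w", unfolded prod.collapse] by linarith
    then have "fst w = 0" using int_vec_small k(1) fw by metis
    moreover have "snd w = 0" using k(2,3) by (simp add: w_def)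
    ultimately have "w = 0" by (simp add: prod_eq_iff)
    then have "\<Phi> t (?z n) - \<Phi> t z = F (?y n) - F z0" by (simp add: w_def)
    then show ?case by simp
  qed
  then have "(\<lambda>n. (F (?y n) - F z0) /\<^sub>R inverse (real (Suc n))) \<longlonglongrightarrow> D t z v"
    by (rule Lim_transform_eventually[OF q])
  then show ?thesis
    using has_derivative_sequential[OF F] LIMSEQ_unique by blast
qed

lemma twist:
  assumes z: "cotangent_of z \<in> N" and t: "t > 0" and "fst (D t z (0, p)) = 0"
  shows "D t z (0, p) = 0"
proof -
  have "\<phi> 0 (cotangent_of z) = cotangent_of z" using cotangent_of_\<Phi>[of 0 z] by (simp add: \<Phi>_0)
  then have "cotangent_of z \<in> orbit \<phi> (cotangent_of z)" unfolding orbit_def by (metis rangeI)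
  then obtain D' where D': "has_cotangent_derivative (\<phi> t) D' (cotangent_of z)" "D' ` vertical \<inter> vertical = {0}"
    using no_conjugate[OF z] t unfolding no_conjugate_points_def by (metis less_irrefl)
  have "D' (0, p) = D t z (0, p)"
    by (rule cotangent_derivative_eq[OF D'(1) energy_less[OF z]]) (use t in simp)
  then have "D t z (0, p) \<in> D' ` vertical \<inter> vertical"
    using assms(3) by (auto simp: vertical_def intro!: image_eqI[of _ _ "(0, p)"])
  with D'(2) show ?thesis by blast
qed

lemma linear_hamiltonian_along:
  obtains \<kappa> where "\<And>z. cotangent_of z \<in> N \<Longrightarrow> linear_hamiltonian (\<lambda>t. D t z) (\<lambda>t. DX (\<Phi> t z)) \<kappa>"
proof -
  obtain R where R: "\<And>z. Hl z < c \<Longrightarrow> norm (snd z) \<le> R" by (rule sublevel_bounded) blast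
  obtain \<kappa> where \<kappa>: "\<kappa> > 0" "\<And>z p. norm (snd z) \<le> R \<Longrightarrow> \<kappa> * (norm p)\<^sup>2 \<le> fst (DX z (0, p)) \<bullet> p"
    by (rule uniformly_coercive) blast
  have "linear_hamiltonian (\<lambda>t. D t z) (\<lambda>t. DX (\<Phi> t z)) \<kappa>" if z: "cotangent_of z \<in> N" for z
  proof (rule linear_hamiltonian.intro)
    have zc: "z \<in> {z. Hl z < c}" using energy_less[OF z] by simp
    show "linear (D t z)" if "t \<ge> 0" for t by (rule linear_D[OF zc that])
    show "D 0 z v = v" for v by (rule D_0[OF zc])
    show "((\<lambda>t. D t z v) has_vector_derivative DX (\<Phi> t z) (D t z v)) (at t within {0..})" if "t \<ge> 0" for t v
      by (rule D_deriv[OF zc that])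
    show "linear (DX (\<Phi> t z))" for t by (rule tonelli_flow.linear_DX) unfold_locales
    show "omega (DX (\<Phi> t z) u) w + omega u (DX (\<Phi> t z) w) = 0" for t u w by (rule DX_skew)
    show "\<kappa> * (norm p)\<^sup>2 \<le> fst (DX (\<Phi> t z) (0, p)) \<bullet> p" for t p
      by (rule \<kappa>(2), rule R) (use zc in \<open>simp add: Hl_\<Phi>\<close>)
    show "D t z (0, p) = 0" if "t > 0" "fst (D t z (0, p)) = 0" for t p
      by (rule twist[OF z that])
  qed (rule \<kappa>(1))
  with that show thesis by blast
qed

text \<open>Rotations are isometries of the torus, so the Lipschitz constants of \<open>h\<close>
  and \<open>h'\<close> enter only once, whatever \<open>k\<close>.\<close>

lemma \<phi>_dist_le:
  assumes "x \<in> N" "y \<in> N"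
  shows "dist (\<phi> (real k * T) x) (\<phi> (real k * T) y) \<le> C * C' * dist x y"
proof -
  define rot where "rot = ((\<lambda>\<theta>. \<theta> + a) ^^ k)"
  have iter: "h (((\<lambda>\<theta>. \<theta> + a) ^^ k) \<theta>) = \<phi> (real k * T) (h \<theta>)" for k \<theta>
  proof (induction k)
    case 0
    obtain z where "h \<theta> = cotangent_of z" by (rule cotangent_of_surj)
    then show ?case using cotangent_of_\<Phi>[of 0 z] by (simp add: \<Phi>_0)
  next
    case (Suc k)
    obtain z where z: "h \<theta> = cotangent_of z" by (rule cotangent_of_surj)
    have "cotangent_of z \<in> N" using homeomorphism_image1[OF homeo] z by (metis rangeI)
    then have "\<Phi> (T + real k * T) z = \<Phi> T (\<Phi> (real k * T) z)"
      using energy_less T_pos by (intro flow_add) auto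
    then have "\<phi> (real (Suc k) * T) (h \<theta>) = \<phi> T (\<phi> (real k * T) (h \<theta>))"
      by (simp add: z cotangent_of_\<Phi>[symmetric] algebra_simps)
    then show ?case using Suc by (simp add: conjugacy)
  qed
  have iso: "dist (((\<lambda>\<theta>. \<theta> + a) ^^ k) s) (((\<lambda>\<theta>. \<theta> + a) ^^ k) t) = dist s t" for k s t
    by (induction k) (simp_all add: dist_torus_add)
  have hh': "h (h' x) = x" "h (h' y) = y"
    using assms homeomorphism_apply2[OF homeo] by auto
  have "dist (\<phi> (real k * T) x) (\<phi> (real k * T) y) = dist (h (rot (h' x))) (h (rot (h' y)))"
    using iter[of k "h' x"] iter[of k "h' y"] hh' by (simp add: rot_def)
  also have "\<dots> \<le> C * dist (rot (h' x)) (rot (h' y))"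
    by (rule lipschitz_onD[OF lip_h]) auto
  also have "\<dots> = C * dist (h' x) (h' y)" by (simp add: rot_def iso)
  also have "\<dots> \<le> C * (C' * dist x y)"
    using lipschitz_onD[OF lip_h' assms] lipschitz_on_nonneg[OF lip_h] by (intro mult_left_mono)
  finally show ?thesis by simp
qed

text \<open>A linear substitute for the tangent space: it contains all limits of difference
  quotients, and linearity of \<open>D\<close> makes it a subspace.\<close>

definition bounded_vectors :: "'n lifted \<Rightarrow> 'n lifted set"
  where "bounded_vectors z = {u. \<exists>K. \<forall>t\<ge>0. norm (D t z u) \<le> K}"

lemma paratingent_bounded:
  assumes a: "\<And>n. cotangent_of (\<alpha> n) \<in> N" and b: "\<And>n. cotangent_of (\<beta> n) \<in> N"
    and az: "\<alpha> \<longlonglongrightarrow> z" and bz: "\<beta> \<longlonglongrightarrow> z" and eps: "\<And>n. \<epsilon> n > (0::real)"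
    and v: "(\<lambda>n. (\<alpha> n - \<beta> n) /\<^sub>R \<epsilon> n) \<longlonglongrightarrow> v"
  shows "v \<in> bounded_vectors z"
proof -
  have "z \<in> cotangent_of -` N"
    by (rule closed_sequentially[OF closed_cotangent_lift[OF compact_torus_image[OF homeo]] _ az]) (use a in auto)
  then have zc: "z \<in> {z. Hl z < c}" using energy_less by simp
  have periods: "norm (D (real k * T) z v) \<le> C * C' * norm v" for k
  proof -
    let ?t = "real k * T"
    define G where "G = exp ((2 * L + 1) * ?t)"
    have G: "G > 0" by (simp add: G_def)
    have t: "0 \<le> ?t" using T_pos by simp
    have q: "(\<lambda>n. (\<Phi> ?t (\<alpha> n) - \<Phi> ?t (\<beta> n)) /\<^sub>R \<epsilon> n) \<longlonglongrightarrow> D ?t z v"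
      by (rule D_limit[OF zc az bz eps v t])
    have "(\<lambda>n. \<alpha> n - \<beta> n) \<longlonglongrightarrow> 0" using tendsto_diff[OF az bz] by simp
    \<comment> \<open>The flow expands distances by at most \<open>G\<close> up to this time, so the
      lifted images stay within \<open>1 / 2\<close>, where the covering preserves
      distances.\<close>
    then have "\<forall>\<^sub>F n in sequentially. dist (\<alpha> n - \<beta> n) 0 < 1 / (2 * G)"
      using G by (intro tendstoD) auto
    then have "\<forall>\<^sub>F n in sequentially. norm ((\<Phi> ?t (\<alpha> n) - \<Phi> ?t (\<beta> n)) /\<^sub>R \<epsilon> n) \<le> C * C' * norm ((\<alpha> n - \<beta> n) /\<^sub>R \<epsilon> n)"
    proof eventually_elim
      case (elim n)
      have "norm (\<Phi> ?t (\<alpha> n) - \<Phi> ?t (\<beta> n)) \<le> norm (\<alpha> n - \<beta> n) * G"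
        unfolding G_def by (rule flow_dist_le) (use energy_less a b t in auto)
      also have "\<dots> \<le> 1 / 2" using elim G by (simp add: field_simps)
      finally have small: "dist (\<Phi> ?t (\<alpha> n)) (\<Phi> ?t (\<beta> n)) \<le> 1 / 2" by (simp add: dist_norm)
      have "norm (\<Phi> ?t (\<alpha> n) - \<Phi> ?t (\<beta> n)) = dist (\<phi> ?t (cotangent_of (\<alpha> n))) (\<phi> ?t (cotangent_of (\<beta> n)))"
        using dist_cotangent_of[OF small] by (simp add: cotangent_of_\<Phi> dist_norm)
      also have "\<dots> \<le> C * C' * dist (cotangent_of (\<alpha> n)) (cotangent_of (\<beta> n))"
        by (rule \<phi>_dist_le[OF a b])
      also have "\<dots> \<le> C * C' * norm (\<alpha> n - \<beta> n)"
        using dist_cotangent_of_le[of "\<alpha> n" "\<beta> n"] lipschitz_on_nonneg[OF lip_h] lipschitz_on_nonneg[OF lip_h']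
        by (intro mult_left_mono) (auto simp: dist_norm)
      finally have "norm (\<Phi> ?t (\<alpha> n) - \<Phi> ?t (\<beta> n)) / \<epsilon> n \<le> C * C' * norm (\<alpha> n - \<beta> n) / \<epsilon> n"
        using eps[of n] by (intro divide_right_mono) auto
      then show ?case using eps[of n] by (simp add: divide_inverse_commute mult.left_commute)
    qed
    then show ?thesis
      by (intro tendsto_le[OF _ tendsto_mult[OF tendsto_const tendsto_norm[OF v]] tendsto_norm[OF q]]) auto
  qed
  \<comment> \<open>Between two multiples of \<open>T\<close> the growth is at most the Gronwall
    factor of one period.\<close>
  have "norm (D t z v) \<le> C * C' * norm v * exp ((2 * L + 1) * T)" if t: "t \<ge> 0" for t
  proof -
    define k where "k = nat \<lfloor>t / T\<rfloor>"
    define r where "r = t - real k * T"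
    have k: "real k = of_int \<lfloor>t / T\<rfloor>" using t T_pos by (simp add: k_def)
    have "real k \<le> t / T" "t / T < real k + 1" unfolding k by linarith+
    then have r: "0 \<le> r" "r \<le> T" using T_pos by (simp_all add: r_def field_simps)
    have kT: "0 \<le> real k * T" using T_pos by simp
    have "D (r + real k * T) z v = D r (\<Phi> (real k * T) z) (D (real k * T) z v)"
      by (rule D_add[OF zc r(1) kT])
    then have "norm (D t z v) \<le> norm (D (real k * T) z v) * exp ((2 * L + 1) * r)"
      using D_le[OF flow_in[OF zc] r(1)] by (simp add: r_def)
    also have "\<dots> \<le> C * C' * norm v * exp ((2 * L + 1) * T)"
      using periods[of k] r L_nonneg by (intro mult_mono) (auto intro: order_trans[OF norm_ge_zero])
    finally show ?thesis .
  qed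
  then show ?thesis unfolding bounded_vectors_def by blast
qed

sublocale paratingent_torus N h h' C' bounded_vectors
proof (rule paratingent_torus.intro)
  obtain \<kappa> where lh: "\<And>z. cotangent_of z \<in> N \<Longrightarrow> linear_hamiltonian (\<lambda>t. D t z) (\<lambda>t. DX (\<Phi> t z)) \<kappa>"
    by (rule linear_hamiltonian_along) blast
  show "subspace (bounded_vectors z)" if z: "cotangent_of z \<in> N" for z
  proof -
    have lin: "linear (D t z)" if "t \<ge> 0" for t by (rule linear_hamiltonian.lin[OF lh[OF z] that])
    show ?thesis
      unfolding subspace_def bounded_vectors_def
    proof (intro conjI ballI allI CollectI)
      show "\<exists>K. \<forall>t\<ge>0. norm (D t z 0) \<le> K" using lin by (intro exI[of _ 0]) (auto simp: linear_0)
      fix u w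
      assume "u \<in> {u. \<exists>K. \<forall>t\<ge>0. norm (D t z u) \<le> K}"
      then obtain K where K: "\<And>t. t \<ge> 0 \<Longrightarrow> norm (D t z u) \<le> K" by blast
      show "\<exists>K. \<forall>t\<ge>0. norm (D t z (s *\<^sub>R u)) \<le> K" for s
        using K lin by (intro exI[of _ "\<bar>s\<bar> * K"]) (auto simp: linear_scale intro: mult_left_mono)
      assume "w \<in> {u. \<exists>K. \<forall>t\<ge>0. norm (D t z u) \<le> K}"
      then obtain K' where K': "\<And>t. t \<ge> 0 \<Longrightarrow> norm (D t z w) \<le> K'" by blast
      show "\<exists>K. \<forall>t\<ge>0. norm (D t z (u + w)) \<le> K"
        using K K' lin by (intro exI[of _ "K + K'"]) (auto simp: linear_add intro: norm_triangle_mono)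
    qed
  qed
  show "omega u w = 0" if z: "cotangent_of z \<in> N" and uw: "u \<in> bounded_vectors z" "w \<in> bounded_vectors z" for z u w
  proof -
    obtain K K' where K: "\<And>t. t \<ge> 0 \<Longrightarrow> norm (D t z u) \<le> K" "\<And>t. t \<ge> 0 \<Longrightarrow> norm (D t z w) \<le> K'"
      using uw unfolding bounded_vectors_def by blast
    show ?thesis
      by (rule linear_hamiltonian.isotropic[OF lh[OF z], where K = "max K K'"]) (use K in \<open>auto simp: le_max_iff_disj\<close>)
  qed
  show "p = 0" if z: "cotangent_of z \<in> N" and p: "(0, p) \<in> bounded_vectors z" for z p
  proof -
    \<comment> \<open>At time 0 every vertical vector stays vertical, so
      \<open>vertical_unbounded\<close> cannot be used at \<open>z\<close> itself. It is applied one
      time unit earlier, at a point \<open>y\<close> with \<open>\<Phi> 1 y = z\<close> that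
      invariance of the torus provides.\<close>
    have "cotangent_of z \<in> \<phi> 1 ` N" using invariant z by simp
    then obtain x where x: "cotangent_of z = \<phi> 1 x" "x \<in> N" by (rule imageE)
    obtain y0 where y0: "x = cotangent_of y0" by (rule cotangent_of_surj)
    have y0c: "y0 \<in> {z. Hl z < c}" using energy_less x(2) y0 by simp
    define m where "m = fst z - fst (\<Phi> 1 y0)"
    have "cotangent_of z = cotangent_of (\<Phi> 1 y0)" using x(1) y0 by (simp add: cotangent_of_\<Phi>)
    then have m: "m \<in> int_vec" "z = \<Phi> 1 y0 + (m, 0)"
      unfolding cotangent_of_eq_iff m_def by (simp_all add: prod_eq_iff)
    define y where "y = y0 + (m, 0)"
    have y: "cotangent_of y \<in> N" using x(2) y0 m(1) by (simp add: y_def)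
    have yc: "y \<in> {z. Hl z < c}" using energy_less[OF y] by simp
    \<comment> \<open>Uniqueness of solutions: \<open>\<Phi>\<close> commutes with integer
      translations although the lifts were chosen independently.\<close>
    have "\<Phi> 1 y0 + (m, 0) = \<Phi> 1 (\<Phi> 0 y0 + (m, 0))"
    proof (rule flow_unique)
      show "((\<lambda>t. \<Phi> t y0 + (m, 0)) has_vector_derivative X (\<Phi> t y0 + (m, 0))) (at t)" for t
        using \<Phi>_deriv[of y0 t] by (simp add: X_periodic[OF m(1)] has_vector_derivative_add_const)
      show "\<Phi> t y0 + (m, 0) \<in> {z. Hl z < c}" for t
        using flow_in[OF y0c, of t] by (simp add: Hl_periodic[OF m(1)])
    qed simp
    then have yz: "\<Phi> 1 y = z" using m(2) by (simp add: y_def \<Phi>_0)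
    interpret lh: linear_hamiltonian "\<lambda>t. D t y" "\<lambda>t. DX (\<Phi> t y)" \<kappa> by (rule lh[OF y])
    have lin1: "linear (D 1 y)" by (rule lh.lin) simp
    have "inj (D 1 y)"
      using lh.Z_eq_0[of 1] by (simp add: linear_injective_0[OF lin1])
    then have "surj (D 1 y)" by (rule linear_inj_imp_surj[OF lin1])
    then obtain u where u: "D 1 y u = (0, p)" by (metis surjD)
    obtain K where K: "\<And>t. t \<ge> 0 \<Longrightarrow> norm (D t z (0, p)) \<le> K" using p unfolding bounded_vectors_def by blast
    \<comment> \<open>From time 1 on, \<open>D t y u\<close> is the bounded solution through
      \<open>(0, p)\<close>; on the first unit of time Gronwall supplies the bound.\<close>
    have "u = 0"
    proof (rule lh.vertical_unbounded[where s = 1 and K = "max K (norm u * exp (2 * L + 1))"])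
      fix t :: real assume t: "t \<ge> 0"
      show "norm (D t y u) \<le> max K (norm u * exp (2 * L + 1))"
      proof (cases "t \<ge> 1")
        case True
        have "D (t - 1 + 1) y u = D (t - 1) (\<Phi> 1 y) (D 1 y u)"
          by (rule D_add[OF yc]) (use True in auto)
        then show ?thesis using K[of "t - 1"] True by (simp add: yz u)
      next
        case False
        have "norm (D t y u) \<le> norm u * exp ((2 * L + 1) * t)" by (rule D_le[OF yc t])
        also have "\<dots> \<le> norm u * exp ((2 * L + 1) * 1)"
          using False L_nonneg by (intro mult_left_mono) auto
        finally show ?thesis by simp
      qed
    qed (use u in auto)
    then show "p = 0" using u linear_0[OF lin1] by (simp add: zero_prod_def)
  qed
  show "v \<in> bounded_vectors z" if "\<And>n. cotangent_of (\<alpha> n) \<in> N" "\<And>n. cotangent_of (\<beta> n) \<in> N" "\<alpha> \<longlonglongrightarrow> z" "\<beta> \<longlonglongrightarrow> z"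
      "\<And>n. \<epsilon> n > (0::real)" "(\<lambda>n. (\<alpha> n - \<beta> n) /\<^sub>R \<epsilon> n) \<longlonglongrightarrow> v" for \<alpha> \<beta> z \<epsilon> v
    by (rule paratingent_bounded[OF that])
qed (rule homeo lip_h')+

end

theorem corollary3:
  fixes H :: "(circle ^ 'n) \<times> (real ^ 'n) \<Rightarrow> real"
    and \<phi> :: "real \<Rightarrow> (circle ^ 'n) \<times> (real ^ 'n) \<Rightarrow> (circle ^ 'n) \<times> (real ^ 'n)"
    and \<T> :: "((circle ^ 'n) \<times> (real ^ 'n)) set"
    and T :: real
  assumes "tonelli H"
    and "hamiltonian_flow H \<phi>"
    and "lipschitz_torus \<T>"
    and "\<And>t. \<phi> t ` \<T> = \<T>"
    and "T > 0"
    and "\<exists>a. lipschitz_conjugated (UNIV :: (circle ^ 'n) set) (\<lambda>\<theta>. \<theta> + a) \<T> (\<phi> T)"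
    and "\<And>x. orbit \<phi> x \<subseteq> \<T> \<Longrightarrow> no_conjugate_points \<phi> (orbit \<phi> x)"
  shows "lagrangian \<T> \<and>
    (\<exists>s :: circle ^ 'n \<Rightarrow> real ^ 'n.
      Ck_on 1 UNIV (s \<circ> torus_of) \<and> \<T> = {(q, s q) | q. True})"
proof -
  obtain a C C' and h :: "circle ^ 'n \<Rightarrow> (circle ^ 'n) \<times> (real ^ 'n)" and h' where conj: "homeomorphism UNIV \<T> h h'" "C-lipschitz_on UNIV h" "C'-lipschitz_on \<T> h'"
    "\<And>\<theta>. h (\<theta> + a) = \<phi> T (h \<theta>)"
  proof -
    obtain a C C' and h :: "circle ^ 'n \<Rightarrow> (circle ^ 'n) \<times> (real ^ 'n)" and h' where "homeomorphism UNIV \<T> h h' \<and> C-lipschitz_on UNIV h \<and> C'-lipschitz_on \<T> h' \<and>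
        (\<forall>\<theta>\<in>UNIV. h (\<theta> + a) = \<phi> T (h \<theta>))"
      using assms(6) unfolding lipschitz_conjugated_def by blast
    then show thesis by (auto intro: that)
  qed
  \<comment> \<open>Invariance turns the hypothesis on orbits contained in the torus into one on the
    orbit of each of its points.\<close>
  have "orbit \<phi> x \<subseteq> \<T>" if "x \<in> \<T>" for x
    using assms(4) that unfolding orbit_def by blast
  then interpret conjugated_torus H \<phi> \<T> T a h h' C C'
    using assms conj by unfold_locales auto
  \<comment> \<open>The level comes first, since the Lipschitz constant \<open>L\<close> depends on
    it.\<close>
  obtain c where c: "\<And>z. cotangent_of z \<in> \<T> \<Longrightarrow> Hl z < c" by (rule energy_bound) blast
  obtain L where L: "lipschitz_flow X DX \<Phi> {z. Hl z < c} L" by (rule lipschitz_flow_sublevel)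
  interpret conjugated_torus_flow H \<phi> \<T> T a h h' C C' c L
    by (intro conjugated_torus_flow.intro conjugated_torus_flow_axioms.intro conjugated_torus_axioms L c)
  show ?thesis by (rule lagrangian_graph)
qed

end
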